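(* Let $d \geq 2$ be an integer and let $0 \leq t < d-1$. Then there exist compact sets $E \subset \mathbb{R}^{d-1}$ with $0 < \mathcal{H}^{t}(E) < \infty$ such that the conformal dimension of the measure $\nu := \mathcal{H}^{1+t}|_{[0,1]\times E}$ (the restriction of the $(1+t)$-dimensional Hausdorff measure to $[0,1]\times E \subset \mathbb{R}^{d}$) is zero: for any $\epsilon > 0$ there exists a quasisymmetric embedding $F \colon [0,1]\times E \to \mathbb{R}^{d}$ such that $\dim_{\mathrm{H}} F_{\sharp}\nu < \epsilon$.
   Context: $\mathcal{H}^{t}$ denotes $t$-dimensional Hausdorff measure and $\dim_{\mathrm{H}}$ of a set denotes Hausdorff dimension; subsets of Euclidean spaces carry the Euclidean metric. A map $f \colon (X,d) \to (Y,d')$ between metric spaces is quasisymmetric if there is a homeomorphism $\eta \colon [0,\infty) \to [0,\infty)$ such that $$\frac{d'(f(x),f(a))}{d'(f(x),f(b))} \leq \eta\left(\frac{d(x,a)}{d(x,b)}\right)$$ for all $x,a,b \in X$ with $x \neq b$. A quasisymmetric embedding is a quasisymmetric map which is a homeomorphism onto its image. For a Borel measure $\mu$, $\dim_{\mathrm{H}} \mu := \inf\{\dim_{\mathrm{H}} A : \mu(A^{c}) = 0\}$, and $f_{\sharp}\mu$ is the push-forward, $(f_{\sharp}\mu)(A) = \mu(f^{-1}(A))$ for Borel sets $A$. The conformal dimension of a locally finite Borel measure $\mu$ on a metric space $(X,d)$ is $\inf_{f} \dim_{\mathrm{H}} f_{\sharp}\mu$, where the infimum ranges over all quasisymmetric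 homeomorphisms $f$ between $(\operatorname{spt}\mu, d)$ and any metric space $(Y,d')$. *)

theory Defs
  imports "HOL-Analysis.Analysis"
begin

section \<open>Hausdorff measure and Hausdorff dimension\<close>

text \<open>Everything is stated for the abstract type \<open>'a metric\<close>, because the conformal dimension
  involves arbitrary target metrics. Subsets of Euclidean spaces are used through
  \<^const>\<open>euclidean_metric\<close> and \<^const>\<open>submetric\<close>.\<close>

definition ediam :: "'a metric \<Rightarrow> 'a set \<Rightarrow> ennreal" where
  "ediam m U = (SUP x\<in>U. SUP y\<in>U. ennreal (mdist m x y))"

text \<open>\<open>(diam U)\<^sup>s\<close> with the usual conventions: the empty set contributes 0, and
  \<open>(diam U)\<^sup>0 = 1\<close> for nonempty \<open>U\<close>, also when the diameter is 0 (Isabelle has \<open>0 powr 0 = 0\<close>), so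
  that the 0-dimensional measure is counting measure. The conversion to real is harmless, since
  only sets of finite diameter occur in the covers below.\<close>

definition diam_pow :: "'a metric \<Rightarrow> real \<Rightarrow> 'a set \<Rightarrow> ennreal" where
  "diam_pow m s U =
     (if U = {} then 0 else if s = 0 then 1 else ennreal (enn2real (ediam m U) powr s))"

definition fine_covers :: "'a metric \<Rightarrow> real \<Rightarrow> 'a set \<Rightarrow> (nat \<Rightarrow> 'a set) set" where
  "fine_covers m \<delta> A =
     {U. (\<forall>i. U i \<subseteq> mspace m \<and> ediam m (U i) \<le> ennreal \<delta>) \<and> A \<subseteq> (\<Union>i. U i)}"

definition hausdorff_premeasure :: "'a metric \<Rightarrow> real \<Rightarrow> real \<Rightarrow> 'a set \<Rightarrow> ennreal" where
  "hausdorff_premeasure m s \<delta> A = (INF U\<in>fine_covers m \<delta> A. \<Sum>i. diam_pow m s (U i))"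

definition hausdorff_outer :: "'a metric \<Rightarrow> real \<Rightarrow> 'a set \<Rightarrow> ennreal" where
  "hausdorff_outer m s A = (SUP \<delta>\<in>{0<..}. hausdorff_premeasure m s \<delta> A)"

definition borel_sets_of :: "'a topology \<Rightarrow> 'a set set" where
  "borel_sets_of T = sigma_sets (topspace T) {U. openin T U}"

text \<open>The Hausdorff measure as a Borel measure. Lemma \<open>emeasure_hausdorff_measure\<close> below shows that
  on Borel sets it does agree with \<^const>\<open>hausdorff_outer\<close>.\<close>

definition hausdorff_measure :: "'a metric \<Rightarrow> real \<Rightarrow> 'a measure" where
  "hausdorff_measure m s =
     measure_of (mspace m) (borel_sets_of (mtopology_of m)) (hausdorff_outer m s)"

definition hausdorff_dim :: "'a metric \<Rightarrow> 'a set \<Rightarrow> ennreal" where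
  "hausdorff_dim m A = Inf {ennreal s | s. 0 \<le> s \<and> hausdorff_outer m s A = 0}"

text \<open>The measure \<open>\<mu>\<close> is meant to be a Borel measure on the metric space \<open>m\<close>.\<close>

definition measure_hausdorff_dim :: "'a metric \<Rightarrow> 'a measure \<Rightarrow> ennreal" where
  "measure_hausdorff_dim m \<mu> =
     (INF A\<in>{A \<in> sets \<mu>. emeasure \<mu> (space \<mu> - A) = 0}. hausdorff_dim m A)"


section \<open>Quasisymmetric maps\<close>

text \<open>The quotient \<open>d'(f x, f a) / d'(f x, f b)\<close> presupposes \<open>f x \<noteq> f b\<close>. This is made explicit,
  since otherwise constant maps would qualify because of \<open>x / 0 = 0\<close>.\<close>

definition quasisymmetric :: "'a metric \<Rightarrow> 'b metric \<Rightarrow> ('a \<Rightarrow> 'b) \<Rightarrow> bool" where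
  "quasisymmetric m m' f \<longleftrightarrow>
     f ` mspace m \<subseteq> mspace m' \<and>
     (\<exists>\<eta>. homeomorphic_map (top_of_set {0..}) (top_of_set {0..}) (\<eta> :: real \<Rightarrow> real) \<and>
        (\<forall>x\<in>mspace m. \<forall>a\<in>mspace m. \<forall>b\<in>mspace m. x \<noteq> b \<longrightarrow>
           f x \<noteq> f b \<and>
           mdist m' (f x) (f a) / mdist m' (f x) (f b) \<le> \<eta> (mdist m x a / mdist m x b)))"

definition quasisymmetric_embedding :: "'a metric \<Rightarrow> 'b metric \<Rightarrow> ('a \<Rightarrow> 'b) \<Rightarrow> bool" where
  "quasisymmetric_embedding m m' f \<longleftrightarrow>
     quasisymmetric m m' f \<and> embedding_map (mtopology_of m) (mtopology_of m') f"

definition quasisymmetric_homeo :: "'a metric \<Rightarrow> 'b metric \<Rightarrow> ('a \<Rightarrow> 'b) \<Rightarrow> bool" where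
  "quasisymmetric_homeo m m' f \<longleftrightarrow>
     quasisymmetric m m' f \<and> homeomorphic_map (mtopology_of m) (mtopology_of m') f"


section \<open>Conformal dimension of a measure\<close>

definition spt :: "'a metric \<Rightarrow> 'a measure \<Rightarrow> 'a set" where
  "spt m \<mu> = {x \<in> mspace m. \<forall>U. openin (mtopology_of m) U \<and> x \<in> U \<longrightarrow> emeasure \<mu> U > 0}"

definition borel_pushforward :: "'a measure \<Rightarrow> 'b metric \<Rightarrow> ('a \<Rightarrow> 'b) \<Rightarrow> 'b measure" where
  "borel_pushforward \<mu> m' f = distr \<mu> (sigma (mspace m') (borel_sets_of (mtopology_of m'))) f"

text \<open>The infimum ranges over target spaces \<open>m'\<close> whose points are of the same type as those of \<open>m\<close>.
  This is no loss of generality: a target \<open>Y\<close> homeomorphic to the support of \<open>\<mu>\<close> is in bijection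
  with it, so that \<open>Y\<close> is isometric to the support of \<open>\<mu>\<close> with the metric of \<open>Y\<close> transported to it.\<close>

definition conformal_dim :: "'a metric \<Rightarrow> 'a measure \<Rightarrow> ennreal" where
  "conformal_dim m \<mu> =
     Inf {measure_hausdorff_dim m' (borel_pushforward (restrict_space \<mu> (spt m \<mu>)) m' f)
          | (m' :: 'a metric) f. quasisymmetric_homeo (submetric m (spt m \<mu>)) m' f}"


section \<open>Hausdorff measure is a Borel measure\<close>

interpretation pm: Metric_space "mspace m" "mdist m" for m :: "'a metric"
  by (rule Metric_space_mspace_mdist)

lemma diam_pow_empty [simp]: "diam_pow m s {} = 0"
  by (simp add: diam_pow_def)

lemma ediam_empty [simp]: "ediam m {} = 0"
  by (simp add: ediam_def bot_ennreal)

lemma ediam_ge: "x \<in> U \<Longrightarrow> y \<in> U \<Longrightarrow> ennreal (mdist m x y) \<le> ediam m U"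
  unfolding ediam_def by (meson SUP_upper2 order_refl)

lemma fine_covers_empty: "(\<lambda>_. {}) \<in> fine_covers m \<delta> {}"
  by (simp add: fine_covers_def)

lemma hausdorff_premeasure_empty [simp]: "hausdorff_premeasure m s \<delta> {} = 0"
proof -
  have "hausdorff_premeasure m s \<delta> {} \<le> (\<Sum>i::nat. diam_pow m s {})"
    unfolding hausdorff_premeasure_def by (rule INF_lower[OF fine_covers_empty])
  then show ?thesis by simp
qed

lemma hausdorff_premeasure_mono:
  "A \<subseteq> B \<Longrightarrow> hausdorff_premeasure m s \<delta> A \<le> hausdorff_premeasure m s \<delta> B"
  unfolding hausdorff_premeasure_def
  by (rule INF_superset_mono) (auto simp: fine_covers_def)

lemma hausdorff_premeasure_antimono:
  "\<delta> \<le> \<delta>' \<Longrightarrow> hausdorff_premeasure m s \<delta>' A \<le> hausdorff_premeasure m s \<delta> A"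
  unfolding hausdorff_premeasure_def
  by (rule INF_superset_mono) (auto simp: fine_covers_def intro: order_trans ennreal_leI)

lemma hausdorff_outer_empty [simp]: "hausdorff_outer m s {} = 0"
  by (simp add: hausdorff_outer_def)

lemma hausdorff_outer_mono: "A \<subseteq> B \<Longrightarrow> hausdorff_outer m s A \<le> hausdorff_outer m s B"
  unfolding hausdorff_outer_def by (intro SUP_mono') (rule hausdorff_premeasure_mono)

lemma ennreal_less_add_pos:
  fixes a b :: ennreal
  assumes "a < top" "0 < b"
  shows "a < a + b"
  using ennreal_add_left_cancel_less[of a 0 b] assms by simp

lemma hausdorff_premeasure_UN:
  "hausdorff_premeasure m s \<delta> (\<Union>n::nat. A n) \<le> (\<Sum>n. hausdorff_premeasure m s \<delta> (A n))"
proof (rule ennreal_le_epsilon)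
  fix e :: real assume e: "0 < e" and fin: "(\<Sum>n. hausdorff_premeasure m s \<delta> (A n)) < top"
  have "\<exists>U\<in>fine_covers m \<delta> (A n). (\<Sum>i. diam_pow m s (U i))
          \<le> hausdorff_premeasure m s \<delta> (A n) + ennreal (e * (1/2) ^ Suc n)" for n
  proof -
    have "hausdorff_premeasure m s \<delta> (A n) < top"
      using fin by (metis ennreal_suminf_lessD)
    moreover have "0 < ennreal (e * (1/2) ^ Suc n)" using e by simp
    ultimately have "hausdorff_premeasure m s \<delta> (A n)
        < hausdorff_premeasure m s \<delta> (A n) + ennreal (e * (1/2) ^ Suc n)"
      by (rule ennreal_less_add_pos)
    then show ?thesis
      unfolding hausdorff_premeasure_def[of _ _ _ "A n"] INF_less_iff by (meson less_imp_le)
  qed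
  then obtain U where U: "\<And>n. U n \<in> fine_covers m \<delta> (A n)"
    "\<And>n. (\<Sum>i. diam_pow m s (U n i))
          \<le> hausdorff_premeasure m s \<delta> (A n) + ennreal (e * (1/2) ^ Suc n)"
    by metis
  define V where "V k = U (fst (prod_decode k)) (snd (prod_decode k))" for k
  have V: "V \<in> fine_covers m \<delta> (\<Union>n. A n)"
  proof -
    have "\<exists>k. x \<in> V k" if "x \<in> A n" for x n
    proof -
      obtain i where "x \<in> U n i" using U(1)[of n] \<open>x \<in> A n\<close> by (auto simp: fine_covers_def)
      then have "x \<in> V (prod_encode (n, i))" by (simp add: V_def)
      then show ?thesis ..
    qed
    then show ?thesis using U(1) by (auto simp: fine_covers_def V_def)
  qed
  have "hausdorff_premeasure m s \<delta> (\<Union>n. A n) \<le> (\<Sum>k. diam_pow m s (V k))"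
    unfolding hausdorff_premeasure_def by (rule INF_lower[OF V])
  also have "\<dots> = (\<Sum>n. \<Sum>i. diam_pow m s (U n i))"
    using suminf_ennreal_2dimen[of "\<lambda>n. \<Sum>i. diam_pow m s (U n i)" "\<lambda>(n, i). diam_pow m s (U n i)"]
    by (simp add: V_def comp_def case_prod_beta)
  also have "\<dots> \<le> (\<Sum>n. hausdorff_premeasure m s \<delta> (A n) + ennreal (e * (1/2) ^ Suc n))"
    by (intro suminf_le U(2)) auto
  also have "\<dots> = (\<Sum>n. hausdorff_premeasure m s \<delta> (A n)) + (\<Sum>n. ennreal (e * (1/2) ^ Suc n))"
    by (intro suminf_add[symmetric]) auto
  also have "(\<Sum>n. ennreal (e * (1/2) ^ Suc n)) = ennreal e"
  proof -
    have "(\<lambda>n. e * (1/2) ^ Suc n) sums (e * 1)"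
      by (intro sums_mult power_half_series)
    then show ?thesis using e by (intro suminf_ennreal_eq) auto
  qed
  finally show "hausdorff_premeasure m s \<delta> (\<Union>n. A n)
      \<le> (\<Sum>n. hausdorff_premeasure m s \<delta> (A n)) + ennreal e" .
qed

lemma hausdorff_outer_UN:
  "hausdorff_outer m s (\<Union>n::nat. A n) \<le> (\<Sum>n. hausdorff_outer m s (A n))"
  unfolding hausdorff_outer_def[of _ _ "\<Union>n. A n"]
proof (rule SUP_least)
  fix \<delta> :: real assume \<delta>: "\<delta> \<in> {0<..}"
  have "hausdorff_premeasure m s \<delta> (\<Union>n. A n) \<le> (\<Sum>n. hausdorff_premeasure m s \<delta> (A n))"
    by (rule hausdorff_premeasure_UN)
  also have "\<dots> \<le> (\<Sum>n. hausdorff_outer m s (A n))"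
    unfolding hausdorff_outer_def by (intro suminf_le SUP_upper[OF \<delta>]) auto
  finally show "hausdorff_premeasure m s \<delta> (\<Union>n. A n) \<le> (\<Sum>n. hausdorff_outer m s (A n))" .
qed

lemma hausdorff_outer_Un:
  "hausdorff_outer m s (A \<union> B) \<le> hausdorff_outer m s A + hausdorff_outer m s B"
proof -
  define C where "C n = (if n = 0 then A else if n = 1 then B else {})" for n :: nat
  have eq: "A \<union> B = (\<Union>n. C n)"
    by (auto simp: C_def split: if_splits intro: exI[of _ 0] exI[of _ 1])
  have "hausdorff_outer m s (A \<union> B) \<le> (\<Sum>n. hausdorff_outer m s (C n))"
    unfolding eq by (rule hausdorff_outer_UN)
  also have "\<dots> = (\<Sum>n\<in>{0,1}. hausdorff_outer m s (C n))"
    by (rule suminf_finite) (auto simp: C_def)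
  also have "\<dots> = hausdorff_outer m s A + hausdorff_outer m s B"
    by (simp add: C_def)
  finally show ?thesis .
qed

lemma hausdorff_premeasure_separated:
  assumes r: "0 < r" and sep: "\<And>x y. x \<in> A \<Longrightarrow> y \<in> B \<Longrightarrow> r \<le> mdist m x y"
    and \<delta>: "0 < \<delta>" "\<delta> < r"
  shows "hausdorff_premeasure m s \<delta> A + hausdorff_premeasure m s \<delta> B
           \<le> hausdorff_premeasure m s \<delta> (A \<union> B)"
  unfolding hausdorff_premeasure_def[of _ _ _ "A \<union> B"]
proof (rule INF_greatest)
  fix U assume U: "U \<in> fine_covers m \<delta> (A \<union> B)"
  define V where "V i = (if U i \<inter> A \<noteq> {} then U i else {})" for i
  define W where "W i = (if U i \<inter> A \<noteq> {} then {} else U i)" for i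
  have meet: "U i \<inter> B = {}" if "U i \<inter> A \<noteq> {}" for i
  proof (rule ccontr)
    assume "U i \<inter> B \<noteq> {}"
    with that obtain x y where xy: "x \<in> U i" "x \<in> A" "y \<in> U i" "y \<in> B" by blast
    have "ennreal (mdist m x y) \<le> ennreal \<delta>"
      using ediam_ge[OF xy(1,3), of m] U by (auto simp: fine_covers_def intro: order_trans)
    then have "mdist m x y \<le> \<delta>" using \<delta> by (simp add: ennreal_le_iff)
    with sep[OF xy(2,4)] \<delta> show False by simp
  qed
  have V: "V \<in> fine_covers m \<delta> A"
  proof -
    have "x \<in> (\<Union>i. V i)" if "x \<in> A" for x
    proof -
      obtain i where "x \<in> U i" using U \<open>x \<in> A\<close> by (auto simp: fine_covers_def)
      then have "x \<in> V i" using \<open>x \<in> A\<close> by (auto simp: V_def)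
      then show ?thesis by blast
    qed
    then show ?thesis using U by (auto simp: fine_covers_def V_def)
  qed
  have W: "W \<in> fine_covers m \<delta> B"
  proof -
    have "x \<in> (\<Union>i. W i)" if "x \<in> B" for x
    proof -
      obtain i where "x \<in> U i" using U \<open>x \<in> B\<close> by (auto simp: fine_covers_def)
      then have "x \<in> W i" using \<open>x \<in> B\<close> meet[of i] by (auto simp: W_def)
      then show ?thesis by blast
    qed
    then show ?thesis using U by (auto simp: fine_covers_def W_def)
  qed
  have "hausdorff_premeasure m s \<delta> A + hausdorff_premeasure m s \<delta> B
          \<le> (\<Sum>i. diam_pow m s (V i)) + (\<Sum>i. diam_pow m s (W i))"
    unfolding hausdorff_premeasure_def by (intro add_mono INF_lower V W)
  also have "\<dots> = (\<Sum>i. diam_pow m s (V i) + diam_pow m s (W i))"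
    by (rule suminf_add) auto
  also have "\<dots> = (\<Sum>i. diam_pow m s (U i))"
    by (intro suminf_cong) (simp add: V_def W_def)
  finally show "hausdorff_premeasure m s \<delta> A + hausdorff_premeasure m s \<delta> B
      \<le> (\<Sum>i. diam_pow m s (U i))" .
qed

lemma hausdorff_outer_separated:
  assumes r: "0 < r" and sep: "\<And>x y. x \<in> A \<Longrightarrow> y \<in> B \<Longrightarrow> r \<le> mdist m x y"
  shows "hausdorff_outer m s A + hausdorff_outer m s B \<le> hausdorff_outer m s (A \<union> B)"
proof -
  have *: "hausdorff_premeasure m s \<delta> A + hausdorff_premeasure m s \<delta>' B
          \<le> hausdorff_outer m s (A \<union> B)" if "0 < \<delta>" "0 < \<delta>'" for \<delta> \<delta>'
  proof -
    define \<epsilon> where "\<epsilon> = min (min \<delta> \<delta>') (r / 2)"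
    have \<epsilon>: "0 < \<epsilon>" "\<epsilon> < r" "\<epsilon> \<le> \<delta>" "\<epsilon> \<le> \<delta>'" using that r by (auto simp: \<epsilon>_def)
    have "hausdorff_premeasure m s \<delta> A + hausdorff_premeasure m s \<delta>' B
        \<le> hausdorff_premeasure m s \<epsilon> A + hausdorff_premeasure m s \<epsilon> B"
      by (intro add_mono hausdorff_premeasure_antimono \<epsilon>)
    also have "\<dots> \<le> hausdorff_premeasure m s \<epsilon> (A \<union> B)"
      by (rule hausdorff_premeasure_separated[OF r sep \<epsilon>(1,2)])
    also have "\<dots> \<le> hausdorff_outer m s (A \<union> B)"
      unfolding hausdorff_outer_def by (rule SUP_upper) (use \<epsilon> in auto)
    finally show ?thesis .
  qed
  have ne: "{0<..} \<noteq> ({} :: real set)" by (simp add: ex_in_conv[symmetric] gt_ex)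
  have "hausdorff_premeasure m s \<delta> A + hausdorff_outer m s B \<le> hausdorff_outer m s (A \<union> B)"
    if "0 < \<delta>" for \<delta>
    unfolding hausdorff_outer_def[of _ _ B]
    by (subst ennreal_SUP_add_right[OF ne]) (use * that in \<open>auto intro!: SUP_least\<close>)
  then show ?thesis
    unfolding hausdorff_outer_def[of _ _ A]
    by (subst ennreal_SUP_add_left[OF ne, symmetric]) (auto intro!: SUP_least)
qed

lemma hausdorff_outer_closed_split:
  assumes C: "closedin (mtopology_of m) C" and A: "A \<subseteq> mspace m"
  shows "hausdorff_outer m s (A \<inter> C) + hausdorff_outer m s (A - C) \<le> hausdorff_outer m s A"
proof (cases "hausdorff_outer m s A = top")
  case False
  let ?H = "hausdorff_outer m s"
  define P where "P n = {x \<in> A - C. \<forall>c\<in>C. inverse (real (Suc n)) \<le> mdist m x c}" for n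
  define R where "R n = P (Suc n) - P n" for n
  have CM: "C \<subseteq> mspace m" using closedin_subset[OF C] by simp
  have P_mono: "P n \<subseteq> P (Suc n)" for n
  proof -
    have "inverse (real (Suc (Suc n))) \<le> inverse (real (Suc n))" by (rule le_imp_inverse_le) auto
    then show ?thesis unfolding P_def using order_trans by blast
  qed
  have PA: "P n \<subseteq> A - C" for n by (auto simp: P_def)
  have step: "?H (P (Suc n)) + ?H (R (Suc (Suc n))) \<le> ?H (P (Suc (Suc (Suc n))))" for n
  proof -
    define r where "r = inverse (real (Suc (Suc n))) - inverse (real (Suc (Suc (Suc n))))"
    have r: "0 < r" unfolding r_def by (simp add: less_imp_inverse_less)
    have "r \<le> mdist m x y" if x: "x \<in> P (Suc n)" and y: "y \<in> R (Suc (Suc n))" for x y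
    proof -
      have "y \<in> A - C" using y PA by (auto simp: R_def)
      moreover have "y \<notin> P (Suc (Suc n))" using y by (simp add: R_def)
      ultimately obtain c where c: "c \<in> C" "mdist m y c < inverse (real (Suc (Suc (Suc n))))"
        by (auto simp: P_def not_le)
      have "inverse (real (Suc (Suc n))) \<le> mdist m x c" using x c(1) by (auto simp: P_def)
      moreover have "mdist m x c \<le> mdist m x y + mdist m y c"
        using x \<open>y \<in> A - C\<close> c(1) PA A CM by (intro pm.triangle) auto
      ultimately show ?thesis using c(2) by (simp add: r_def)
    qed
    then have "?H (P (Suc n)) + ?H (R (Suc (Suc n))) \<le> ?H (P (Suc n) \<union> R (Suc (Suc n)))"
      by (rule hausdorff_outer_separated[OF r])
    also have "\<dots> \<le> ?H (P (Suc (Suc (Suc n))))"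
      by (rule hausdorff_outer_mono) (use P_mono in \<open>auto simp: R_def\<close>)
    finally show ?thesis .
  qed
  have sums: "(\<Sum>k<N. ?H (R (k + 2))) \<le> ?H (P (Suc N)) + ?H (P (Suc (Suc N)))" for N
  proof (induction N)
    case (Suc N)
    have "(\<Sum>k<Suc N. ?H (R (k + 2)))
        \<le> ?H (P (Suc (Suc N))) + (?H (P (Suc N)) + ?H (R (Suc (Suc N))))"
      using add_right_mono[OF Suc.IH, of "?H (R (Suc (Suc N)))"] by (simp add: ac_simps)
    also have "\<dots> \<le> ?H (P (Suc (Suc N))) + ?H (P (Suc (Suc (Suc N))))"
      by (intro add_left_mono step)
    finally show ?case .
  qed simp
  define T where "T = (\<Sum>k. ?H (R (k + 2)))"
  have "T \<le> ?H A + ?H A"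
    unfolding T_def
  proof (rule suminf_le_const)
    fix N
    show "(\<Sum>k<N. ?H (R (k + 2))) \<le> ?H A + ?H A"
      using sums[of N] PA
      by (meson Diff_subset add_mono hausdorff_outer_mono order_trans)
  qed simp
  moreover have "?H A + ?H A < top" using False by (simp add: top.not_eq_extremum)
  ultimately have T: "T < top" by (rule le_less_trans)
  define S where "S n = (\<Sum>k<n. ?H (R (k + 2)))" for n
  define tl where "tl n = (\<Sum>k. ?H (R (k + n + 2)))" for n
  have split: "T = S n + tl n" for n
    unfolding T_def S_def tl_def
    using suminf_offset[of "\<lambda>k. ?H (R (k + 2))" n] by (simp add: add.commute)
  have "S \<longlonglongrightarrow> T"
    unfolding S_def T_def by (rule summable_LIMSEQ) simp
  then have "(\<lambda>n. T - S n) \<longlonglongrightarrow> T - T"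
    using T by (intro tendsto_diff_ennreal tendsto_const) auto
  moreover have "T - S n = tl n" for n
  proof -
    have "S n < top" using split[of n] T by (metis ennreal_add_eq_top top.not_eq_extremum)
    then show ?thesis by (simp add: split[of n] top.not_eq_extremum)
  qed
  ultimately have tl0: "tl \<longlonglongrightarrow> 0" using T by simp
  have cover: "A - C \<subseteq> P (n + 2) \<union> (\<Union>k. R (k + n + 2))" for n
  proof
    fix x assume x: "x \<in> A - C"
    have "openin (mtopology_of m) (mspace m - C)" using C by (simp add: closedin_def)
    then obtain e where e: "e > 0" "pm.mball m x e \<subseteq> mspace m - C"
      using x A by (auto simp: mtopology_of_def pm.openin_mtopology)
    obtain N where N: "inverse (real (Suc N)) < e" using reals_Archimedean[OF e(1)] by auto
    have xP: "x \<in> P N"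
    proof -
      have "inverse (real (Suc N)) \<le> mdist m x c" if "c \<in> C" for c
      proof (rule ccontr)
        assume "\<not> ?thesis"
        then have "c \<in> pm.mball m x e" using N that x A CM by (auto simp: pm.in_mball)
        then show False using e(2) that by auto
      qed
      then show ?thesis using x by (simp add: P_def)
    qed
    have "\<exists>j. x \<in> P j" using xP ..
    define j where "j = (LEAST j. x \<in> P j)"
    have j: "x \<in> P j" unfolding j_def using xP by (rule LeastI)
    have least: "x \<notin> P i" if "i < j" for i using that not_less_Least unfolding j_def by blast
    show "x \<in> P (n + 2) \<union> (\<Union>k. R (k + n + 2))"
    proof (cases "j \<le> n + 2")
      case True
      have "P j \<subseteq> P (n + 2)" by (rule lift_Suc_mono_le[of P, OF P_mono True])
      then show ?thesis using j by auto
    next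
      case False
      then obtain k where k: "j = Suc (k + n + 2)"
        by (metis add.assoc add.commute less_imp_Suc_add not_le)
      then have "x \<in> R (k + n + 2)" using j least by (simp add: R_def)
      then show ?thesis by auto
    qed
  qed
  have bound: "?H (A \<inter> C) + ?H (A - C) \<le> ?H A + tl n" for n
  proof -
    have "?H (A - C) \<le> ?H (P (n + 2)) + ?H (\<Union>k. R (k + n + 2))"
      using hausdorff_outer_mono[OF cover] hausdorff_outer_Un order_trans by blast
    also have "\<dots> \<le> ?H (P (n + 2)) + tl n"
      unfolding tl_def by (intro add_left_mono hausdorff_outer_UN)
    finally have "?H (A \<inter> C) + ?H (A - C) \<le> ?H (A \<inter> C) + ?H (P (n + 2)) + tl n"
      by (simp add: add.assoc add_left_mono)
    also have "?H (A \<inter> C) + ?H (P (n + 2)) \<le> ?H (A \<inter> C \<union> P (n + 2))"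
    proof (rule hausdorff_outer_separated)
      show "0 < inverse (real (Suc (n + 2)))" by simp
      show "inverse (real (Suc (n + 2))) \<le> mdist m x y" if "x \<in> A \<inter> C" "y \<in> P (n + 2)" for x y
        using that by (auto simp: P_def pm.commute)
    qed
    also have "?H (A \<inter> C \<union> P (n + 2)) \<le> ?H A"
      by (rule hausdorff_outer_mono) (use PA in auto)
    finally show ?thesis by (simp add: add_right_mono)
  qed
  have "(\<lambda>n. ?H A + tl n) \<longlonglongrightarrow> ?H A + 0"
    by (intro tendsto_add tl0 tendsto_const)
  then show ?thesis
    using bound by (intro LIMSEQ_le_const[where X = "\<lambda>n. ?H A + tl n"]) auto
qed simp

lemma measure_space_hausdorff:
  "measure_space (mspace m) (borel_sets_of (mtopology_of m)) (hausdorff_outer m s)"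
proof -
  let ?H = "hausdorff_outer m s"
  interpret Pow: sigma_algebra "mspace m" "Pow (mspace m)" by (rule sigma_algebra_Pow)
  have outer: "outer_measure_space (Pow (mspace m)) ?H"
    unfolding outer_measure_space_def
    by (auto simp: positive_def increasing_def countably_subadditive_def
        intro: hausdorff_outer_mono hausdorff_outer_UN)
  define L where "L = lambda_system (mspace m) (Pow (mspace m)) ?H"
  have L: "measure_space (mspace m) L ?H"
    unfolding L_def using Pow.caratheodory_lemma[OF outer] .
  then interpret L: sigma_algebra "mspace m" L by (simp add: measure_space_def)
  have closed: "C \<in> L" if C: "closedin (mtopology_of m) C" for C
  proof -
    have "?H (C \<inter> A) + ?H ((mspace m - C) \<inter> A) = ?H A" if "A \<subseteq> mspace m" for A
    proof (rule antisym)
      have eq: "C \<inter> A = A \<inter> C" "(mspace m - C) \<inter> A = A - C" using that by auto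
      show "?H (C \<inter> A) + ?H ((mspace m - C) \<inter> A) \<le> ?H A"
        unfolding eq by (rule hausdorff_outer_closed_split[OF C that])
      show "?H A \<le> ?H (C \<inter> A) + ?H ((mspace m - C) \<inter> A)"
        unfolding eq using hausdorff_outer_Un[of m s "A \<inter> C" "A - C"] by (simp add: Int_Diff_Un)
    qed
    then show ?thesis
      using closedin_subset[OF C] by (auto simp: L_def lambda_system_def)
  qed
  have "openin (mtopology_of m) U \<Longrightarrow> U \<in> L" for U
  proof -
    assume U: "openin (mtopology_of m) U"
    have "closedin (mtopology_of m) (mspace m - U)"
      using openin_closedin_eq[of "mtopology_of m" U] U by simp
    then have "mspace m - (mspace m - U) \<in> L"
      by (intro L.compl_sets closed)
    moreover have "U \<subseteq> mspace m" using openin_subset[OF U] by simp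
    ultimately show "U \<in> L" by (simp add: double_diff)
  qed
  then have sub: "borel_sets_of (mtopology_of m) \<subseteq> L"
    unfolding borel_sets_of_def by (auto intro!: L.sigma_sets_subset)
  have "sigma_algebra (mspace m) (borel_sets_of (mtopology_of m))"
    unfolding borel_sets_of_def topspace_mtopology_of
    by (rule sigma_algebra_sigma_sets) (use openin_subset in fastforce)
  then show ?thesis using measure_down[OF L _ sub] by simp
qed

lemma space_hausdorff_measure [simp]: "space (hausdorff_measure m s) = mspace m"
  using measure_space_hausdorff[of m s]
  by (simp add: hausdorff_measure_def measure_space_def space_measure_of_conv)

lemma sets_hausdorff_measure: "sets (hausdorff_measure m s) = borel_sets_of (mtopology_of m)"
  using measure_space_hausdorff[of m s]
  by (simp add: hausdorff_measure_def measure_space_def sigma_algebra.sets_measure_of_eq)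

lemma emeasure_hausdorff_measure:
  assumes "A \<in> borel_sets_of (mtopology_of m)"
  shows "emeasure (hausdorff_measure m s) A = hausdorff_outer m s A"
  using measure_space_hausdorff[of m s] assms unfolding hausdorff_measure_def measure_space_def
  by (intro emeasure_measure_of_sigma) auto

lemma sets_hausdorff_measure_euclidean: "sets (hausdorff_measure euclidean_metric s) = sets borel"
  by (simp add: sets_hausdorff_measure borel_sets_of_def borel_def)

end

theory Submission
  imports Defs
begin

text \<open>The set \<open>E\<close> is a Cantor set in which long ranges of scales where it looks like a lattice alternate
  with long ranges where it looks like a single point, the proportion being chosen so that
  \<open>0 < \<H>\<^sup>t(E) < \<infinity>\<close>. On the latter ranges \<open>[0,1] \<times> E\<close> looks like a segment. There we may use a singular
  quasisymmetric map \<open>f\<close> of the line, namely the distribution function of a triadic cascade with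
  weights \<open>\<delta>, 1 - 2\<delta>, \<delta>\<close>, which contracts typical intervals by an arbitrarily large exponent. On
  the lattice ranges the cascade has equal weights, so that \<open>f\<close> is locally a similarity, and
  the map \<open>(x, y) \<mapsto> (f x, \<Sum>\<^sub>j m\<^sub>j(x) y\<^sub>j)\<close>, where \<open>y\<^sub>j\<close> is the part of \<open>y\<close> from the \<open>j\<close>-th lattice range and
  \<open>m\<^sub>j(x)\<close> is the scaling factor of \<open>f\<close> near \<open>x\<close> at that range, continues \<open>f\<close> to the product. It moves
  points at distance \<open>3\<^sup>-\<^sup>k\<close> to a distance comparable with the \<open>f\<close>-image of the triadic interval of
  length \<open>3\<^sup>-\<^sup>k\<close>, which gives quasisymmetry. A few equal weights before each lattice range make the
  \<open>m\<^sub>j\<close> vary so slowly that the slopes are summable. A moment estimate shows that \<open>f\<close> contracts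
  strongly on all but a negligible part of the columns at the beginning of each lattice range, and
  counting cells shows that the image of the rest has small dimension.\<close>


section \<open>Triadic cascades\<close>

text \<open>The order of choices shapes the proof: one set has to serve every \<epsilon>, so
  \<open>s\<close> and \<open>e\<close> come from \<open>t\<close> and the number of vertical
  coordinates alone, and only \<open>\<delta>\<close> and \<open>j0\<close>, hence the map, depend
  on the wanted dimension. This works because \<open>s j\<close> is \<open>K * j\<^sup>2\<close>
  while the \<open>j\<close>-th burst of unequal weights has length \<open>j\<close>: bursts fill a
  positive proportion of all scales, so shrinking \<open>\<delta>\<close> yields any contraction
  exponent. The mass of a triadic interval jumps from one interval to the next; hence the scaling
  factors are built from the infimal convolution \<open>M\<close>, which is Lipschitz with respect
  to \<open>f\<close> rather than to \<open>x\<close>, so that horizontal errors of the second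
  coordinate are always paid for by the first. Starting the bursts only at \<open>j0\<close> lets
  the spare levels absorb the factor \<open>\<delta>\<^sup>2\<close> lost between \<open>M\<close>
  and the masses. In each period the free digits precede the vanishing ones, so their share among
  the first \<open>k\<close> digits is locally smallest at \<open>k = s j\<close>. Prescribing it
  there up to a bounded number of digits gives positive measure, and covering at these scales alone
  gives finite measure.\<close>

locale cascade =
  fixes \<delta> :: real and B :: "nat set"
  assumes \<delta>_pos: "0 < \<delta>" and \<delta>_le: "\<delta> \<le> 1/4"
begin

definition w :: "nat \<Rightarrow> int \<Rightarrow> real" where
  "w k r = (if k \<in> B then (if r = 1 then 1 - 2 * \<delta> else \<delta>) else 1/3)"

primrec W :: "nat \<Rightarrow> int \<Rightarrow> real" where
  "W 0 i = 1"
| "W (Suc k) i = W k (i div 3) * w k (i mod 3)"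

text \<open>The distribution function at \<open>i/3\<^sup>k\<close> of the measure that gives the interval
  \<open>[i/3\<^sup>k, (i+1)/3\<^sup>k]\<close> the mass \<open>W k i\<close>; being 1-periodic, it has no boundary intervals.\<close>

primrec S :: "nat \<Rightarrow> int \<Rightarrow> real" where
  "S 0 i = of_int i"
| "S (Suc k) i = S k (i div 3) + W k (i div 3) *
     (if i mod 3 = 0 then 0 else if i mod 3 = 1 then w k 0 else w k 0 + w k 1)"

text \<open>The bound \<delta> \<le> 1/4 puts 1/3 into the same range, so the geometric rates below
  hold at every level, with equal or unequal weights.\<close>

lemma w_bounds: "\<delta> \<le> w k r" "w k r \<le> 1 - 2 * \<delta>" "0 < w k r"
  using \<delta>_pos \<delta>_le by (auto simp: w_def)

lemma w_sum: "w k 0 + w k 1 + w k 2 = 1"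
  by (simp add: w_def)

lemma W_pos: "0 < W k i"
  by (induction k arbitrary: i) (auto simp: w_bounds)

lemma W_Suc_bounds: "W (Suc k) i \<le> (1 - 2 * \<delta>) * W k (i div 3)" "\<delta> * W k (i div 3) \<le> W (Suc k) i"
  using w_bounds[of k "i mod 3"] W_pos[of k "i div 3"] by (auto simp: mult.commute)

lemma W_le: "W k i \<le> (1 - 2 * \<delta>) ^ k"
proof (induction k arbitrary: i)
  case (Suc k)
  have "W (Suc k) i \<le> (1 - 2 * \<delta>) * W k (i div 3)" by (rule W_Suc_bounds)
  also have "\<dots> \<le> (1 - 2 * \<delta>) * (1 - 2 * \<delta>) ^ k" using Suc \<delta>_le by (intro mult_left_mono) auto
  finally show ?case by simp
qed simp

lemma int_mod_3_cases:
  fixes i :: int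
  obtains "i mod 3 = 0" "(i + 1) mod 3 = 1" "(i + 1) div 3 = i div 3"
  | "i mod 3 = 1" "(i + 1) mod 3 = 2" "(i + 1) div 3 = i div 3"
  | "i mod 3 = 2" "(i + 1) mod 3 = 0" "(i + 1) div 3 = i div 3 + 1"
proof -
  have "i mod 3 = 0 \<and> (i + 1) mod 3 = 1 \<and> (i + 1) div 3 = i div 3 \<or>
    i mod 3 = 1 \<and> (i + 1) mod 3 = 2 \<and> (i + 1) div 3 = i div 3 \<or>
    i mod 3 = 2 \<and> (i + 1) mod 3 = 0 \<and> (i + 1) div 3 = i div 3 + 1" by presburger
  then show ?thesis by (elim disjE conjE) (rule that; assumption)+
qed

text \<open>Neighbours with different parents have equal weights, because the
  weights at the two ends are the same.\<close>

lemma W_neighbour: "\<delta> * W k i \<le> W k (i + 1)" "\<delta> * W k (i + 1) \<le> W k i"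
proof -
  have "\<delta> * W k i \<le> W k (i + 1) \<and> \<delta> * W k (i + 1) \<le> W k i"
  proof (induction k arbitrary: i)
    case 0
    then show ?case using \<delta>_le by simp
  next
    case (Suc k)
    have *: "\<delta> * (W k j * w k r) \<le> W k j * w k r'" for j r r'
    proof -
      have "\<delta> * w k r \<le> \<delta> * 1" using w_bounds(2)[of k r] \<delta>_pos by (intro mult_left_mono) auto
      also have "\<dots> \<le> w k r'" using w_bounds by simp
      finally show ?thesis using W_pos[of k j]
        by (metis mult.left_commute mult_left_mono order_less_imp_le)
    qed
    have **: "w k 2 = w k 0" by (simp add: w_def)
    show ?case
    proof (cases i rule: int_mod_3_cases)
      case 3
      then show ?thesis using Suc[of "i div 3"] w_bounds(3)[of k 0]
        by (auto simp: ** mult.assoc[symmetric] intro!: mult_right_mono)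
    qed (auto simp: *)
  qed
  then show "\<delta> * W k i \<le> W k (i + 1)" "\<delta> * W k (i + 1) \<le> W k i" by auto
qed

lemma S_step: "S k (i + 1) = S k i + W k i"
proof (induction k arbitrary: i)
  case (Suc k)
  have w2: "w k 2 = 1 - w k 0 - w k 1" using w_sum[of k] by simp
  show ?case
    by (cases i rule: int_mod_3_cases) (auto simp: Suc w2 ring_distribs)
qed simp

lemma S_mono:
  assumes "i \<le> j" shows "S k i \<le> S k j"
  using assms
proof (induction j rule: int_ge_induct)
  case (step j)
  then show ?case using S_step[of k j] W_pos[of k j] by simp
qed simp

section \<open>The singular function and its distortion at triadic scales\<close>

abbreviation ix :: "nat \<Rightarrow> real \<Rightarrow> int" where
  "ix k x \<equiv> \<lfloor>3 ^ k * x\<rfloor>"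

lemma ix_Suc_div: "ix (Suc k) x div 3 = ix k x"
  using floor_divide_real_eq_div[of 3 "3 ^ Suc k * x"] by (simp add: mult.assoc)

definition lam :: "nat \<Rightarrow> real \<Rightarrow> real" where
  "lam k x = W k (ix k x)"

text \<open>The values of \<open>S\<close> at the left ends of the nested intervals around
  \<open>x\<close> increase, and the masses tend to 0; the supremum is thus the distribution
  function, without a convergence argument.\<close>

definition f :: "real \<Rightarrow> real" where
  "f x = (SUP k. S k (ix k x))"

lemma lam_pos: "0 < lam k x" by (simp add: lam_def W_pos)

lemma lam_0 [simp]: "lam 0 x = 1" by (simp add: lam_def)

lemma lam_Suc:
  "lam (Suc k) x \<le> (1 - 2 * \<delta>) * lam k x" "\<delta> * lam k x \<le> lam (Suc k) x"
  unfolding lam_def using W_Suc_bounds[of k "ix (Suc k) x"] by (simp_all only: ix_Suc_div)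

lemma lam_Suc_uniform: "k \<notin> B \<Longrightarrow> lam (Suc k) x = lam k x / 3"
  unfolding lam_def W.simps ix_Suc_div by (simp add: w_def)

lemma lam_uniform:
  assumes "k \<le> l" "\<And>i. k \<le> i \<Longrightarrow> i < l \<Longrightarrow> i \<notin> B"
  shows "3 ^ l * lam l x = 3 ^ k * lam k x"
  using assms
proof (induction l rule: dec_induct)
  case (step l)
  then have eq: "lam (Suc l) x = lam l x / 3" by (intro lam_Suc_uniform) auto
  moreover have "3 ^ l * lam l x = 3 ^ k * lam k x" using step by auto
  ultimately show ?case unfolding eq by simp
qed simp

lemma lam_le_power: "k \<le> l \<Longrightarrow> lam l x \<le> (1 - 2 * \<delta>) ^ (l - k) * lam k x"
proof (induction l rule: dec_induct)
  case (step l)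
  have "lam (Suc l) x \<le> (1 - 2 * \<delta>) * lam l x" by (rule lam_Suc)
  also have "\<dots> \<le> (1 - 2 * \<delta>) * ((1 - 2 * \<delta>) ^ (l - k) * lam k x)"
    using step \<delta>_le by (intro mult_left_mono) auto
  finally show ?case using step(1) by (simp add: Suc_diff_le)
qed simp

lemma lam_ge_power: "k \<le> l \<Longrightarrow> \<delta> ^ (l - k) * lam k x \<le> lam l x"
proof (induction l rule: dec_induct)
  case (step l)
  have "\<delta> * (\<delta> ^ (l - k) * lam k x) \<le> \<delta> * lam l x"
    using step \<delta>_pos by (intro mult_left_mono) auto
  also have "\<dots> \<le> lam (Suc l) x" by (rule lam_Suc)
  finally show ?case using step(1) by (simp add: Suc_diff_le)
qed simp

lemma lam_antimono: "k \<le> l \<Longrightarrow> lam l x \<le> lam k x"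
proof (rule lift_Suc_antimono_le)
  fix k show "lam (Suc k) x \<le> lam k x"
    using lam_Suc(1)[of k x] mult_pos_pos[OF \<delta>_pos lam_pos[of k x]] by (simp add: algebra_simps)
qed

lemma lam_tendsto_0: "(\<lambda>k. lam k x) \<longlonglongrightarrow> 0"
proof (rule tendsto_sandwich[OF _ _ tendsto_const])
  show "\<forall>\<^sub>F k in sequentially. 0 \<le> lam k x" using lam_pos by (simp add: less_imp_le)
  show "\<forall>\<^sub>F k in sequentially. lam k x \<le> (1 - 2 * \<delta>) ^ k" by (simp add: lam_def W_le)
  show "(\<lambda>k. (1 - 2 * \<delta>) ^ k) \<longlonglongrightarrow> 0" using \<delta>_pos \<delta>_le by (intro LIMSEQ_power_zero) auto
qed

lemma S_ix_mono: "k \<le> l \<Longrightarrow> S k (ix k x) \<le> S l (ix l x)"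
proof (induction l rule: dec_induct)
  case (step l)
  have "S l (ix l x) \<le> S (Suc l) (ix (Suc l) x)"
    unfolding S.simps ix_Suc_div using W_pos[of l "ix l x"] w_bounds(3)[of l 0] w_bounds(3)[of l 1] by auto
  then show ?case using step by simp
qed simp

text \<open>Right ends of nested triadic intervals move left. With \<open>S_ix_mono\<close> this
  brackets \<open>f x\<close> by the values at both ends at every level.\<close>

lemma S_ix_upper_mono: "k \<le> l \<Longrightarrow> S l (ix l x) + lam l x \<le> S k (ix k x) + lam k x"
proof (induction l rule: dec_induct)
  case (step l)
  let ?i = "ix (Suc l) x"
  have "S (Suc l) (?i + 1) \<le> S (Suc l) (3 * (?i div 3 + 1))"
    by (rule S_mono) presburger
  also have "\<dots> = S l (ix l x + 1)" using ix_Suc_div[of l x] by simp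
  finally show ?case using step unfolding lam_def S_step[symmetric] by simp
qed simp

lemma f_bounds: "S k (ix k x) \<le> f x" "f x \<le> S k (ix k x) + lam k x"
proof -
  have up: "S l (ix l x) \<le> S k (ix k x) + lam k x" for l k
  proof (cases "k \<le> l")
    case True
    then show ?thesis using S_ix_upper_mono[OF True, of x] lam_pos[of l x] by simp
  next
    case False
    then show ?thesis using S_ix_mono[of l k x] lam_pos[of k x] by simp
  qed
  show "S k (ix k x) \<le> f x" unfolding f_def using up[of _ 0]
    by (intro cSUP_upper bdd_aboveI2[where M="S 0 (ix 0 x) + lam 0 x"]) auto
  show "f x \<le> S k (ix k x) + lam k x" unfolding f_def using up by (intro cSUP_least) auto
qed

lemma f_le_S: "f x \<le> S k (ix k x + 1)"
  using f_bounds(2) by (simp add: S_step lam_def)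

lemma ix_near:
  assumes "\<bar>x - y\<bar> \<le> (1/3) ^ k"
  shows "ix k x = ix k y \<or> ix k x = ix k y + 1 \<or> ix k y = ix k x + 1"
proof -
  have "\<bar>3 ^ k * x - 3 ^ k * y\<bar> = 3 ^ k * \<bar>x - y\<bar>"
    by (simp add: abs_mult right_diff_distrib[symmetric])
  also have "\<dots> \<le> 3 ^ k * (1/3) ^ k" using assms by (intro mult_left_mono) auto
  also have "\<dots> = 1" by (simp add: power_mult_distrib[symmetric])
  finally show ?thesis by linarith
qed

lemma lam_near:
  assumes "\<bar>x - y\<bar> \<le> (1/3) ^ k"
  shows "\<delta> * lam k x \<le> lam k y"
proof -
  have "\<delta> * lam k x \<le> 1 * lam k x" using lam_pos[of k x] \<delta>_le by (intro mult_right_mono) auto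
  then show ?thesis
    using ix_near[OF assms] W_neighbour[of k "ix k x"] W_neighbour[of k "ix k y"] unfolding lam_def by auto
qed

text \<open>The points lie in the same or in adjacent intervals of level \<open>k\<close>, so the
  images differ by at most two neighbouring masses, each at most
  \<open>lam k x / \<delta>\<close>.\<close>

lemma f_near:
  assumes "\<bar>x - y\<bar> \<le> (1/3) ^ k"
  shows "\<bar>f x - f y\<bar> \<le> (2 / \<delta>) * lam k x"
proof -
  have y: "lam k y \<le> lam k x / \<delta>"
    using lam_near[of y x k] assms \<delta>_pos by (simp add: field_simps abs_minus_commute)
  have x: "lam k x \<le> lam k x / \<delta>" using lam_pos[of k x] \<delta>_pos \<delta>_le by (simp add: field_simps)
  have "\<bar>f x - f y\<bar> \<le> lam k x + lam k y"
    using ix_near[OF assms] f_bounds(1)[of k x] f_bounds(2)[of x k] f_bounds(1)[of k y] f_bounds(2)[of y k]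
      S_step[of k "ix k x"] S_step[of k "ix k y"] lam_pos[of k x] lam_pos[of k y]
    by (auto simp: lam_def)
  then show ?thesis using x y by simp
qed

text \<open>One level finer the points are at least three interval lengths apart, so the interval
  next to that of \<open>x\<close> on the side of \<open>y\<close> lies between them. Passing to a
  neighbour and descending one level cost a factor \<delta> each.\<close>

lemma f_far:
  assumes "(1/3) ^ k \<le> \<bar>x - y\<bar>"
  shows "\<delta>\<^sup>2 * lam k x \<le> \<bar>f x - f y\<bar>"
proof -
  define m where "m = Suc k"
  have far: "2 \<le> 3 ^ m * \<bar>x - y\<bar>"
  proof -
    have "3 ^ m * (1/3) ^ k \<le> 3 ^ m * \<bar>x - y\<bar>" using assms by (intro mult_left_mono) auto
    moreover have "3 ^ m * (1/3 :: real) ^ k = 3" by (simp add: m_def power_mult_distrib[symmetric])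
    ultimately show ?thesis by simp
  qed
  have main: "\<delta> * lam m x \<le> \<bar>f x - f y\<bar>"
  proof (cases "x \<le> y")
    case True
    then have "ix m x + 2 \<le> ix m y" using far
      by (simp add: le_floor_iff right_diff_distrib) linarith
    then have "S m (ix m x + 1 + 1) \<le> f y" by (intro order_trans[OF S_mono f_bounds(1)]) auto
    moreover have "f x \<le> S m (ix m x + 1)" by (rule f_le_S)
    moreover have "S m (ix m x + 1 + 1) = S m (ix m x + 1) + W m (ix m x + 1)" by (rule S_step)
    ultimately have "W m (ix m x + 1) \<le> f y - f x" by linarith
    then show ?thesis using W_neighbour(1)[of m "ix m x"] by (simp add: lam_def)
  next
    case False
    then have "ix m y + 2 \<le> ix m x" using far
      by (simp add: le_floor_iff right_diff_distrib) linarith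
    then have "S m (ix m x) \<le> f x" "f y \<le> S m (ix m x - 1)"
      using f_bounds(1)[of m x] order_trans[OF f_le_S S_mono, of m y "ix m x - 1" ] by auto
    moreover have "S m (ix m x) = S m (ix m x - 1) + W m (ix m x - 1)" using S_step[of m "ix m x - 1"] by simp
    ultimately have "W m (ix m x - 1) \<le> f x - f y" by linarith
    then show ?thesis using W_neighbour(2)[of m "ix m x - 1"] by (simp add: lam_def)
  qed
  have "\<delta> * (\<delta> * lam k x) \<le> \<delta> * lam m x" unfolding m_def using lam_Suc(2) \<delta>_pos by (intro mult_left_mono) auto
  then show ?thesis using main by (simp add: power2_eq_square)
qed

text \<open>A version of \<open>lam b\<close> that is Lipschitz with respect to \<open>f\<close>.\<close>

definition M :: "nat \<Rightarrow> real \<Rightarrow> real" where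
  "M b x = (INF z. lam b z + \<bar>f x - f z\<bar>)"

lemma M_bdd: "bdd_below (range (\<lambda>z. lam b z + \<bar>f x - f z\<bar>))"
  by (rule bdd_belowI2[where m = 0]) (simp add: lam_pos less_imp_le add_nonneg_nonneg)

lemma M_le_lam: "M b x \<le> lam b x"
  unfolding M_def using cINF_lower[OF M_bdd, of x b x] by simp

text \<open>A competitor \<open>z\<close> in the infimum is either near \<open>x\<close>, and then
  has comparable mass, or far, and then \<open>f\<close> itself has already moved by a comparable
  amount.\<close>

lemma M_ge_lam: "\<delta>\<^sup>2 * lam b x \<le> M b x"
  unfolding M_def
proof (rule cINF_greatest)
  fix z
  show "\<delta>\<^sup>2 * lam b x \<le> lam b z + \<bar>f x - f z\<bar>"
  proof (cases "\<bar>x - z\<bar> \<le> (1/3) ^ b")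
    case True
    have "\<delta>\<^sup>2 * lam b x \<le> \<delta> * lam b x"
      using \<delta>_pos \<delta>_le lam_pos[of b x] by (simp add: power2_eq_square)
    also have "\<dots> \<le> lam b z" by (rule lam_near[OF True])
    finally show ?thesis by simp
  next
    case False
    then show ?thesis using f_far[of b x z] lam_pos[of b z] by simp
  qed
qed simp

lemma M_lipschitz: "\<bar>M b x - M b y\<bar> \<le> \<bar>f x - f y\<bar>"
proof -
  have *: "M b x \<le> M b y + \<bar>f x - f y\<bar>" for x y
  proof -
    have "M b x - \<bar>f x - f y\<bar> \<le> lam b z + \<bar>f y - f z\<bar>" for z
      using cINF_lower[OF M_bdd, of z b x] unfolding M_def[symmetric] by simp
    then have "M b x - \<bar>f x - f y\<bar> \<le> M b y"
      unfolding M_def[of b y] by (intro cINF_greatest) auto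
    then show ?thesis by simp
  qed
  show ?thesis using *[of x y] *[of y x] by (simp add: abs_minus_commute)
qed

lemma M_0: "M 0 x = 1"
proof (rule antisym)
  show "M 0 x \<le> 1" using M_le_lam[of 0 x] by simp
  show "1 \<le> M 0 x" unfolding M_def by (intro cINF_greatest) auto
qed

text \<open>The indices cover [0,2) because \<open>x = 1\<close> has index \<open>3 ^ k\<close>; a
  union of whole unit intervals is stable under subdivision, which makes the moment exactly
  multiplicative.\<close>

definition moment :: "real \<Rightarrow> nat \<Rightarrow> real" where
  "moment p k = (\<Sum>i\<in>{0..<2 * 3 ^ k}. W k i powr p)"

lemma moment_Suc: "moment p (Suc k) = moment p k * (w k 0 powr p + w k 1 powr p + w k 2 powr p)"
proof -
  have split: "{0..<2 * 3 ^ Suc k :: int} = (\<lambda>(j, r). 3 * j + r) ` ({0..<2 * 3 ^ k} \<times> {0, 1, 2})"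
  proof (intro set_eqI iffI)
    fix i :: int assume i: "i \<in> {0..<2 * 3 ^ Suc k}"
    moreover have "i mod 3 = 0 \<or> i mod 3 = 1 \<or> i mod 3 = 2" by presburger
    ultimately have "(i div 3, i mod 3) \<in> {0..<2 * 3 ^ k} \<times> {0, 1, 2}"
      by (auto simp: div_less_iff_less_mult pos_imp_zdiv_nonneg_iff)
    then show "i \<in> (\<lambda>(j, r). 3 * j + r) ` ({0..<2 * 3 ^ k} \<times> {0, 1, 2})"
      by (rule rev_image_eqI) simp
  qed auto
  have inj: "inj_on (\<lambda>(j, r). 3 * j + r) ({0..<2 * 3 ^ k :: int} \<times> {0, 1, 2})"
    by (rule inj_onI) (clarsimp, elim disjE, simp_all, (presburger+)?)
  have "moment p (Suc k) = (\<Sum>(j, r)\<in>{0..<2 * 3 ^ k} \<times> {0, 1, 2}. W (Suc k) (3 * j + r) powr p)"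
    unfolding moment_def split sum.reindex[OF inj] by (simp add: case_prod_beta comp_def)
  also have "\<dots> = (\<Sum>(j, r)\<in>{0..<2 * 3 ^ k} \<times> {0, 1, 2}. W k j powr p * w k r powr p)"
  proof -
    have "W (Suc k) (3 * j + r) powr p = W k j powr p * w k r powr p" if "r \<in> {0, 1, 2}" for j r
    proof -
      have "(3 * j + r) div 3 = j" "(3 * j + r) mod 3 = r" using that by auto
      then show ?thesis using W_pos[of k j] w_bounds(3)[of k r] by (simp add: powr_mult)
    qed
    then show ?thesis by (intro sum.cong) auto
  qed
  also have "\<dots> = moment p k * (\<Sum>r\<in>{0, 1, 2}. w k r powr p)"
    unfolding moment_def sum_product sum.cartesian_product ..
  finally show ?thesis by simp
qed

end

section \<open>A Cantor set with lacunary scales\<close>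

text \<open>Triadic digits with index in \<open>(s j, e j]\<close> are free, those in \<open>(e j, s (j+1)]\<close> vanish.\<close>

locale phases =
  fixes s e :: "nat \<Rightarrow> nat"
  assumes s_0: "s 0 = 0" and s_le_e: "s j \<le> e j" and e_le_s: "e j + 3 * j + 3 \<le> s (Suc j)"
begin

lemma e_less_s: "e j < s (Suc j)" using e_le_s[of j] by simp

lemma s_mono: "i \<le> j \<Longrightarrow> s i \<le> s j"
proof (rule lift_Suc_mono_le[of s])
  show "s n \<le> s (Suc n)" for n using s_le_e[of n] e_less_s[of n] by simp
qed

lemma e_mono: "i \<le> j \<Longrightarrow> e i \<le> e j"
proof (rule lift_Suc_mono_le[of e])
  show "e n \<le> e (Suc n)" for n using s_le_e[of "Suc n"] e_less_s[of n] by simp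
qed

lemma le_s: "j \<le> s j"
proof (cases j)
  case (Suc i)
  then show ?thesis using e_le_s[of i] by simp
qed simp

definition trunc :: "nat \<Rightarrow> real \<Rightarrow> real" where
  "trunc k y = of_int \<lfloor>3 ^ k * y\<rfloor> * (1/3) ^ k"

definition block :: "nat \<Rightarrow> real \<Rightarrow> real" where
  "block j y = trunc (e j) y - trunc (s j) y"

text \<open>The term with the factor 1/2 makes the condition on \<open>y\<close> closed. It only excludes points that
  violate the condition at index \<open>j + 1\<close> anyway.\<close>

definition cantor :: "real set" where
  "cantor = {0..1 - (1/2) * (1/3) ^ e 0} \<inter>
     (\<Inter>j. \<Union>i\<in>{0..3 ^ e j :: int}. {y. of_int i \<le> 3 ^ e j * y \<and>
        3 ^ e j * y \<le> of_int i + 3 ^ e j * ((1/3) ^ s (Suc j) - (1/2) * (1/3) ^ e (Suc j))})"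

lemma cantor_subset: "cantor \<subseteq> {0..<1}"
proof -
  have "(0::real) < (1/3) ^ e 0" by simp
  then show ?thesis unfolding cantor_def by (auto simp del: zero_less_power)
qed

lemma trunc_bounds: "trunc k y \<le> y" "y < trunc k y + (1/3) ^ k"
proof -
  have "(3::real) ^ k * (1/3) ^ k = 1" by (simp add: power_mult_distrib[symmetric])
  then have eq: "y = (3 ^ k * y) * (1/3) ^ k" by simp
  have "of_int \<lfloor>3 ^ k * y\<rfloor> * (1/3) ^ k \<le> (3 ^ k * y) * (1/3) ^ k"
    by (intro mult_right_mono) auto
  then show "trunc k y \<le> y" unfolding trunc_def using eq by simp
  have "(3 ^ k * y) * (1/3) ^ k < (of_int \<lfloor>3 ^ k * y\<rfloor> + 1) * (1/3) ^ k"
    by (intro mult_strict_right_mono) auto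
  then show "y < trunc k y + (1/3) ^ k" unfolding trunc_def using eq by (simp add: distrib_right)
qed

text \<open>The subtracted half power keeps \<open>y\<close> strictly below the right end of the
  admissible interval, so all digits between \<open>e j\<close> and \<open>s (Suc j)\<close> are 0
  and the finer floor is read off from the coarser one.\<close>

lemma ix_cantor:
  assumes "y \<in> cantor"
  shows "\<lfloor>3 ^ s (Suc j) * y\<rfloor> = 3 ^ (s (Suc j) - e j) * \<lfloor>3 ^ e j * y\<rfloor>"
proof -
  let ?d = "s (Suc j) - e j"
  obtain i :: int where i: "of_int i \<le> 3 ^ e j * y"
    "3 ^ e j * y \<le> of_int i + 3 ^ e j * ((1/3) ^ s (Suc j) - (1/2) * (1/3) ^ e (Suc j))"
    using assms unfolding cantor_def by blast
  have sd: "s (Suc j) = e j + ?d" using e_less_s[of j] by simp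
  have pos: "(0::real) < 3 ^ e j * (1/3) ^ e (Suc j)" by simp
  have p: "3 ^ e j * (1/3 :: real) ^ s (Suc j) = (1/3) ^ ?d"
    by (subst sd, simp add: power_add power_mult_distrib[symmetric])
  have up: "3 ^ e j * y < of_int i + (1/3) ^ ?d"
    using i(2) pos unfolding p[symmetric] right_diff_distrib by linarith
  have "(1/3 :: real) ^ ?d \<le> 1" by (intro power_le_one) auto
  then have fl: "\<lfloor>3 ^ e j * y\<rfloor> = i" using i(1) up by (intro floor_unique) auto
  have q: "3 ^ s (Suc j) * y = 3 ^ ?d * (3 ^ e j * y)"
    by (subst sd, simp add: power_add)
  have "\<lfloor>3 ^ s (Suc j) * y\<rfloor> = 3 ^ ?d * i"
  proof (rule floor_unique)
    show "of_int (3 ^ ?d * i) \<le> 3 ^ s (Suc j) * y" unfolding q using i(1) by simp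
    have "3 ^ ?d * (3 ^ e j * y) < 3 ^ ?d * (of_int i + (1/3) ^ ?d)"
      using up by (intro mult_strict_left_mono) auto
    also have "\<dots> = of_int (3 ^ ?d * i) + 1" by (simp add: distrib_left power_mult_distrib[symmetric])
    finally show "3 ^ s (Suc j) * y < of_int (3 ^ ?d * i) + 1" unfolding q .
  qed
  then show ?thesis by (simp add: fl)
qed

lemma trunc_cantor:
  assumes "y \<in> cantor"
  shows "trunc (s (Suc j)) y = trunc (e j) y"
proof -
  let ?d = "s (Suc j) - e j"
  have sd: "s (Suc j) = e j + ?d" using e_less_s[of j] by simp
  have "(1/3 :: real) ^ s (Suc j) = (1/3) ^ e j * (1/3) ^ ?d" by (subst sd) (simp add: power_add)
  moreover have "(3::real) ^ ?d * (1/3) ^ ?d = 1" by (simp add: power_mult_distrib[symmetric])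
  ultimately show ?thesis unfolding trunc_def ix_cantor[OF assms] by simp
qed

lemma trunc_mono: "k \<le> l \<Longrightarrow> trunc k y \<le> trunc l y"
proof (induction l rule: dec_induct)
  case (step l)
  have "3 * \<lfloor>3 ^ l * y\<rfloor> \<le> \<lfloor>3 ^ Suc l * y\<rfloor>"
    by (simp add: le_floor_iff)
  then have "of_int (3 * \<lfloor>3 ^ l * y\<rfloor>) * (1/3) ^ Suc l \<le> of_int \<lfloor>3 ^ Suc l * y\<rfloor> * (1/3 :: real) ^ Suc l"
    by (intro mult_right_mono) (simp_all only: of_int_le_iff, simp)
  then have "trunc l y \<le> trunc (Suc l) y" unfolding trunc_def by simp
  then show ?case using step by simp
qed simp

lemma block_bounds: "0 \<le> block j y" "block j y \<le> (1/3) ^ s j"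
  unfolding block_def using trunc_mono[OF s_le_e, of j y] trunc_bounds(1)[of "e j" y] trunc_bounds(2)[of y "s j"]
  by auto

text \<open>The vanishing digits make the truncation at \<open>s (Suc j)\<close> equal to that at
  \<open>s j\<close> plus one block; hence the blocks determine the point.\<close>

lemma trunc_s_eqI:
  assumes "y \<in> cantor" "z \<in> cantor" "\<And>i. i < j \<Longrightarrow> block i y = block i z"
  shows "trunc (s j) y = trunc (s j) z"
  using assms(3)
proof (induction j)
  case 0
  have "\<lfloor>y\<rfloor> = 0" "\<lfloor>z\<rfloor> = 0" using assms(1,2) cantor_subset by (auto simp: floor_eq_iff)
  then show ?case by (simp add: trunc_def s_0)
next
  case (Suc j)
  have "trunc (s j) y = trunc (s j) z" using Suc by simp
  moreover have "block j y = block j z" using Suc by simp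
  ultimately show ?case unfolding trunc_cantor[OF assms(1)] trunc_cantor[OF assms(2)] block_def by simp
qed

lemma power_third_mono: "k \<le> l \<Longrightarrow> (1/3 :: real) ^ l \<le> (1/3) ^ k"
  by (intro power_decreasing) auto

lemma power_third_cancel: "(3::real) ^ k * (1/3) ^ k = 1"
  by (simp add: power_mult_distrib[symmetric])

lemma eq_of_blocks:
  assumes "y \<in> cantor" "z \<in> cantor" "\<And>j. block j y = block j z"
  shows "y = z"
proof (rule ccontr)
  assume "y \<noteq> z"
  then obtain k where k: "(1/3 :: real) ^ k < \<bar>y - z\<bar>"
    using real_arch_pow_inv[of "\<bar>y - z\<bar>" "1/3"] by auto
  have "(1/3 :: real) ^ s k \<le> (1/3) ^ k" by (rule power_third_mono[OF le_s])
  moreover have "trunc (s k) y = trunc (s k) z" using assms by (intro trunc_s_eqI) auto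
  ultimately show False
    using k trunc_bounds(1)[of "s k" y] trunc_bounds(1)[of "s k" z] trunc_bounds(2)[of y "s k"] trunc_bounds(2)[of z "s k"] by linarith
qed

text \<open>The values of \<open>block j\<close> lie on a lattice of mesh
  \<open>(1/3) ^ e j\<close>.\<close>

lemma block_diff_ge:
  assumes "block j y \<noteq> block j z"
  shows "(1/3) ^ e j \<le> \<bar>block j y - block j z\<bar>"
proof -
  have "\<exists>i::int. block j y = of_int i * (1/3) ^ e j" for y
  proof -
    have "(1/3::real) ^ s j = 3 ^ (e j - s j) * (1/3) ^ e j"
    proof -
      have "(1/3::real) ^ e j = (1/3) ^ (e j - s j) * (1/3) ^ s j"
        using s_le_e[of j] by (simp add: power_add[symmetric])
      then show ?thesis using power_third_cancel[of "e j - s j"] by (simp only: mult.assoc[symmetric])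
    qed
    then have "block j y = of_int (\<lfloor>3 ^ e j * y\<rfloor> - \<lfloor>3 ^ s j * y\<rfloor> * 3 ^ (e j - s j)) * (1/3) ^ e j"
      unfolding block_def trunc_def by (simp add: left_diff_distrib)
    then show ?thesis by blast
  qed
  then obtain i i' :: int where i: "block j y = of_int i * (1/3) ^ e j" "block j z = of_int i' * (1/3) ^ e j"
    by metis
  then have "i \<noteq> i'" using assms by auto
  then have "1 \<le> \<bar>i - i'\<bar>" by simp
  then have "(1::real) \<le> \<bar>of_int (i - i')\<bar>" by linarith
  then have "1 * (1/3::real) ^ e j \<le> \<bar>of_int (i - i')\<bar> * (1/3) ^ e j" by (intro mult_right_mono) auto
  also have "\<dots> = \<bar>block j y - block j z\<bar>" unfolding i by (simp add: left_diff_distrib[symmetric] abs_mult)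
  finally show ?thesis by simp
qed

text \<open>Whatever follows the first differing block contributes at most
  \<open>(1/3) ^ s (Suc j)\<close>, which is at most a third of the lattice mesh and so of the block
  difference. An error of one third yields the constants 3/2 and 3/4.\<close>

lemma first_block:
  assumes "y \<in> cantor" "z \<in> cantor" "y \<noteq> z"
  obtains j where "\<And>i. i < j \<Longrightarrow> block i y = block i z"
    "(1/3) ^ e j \<le> \<bar>block j y - block j z\<bar>" "\<bar>block j y - block j z\<bar> \<le> (1/3) ^ s j"
    "\<bar>block j y - block j z\<bar> \<le> (3/2) * \<bar>y - z\<bar>" "(3/4) * \<bar>y - z\<bar> \<le> \<bar>block j y - block j z\<bar>"
proof -
  obtain j0 where "block j0 y \<noteq> block j0 z" using assms eq_of_blocks by blast
  define j where "j = (LEAST j. block j y \<noteq> block j z)"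
  have j: "block j y \<noteq> block j z" unfolding j_def by (rule LeastI) fact
  have least: "\<And>i. i < j \<Longrightarrow> block i y = block i z" using not_less_Least unfolding j_def by blast
  have ge: "(1/3) ^ e j \<le> \<bar>block j y - block j z\<bar>" by (rule block_diff_ge[OF j])
  have le: "\<bar>block j y - block j z\<bar> \<le> (1/3) ^ s j"
    using block_bounds[of j y] block_bounds[of j z] by auto
  have "trunc (s j) y = trunc (s j) z" by (rule trunc_s_eqI) (use assms least in auto)
  then have "trunc (s (Suc j)) y - trunc (s (Suc j)) z = block j y - block j z"
    using assms by (simp add: trunc_cantor block_def)
  then have "\<bar>(y - z) - (block j y - block j z)\<bar> \<le> (1/3) ^ s (Suc j)"
    using trunc_bounds(1)[of "s (Suc j)" y] trunc_bounds(1)[of "s (Suc j)" z]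
      trunc_bounds(2)[of y "s (Suc j)"] trunc_bounds(2)[of z "s (Suc j)"] by linarith
  moreover have "(1/3 :: real) ^ s (Suc j) \<le> (1/3) ^ Suc (e j)"
    by (rule power_third_mono) (use e_less_s[of j] in simp)
  ultimately have "\<bar>(y - z) - (block j y - block j z)\<bar> \<le> (1/3) * \<bar>block j y - block j z\<bar>" using ge by simp
  then have near: "\<bar>(y - z) - (block j y - block j z)\<bar> \<le> (1/3) * \<bar>block j y - block j z\<bar>" .
  have arith: "R - A \<le> D \<Longrightarrow> D \<le> (1/3) * R \<Longrightarrow> R \<le> (3/2) * A"
    "A - R \<le> D \<Longrightarrow> D \<le> (1/3) * R \<Longrightarrow> (3/4) * A \<le> R" for A D R :: real by linarith+
  have "\<bar>block j y - block j z\<bar> \<le> (3/2) * \<bar>y - z\<bar>"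
    by (rule arith(1)[OF abs_triangle_ineq2_sym near])
  moreover have "(3/4) * \<bar>y - z\<bar> \<le> \<bar>block j y - block j z\<bar>"
    by (rule arith(2)[OF abs_triangle_ineq2 near])
  ultimately show thesis using least ge le that by blast
qed

lemma closed_cantor: "closed cantor"
  unfolding cantor_def
  by (intro closed_Int closed_INT closed_UN ballI closed_Collect_conj closed_Collect_le
      continuous_intros closed_atLeastAtMost) auto

end

text \<open>A burst of length \<open>j\<close> directly follows the free digits of block
  \<open>j\<close>. The condition on \<open>j0\<close> is what \<open>m_step\<close> needs to return
  from \<open>lam\<close> to \<open>m\<close>.\<close>

locale twisted_phases = phases s e + cascade \<delta> "{k. \<exists>j\<ge>j0. e j \<le> k \<and> k < e j + j}"
  for s e :: "nat \<Rightarrow> nat" and \<delta> :: real and j0 :: nat +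
  assumes j0: "1 \<le> \<delta>\<^sup>2 * 3 ^ j0"
begin

text \<open>The level from which the weights are equal up to the end of block \<open>j\<close>: the
  end of the preceding burst, or 0 if there is none.\<close>

definition b :: "nat \<Rightarrow> nat" where
  "b j = (if j \<le> j0 then 0 else e (j - 1) + (j - 1))"

text \<open>The local scaling factor of the map on the lattice scales of block \<open>j\<close>.\<close>

definition m :: "nat \<Rightarrow> real \<Rightarrow> real" where
  "m j x = 3 ^ b j * M (b j) x"

lemma b_add_le_s: "b j + j \<le> s j"
proof (cases j)
  case (Suc i)
  then show ?thesis using e_le_s[of i] le_s[of j] by (auto simp: b_def)
qed (simp add: b_def)

lemma b_le_s: "b j \<le> s j" using b_add_le_s[of j] by simp

text \<open>Bursts of index below \<open>j\<close> are over at level \<open>b j\<close>, and the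
  others start at \<open>e j\<close> or later.\<close>

lemma b_uniform:
  assumes "b j \<le> k" "k < e j"
  shows "k \<notin> {k. \<exists>j\<ge>j0. e j \<le> k \<and> k < e j + j}"
proof
  assume "k \<in> {k. \<exists>j\<ge>j0. e j \<le> k \<and> k < e j + j}"
  then obtain i where i: "j0 \<le> i" "e i \<le> k" "k < e i + i" by blast
  have "i < j" using i(2) assms(2) e_mono[of j i] by (cases "i < j") auto
  then obtain l where l: "j = Suc l" "i \<le> l" by (cases j) auto
  then have "e l + l \<le> k" using assms(1) i(1) by (auto simp: b_def)
  moreover have "e i + i \<le> e l + l" using e_mono[OF l(2)] l(2) by simp
  ultimately show False using i(3) by simp
qed

lemma lam_block:
  assumes "b j \<le> k" "k \<le> l" "l \<le> e j"
  shows "3 ^ l * lam l x = 3 ^ k * lam k x"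
  using assms(2)
  by (rule lam_uniform) (rule b_uniform[of j], use assms in auto)

lemma m_upper: "m j x \<le> 3 ^ s j * lam (s j) x"
  unfolding m_def lam_block[OF order_refl b_le_s s_le_e] by (simp add: M_le_lam)

lemma m_lower: "\<delta>\<^sup>2 * (3 ^ s j * lam (s j) x) \<le> m j x"
  unfolding m_def lam_block[OF order_refl b_le_s s_le_e]
  using M_ge_lam[of "b j" x] by (simp add: mult.left_commute)

lemma m_pos: "0 < m j x"
proof -
  have "0 < \<delta>\<^sup>2 * (3 ^ s j * lam (s j) x)" using \<delta>_pos lam_pos by simp
  then show ?thesis using m_lower[of j x] by simp
qed

text \<open>The \<open>j\<close> spare levels between \<open>b j\<close> and \<open>s j\<close>
  reduce the slope, multiplied by the size of block \<open>j\<close>, to \<open>(1/3) ^ j\<close>;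
  the slopes become summable.\<close>

lemma m_lipschitz: "\<bar>m j x - m j x'\<bar> * (1/3) ^ s j \<le> (1/3) ^ j * \<bar>f x - f x'\<bar>"
proof -
  have "\<bar>m j x - m j x'\<bar> * (1/3) ^ s j = 3 ^ b j * \<bar>M (b j) x - M (b j) x'\<bar> * (1/3) ^ s j"
    by (simp add: m_def right_diff_distrib[symmetric] abs_mult)
  also have "\<dots> \<le> 3 ^ b j * \<bar>f x - f x'\<bar> * (1/3) ^ (b j + j)"
    by (intro mult_mono mult_left_mono M_lipschitz power_third_mono b_add_le_s) auto
  also have "\<dots> = (3 ^ b j * (1/3) ^ b j) * ((1/3) ^ j * \<bar>f x - f x'\<bar>)" by (simp only: power_add ac_simps)
  finally show ?thesis unfolding power_third_cancel by simp
qed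

text \<open>All of block \<open>Suc j\<close> weighs at most a third of one lattice step of block
  \<open>j\<close>. A burst raises the scaling factor by at most \<open>3 ^ j\<close>, and comparing
  \<open>m\<close> with \<open>lam\<close> costs at most \<open>3 ^ j0\<close>; the gap before
  \<open>s (Suc j)\<close> pays for both and leaves a factor 1/3.\<close>

lemma m_step: "m (Suc j) x * (1/3) ^ s (Suc j) \<le> (1/3) * (m j x * (1/3) ^ e j)"
proof (cases "Suc j \<le> j0")
  case True
  then have "m (Suc j) x = 1" "m j x = 1" by (simp_all add: m_def b_def M_0)
  moreover have "(1/3::real) ^ s (Suc j) \<le> (1/3) ^ Suc (e j)"
    by (rule power_third_mono) (use e_less_s[of j] in simp)
  ultimately show ?thesis by simp
next
  case False
  then have j: "j0 \<le> j" and b: "b (Suc j) = e j + j" by (auto simp: b_def)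
  have "m (Suc j) x \<le> 3 ^ (e j + j) * lam (e j + j) x"
    unfolding m_def b by (simp add: M_le_lam)
  also have "\<dots> \<le> 3 ^ (e j + j) * lam (e j) x" by (intro mult_left_mono lam_antimono) auto
  also have "\<dots> = 3 ^ j * (3 ^ e j * lam (e j) x)" by (simp add: power_add)
  also have "3 ^ e j * lam (e j) x = 1 * (3 ^ s j * lam (s j) x)"
    using lam_block[OF b_le_s s_le_e order_refl] by simp
  also have "3 ^ j * (1 * (3 ^ s j * lam (s j) x)) \<le> 3 ^ j * ((\<delta>\<^sup>2 * 3 ^ j0) * (3 ^ s j * lam (s j) x))"
    using lam_pos[of "s j" x] by (intro mult_left_mono mult_right_mono j0) auto
  also have "\<dots> = 3 ^ (j + j0) * (\<delta>\<^sup>2 * (3 ^ s j * lam (s j) x))" by (simp only: power_add ac_simps)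
  also have "\<dots> \<le> 3 ^ (j + j0) * m j x" by (intro mult_left_mono m_lower) auto
  finally have "m (Suc j) x * (1/3) ^ s (Suc j) \<le> 3 ^ (j + j0) * m j x * (1/3) ^ s (Suc j)"
    by (intro mult_right_mono) auto
  \<comment> \<open>Since \<open>j0 \<le> j\<close>, the gap length \<open>3 * j + 3\<close> is at
    least \<open>j + j0 + 1\<close>.\<close>
  also have "\<dots> \<le> 3 ^ (j + j0) * m j x * (1/3) ^ (j + j0 + Suc (e j))"
    using e_le_s[of j] j m_pos[of j x] by (intro mult_left_mono power_third_mono) auto
  also have "\<dots> = (3 ^ (j + j0) * (1/3) ^ (j + j0)) * ((1/3) * (m j x * (1/3) ^ e j))"
    by (simp only: power_add power_Suc ac_simps)
  finally show ?thesis unfolding power_third_cancel by simp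
qed

lemma m_tail: "m (i + Suc j) x * (1/3) ^ s (i + Suc j) \<le> (1/3) ^ Suc i * (m j x * (1/3) ^ e j)"
proof (induction i)
  case (Suc i)
  have "m (Suc (i + Suc j)) x * (1/3) ^ s (Suc (i + Suc j)) \<le> (1/3) * (m (i + Suc j) x * (1/3) ^ e (i + Suc j))"
    by (rule m_step)
  also have "\<dots> \<le> (1/3) * (m (i + Suc j) x * (1/3) ^ s (i + Suc j))"
    by (intro mult_left_mono power_third_mono s_le_e less_imp_le[OF m_pos]) auto
  also have "\<dots> \<le> (1/3) * ((1/3) ^ Suc i * (m j x * (1/3) ^ e j))"
    using Suc by (intro mult_left_mono) auto
  finally show ?case by (simp only: add_Suc power_Suc mult.assoc)
next
  case 0
  show ?case using m_step[of j x] by (simp only: add_0 power_Suc power_0 mult_1_right)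
qed

section \<open>The vertical coordinate and its two-sided estimates\<close>

definition G :: "real \<Rightarrow> real \<Rightarrow> real" where
  "G x y = (\<Sum>j. m j x * block j y)"

lemma sums_third: "(\<lambda>i. (1/3 :: real) ^ Suc i * c) sums (c / 2)" "(\<lambda>i. (1/3 :: real) ^ i * c) sums (3 / 2 * c)"
proof -
  have g: "(\<lambda>i. (1/3 :: real) ^ i) sums (3 / 2)" using geometric_sums[of "1/3 :: real"] by simp
  from sums_mult2[OF g, of c] show "(\<lambda>i. (1/3 :: real) ^ i * c) sums (3 / 2 * c)" .
  from sums_mult[OF this, of "1/3"] show "(\<lambda>i. (1/3 :: real) ^ Suc i * c) sums (c / 2)" by (simp add: mult.assoc)
qed

lemma summable_tail:
  fixes a :: "nat \<Rightarrow> real"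
  assumes "\<And>i. \<bar>a i\<bar> \<le> (1/3) ^ s i"
  shows "summable (\<lambda>i. m i x * a i)" "\<bar>\<Sum>i. m (i + Suc j) x * a (i + Suc j)\<bar> \<le> m j x * (1/3) ^ e j / 2"
proof -
  have bound: "norm (m (i + Suc j) x * a (i + Suc j)) \<le> (1/3) ^ Suc i * (m j x * (1/3) ^ e j)" for i j
  proof -
    have "norm (m (i + Suc j) x * a (i + Suc j)) = m (i + Suc j) x * \<bar>a (i + Suc j)\<bar>"
      using m_pos[of "i + Suc j" x] by (simp add: abs_mult)
    also have "\<dots> \<le> m (i + Suc j) x * (1/3) ^ s (i + Suc j)"
      using m_pos[of "i + Suc j" x] assms by (intro mult_left_mono) auto
    finally show ?thesis using m_tail[of i j x] by simp
  qed
  have g: "(\<lambda>i. (1/3) ^ Suc i * (m j x * (1/3) ^ e j)) sums (m j x * (1/3) ^ e j / 2)" for j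
    by (rule sums_third)
  have "summable (\<lambda>i. m (i + Suc 0) x * a (i + Suc 0))"
    by (rule summable_comparison_test'[OF sums_summable[OF g] bound])
  then show "summable (\<lambda>i. m i x * a i)" by (subst (asm) summable_iff_shift)
  show "\<bar>\<Sum>i. m (i + Suc j) x * a (i + Suc j)\<bar> \<le> m j x * (1/3) ^ e j / 2"
    using norm_suminf_le[OF bound sums_summable[OF g], of j] sums_unique[OF g, of j] by simp
qed

lemma summable_G: "summable (\<lambda>i. m i x * block i y)"
  using block_bounds by (intro summable_tail) auto

text \<open>By \<open>m_tail\<close> the later terms form a geometric series of ratio 1/3, which
  sums to half a lattice step of block \<open>j\<close>; the first differing term dominates.\<close>

lemma G_diff_block:
  assumes "\<And>i. i < j \<Longrightarrow> block i y = block i z" "(1/3) ^ e j \<le> \<bar>block j y - block j z\<bar>"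
  shows "\<bar>G x y - G x z - m j x * (block j y - block j z)\<bar> \<le> m j x * \<bar>block j y - block j z\<bar> / 2"
proof -
  let ?a = "\<lambda>i. block i y - block i z"
  have a: "\<bar>?a i\<bar> \<le> (1/3) ^ s i" for i using block_bounds[of i y] block_bounds[of i z] by auto
  have "G x y - G x z = (\<Sum>i. m i x * ?a i)"
    unfolding G_def suminf_diff[OF summable_G summable_G] by (simp add: right_diff_distrib)
  also have "\<dots> = (\<Sum>i. m (i + Suc j) x * ?a (i + Suc j)) + (\<Sum>i<Suc j. m i x * ?a i)"
    by (rule suminf_split_initial_segment[OF summable_tail(1)[OF a]])
  also have "(\<Sum>i<Suc j. m i x * ?a i) = m j x * ?a j"
    using assms(1) by simp
  finally have "\<bar>G x y - G x z - m j x * ?a j\<bar> = \<bar>\<Sum>i. m (i + Suc j) x * ?a (i + Suc j)\<bar>" by simp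
  also have "\<dots> \<le> m j x * (1/3) ^ e j / 2" by (rule summable_tail[OF a])
  also have "\<dots> \<le> m j x * \<bar>?a j\<bar> / 2" using assms(2) m_pos[of j x] by simp
  finally show ?thesis .
qed

text \<open>The constant 3/2 is the sum of the slopes \<open>(1/3) ^ i\<close>.\<close>

lemma G_diff_left: "\<bar>G x y - G x' y\<bar> \<le> 3 / 2 * \<bar>f x - f x'\<bar>"
proof -
  have "norm (m i x * block i y - m i x' * block i y) \<le> (1/3) ^ i * \<bar>f x - f x'\<bar>" for i
  proof -
    have "norm (m i x * block i y - m i x' * block i y) = \<bar>m i x - m i x'\<bar> * block i y"
      using block_bounds[of i y] by (simp add: left_diff_distrib[symmetric] abs_mult)
    also have "\<dots> \<le> \<bar>m i x - m i x'\<bar> * (1/3) ^ s i" using block_bounds[of i y] by (intro mult_left_mono) auto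
    finally show ?thesis using m_lipschitz[of i x x'] by simp
  qed
  from norm_suminf_le[OF this sums_summable[OF sums_third(2)]]
  have "norm (\<Sum>i. m i x * block i y - m i x' * block i y) \<le> (\<Sum>i. (1/3) ^ i * \<bar>f x - f x'\<bar>)" .
  then show ?thesis
    unfolding G_def suminf_diff[OF summable_G summable_G] sums_unique[OF sums_third(2), symmetric] by simp
qed

text \<open>On the scales of block \<open>j\<close> mass is proportional to length, so the left side
  is the mass of an interval of length \<open>r\<close>. Coarser \<open>k\<close> follow from
  monotonicity, finer ones contradict the bounds on \<open>r\<close>; in
  \<open>lam_block_lower\<close> these roles are exchanged.\<close>

lemma lam_block_upper:
  assumes "(1/3) ^ e j \<le> r" "r \<le> (1/3) ^ s j" "r \<le> (3/2) * (1/3) ^ k"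
  shows "3 ^ s j * lam (s j) x * r \<le> (3/2) * lam k x"
proof (cases "k < s j")
  case True
  have "3 ^ s j * lam (s j) x * r \<le> 3 ^ s j * lam (s j) x * (1/3) ^ s j"
    using assms(2) lam_pos[of "s j" x] by (intro mult_left_mono) auto
  also have "\<dots> = (3 ^ s j * (1/3) ^ s j) * lam (s j) x" by simp
  also have "\<dots> = lam (s j) x" unfolding power_third_cancel by simp
  also have "\<dots> \<le> lam k x" using True by (intro lam_antimono) simp
  finally show ?thesis using lam_pos[of k x] by simp
next
  case False
  have "k \<le> e j"
  proof (rule ccontr)
    assume "\<not> k \<le> e j"
    then have "(1/3 :: real) ^ k \<le> (1/3) ^ Suc (e j)" by (intro power_third_mono) simp
    moreover have "(0::real) < (1/3) ^ e j" by simp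
    ultimately show False using assms(1,3) by (simp del: zero_less_power)
  qed
  then have "3 ^ s j * lam (s j) x * r = 3 ^ k * lam k x * r"
    using False lam_block[of j "s j" k x] b_le_s by simp
  also have "\<dots> \<le> 3 ^ k * lam k x * ((3/2) * (1/3) ^ k)"
    using assms(3) lam_pos[of k x] by (intro mult_left_mono) auto
  also have "\<dots> = (3 ^ k * (1/3) ^ k) * ((3/2) * lam k x)" by simp
  finally show ?thesis unfolding power_third_cancel by simp
qed

lemma lam_block_lower:
  assumes "(1/3) ^ e j \<le> r" "r \<le> (1/3) ^ s j" "(3/4) * (1/3) ^ k \<le> r"
  shows "(3/4) * lam k x \<le> 3 ^ s j * lam (s j) x * r"
proof (cases "k \<le> e j")
  case True
  have "s j \<le> k"
  proof (rule ccontr)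
    assume "\<not> s j \<le> k"
    then have "(1/3 :: real) ^ s j \<le> (1/3) ^ Suc k" by (intro power_third_mono) simp
    moreover have "(0::real) < (1/3) ^ k" by simp
    ultimately show False using assms(2,3) by (simp del: zero_less_power)
  qed
  have "(3/4) * lam k x = (3 ^ k * (1/3) ^ k) * ((3/4) * lam k x)" unfolding power_third_cancel by simp
  also have "\<dots> = 3 ^ k * lam k x * ((3/4) * (1/3) ^ k)" by simp
  also have "\<dots> \<le> 3 ^ k * lam k x * r" using assms(3) lam_pos[of k x] by (intro mult_left_mono) auto
  also have "\<dots> = 3 ^ s j * lam (s j) x * r"
    using True \<open>s j \<le> k\<close> lam_block[of j "s j" k x] b_le_s by simp
  finally show ?thesis .
next
  case False
  have "(3/4) * lam k x \<le> lam k x" using lam_pos[of k x] by simp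
  also have "\<dots> \<le> lam (e j) x" using False by (intro lam_antimono) simp
  also have "\<dots> = (3 ^ e j * (1/3) ^ e j) * lam (e j) x" unfolding power_third_cancel by simp
  also have "\<dots> = 3 ^ e j * lam (e j) x * (1/3) ^ e j" by simp
  also have "\<dots> \<le> 3 ^ e j * lam (e j) x * r" using assms(1) lam_pos[of "e j" x] by (intro mult_left_mono) auto
  also have "\<dots> = 3 ^ s j * lam (s j) x * r" using lam_block[OF b_le_s s_le_e order_refl, of j x] by simp
  finally show ?thesis .
qed

text \<open>First a vertical move at fixed \<open>x\<close>, then a horizontal one at fixed
  \<open>z\<close>; each costs at most \<open>3 / \<delta>\<close> times the mass.\<close>

lemma G_upper:
  assumes "y \<in> cantor" "z \<in> cantor" "\<bar>x - x'\<bar> \<le> (1/3) ^ k" "\<bar>y - z\<bar> \<le> (1/3) ^ k"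
  shows "\<bar>G x y - G x' z\<bar> \<le> (6 / \<delta>) * lam k x"
proof -
  have right: "\<bar>G x y - G x z\<bar> \<le> (9/4) * lam k x"
  proof (cases "y = z")
    case True
    then show ?thesis using lam_pos[of k x] by simp
  next
    case False
    with assms(1,2) obtain j where j: "\<And>i. i < j \<Longrightarrow> block i y = block i z"
      "(1/3) ^ e j \<le> \<bar>block j y - block j z\<bar>" "\<bar>block j y - block j z\<bar> \<le> (1/3) ^ s j"
      "\<bar>block j y - block j z\<bar> \<le> (3/2) * \<bar>y - z\<bar>"
      by (rule first_block) blast
    let ?r = "\<bar>block j y - block j z\<bar>"
    have "\<bar>G x y - G x z\<bar> \<le> \<bar>m j x * (block j y - block j z)\<bar> + m j x * ?r / 2"
      using G_diff_block[OF j(1,2), of x] by linarith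
    also have "\<dots> = (3/2) * (m j x * ?r)" using m_pos[of j x] by (simp add: abs_mult)
    also have "m j x * ?r \<le> 3 ^ s j * lam (s j) x * ?r" by (intro mult_right_mono m_upper) auto
    also have "\<dots> \<le> (3/2) * lam k x"
      using j(4) assms(4) by (intro lam_block_upper j(2,3)) simp
    finally show ?thesis by simp
  qed
  have "\<bar>G x z - G x' z\<bar> \<le> 3 / 2 * \<bar>f x - f x'\<bar>" by (rule G_diff_left)
  also have "\<dots> \<le> 3 / 2 * ((2 / \<delta>) * lam k x)" by (intro mult_left_mono f_near assms) auto
  finally have left: "\<bar>G x z - G x' z\<bar> \<le> (3 / \<delta>) * lam k x" by simp
  have "9/4 \<le> 3 / \<delta>" using \<delta>_pos \<delta>_le by (simp add: field_simps)
  then have "(9/4) * lam k x \<le> (3 / \<delta>) * lam k x" using lam_pos[of k x] by (intro mult_right_mono) auto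
  moreover have "(6 / \<delta>) * lam k x = (3 / \<delta>) * lam k x + (3 / \<delta>) * lam k x"
    by (simp add: add_divide_distrib[symmetric] distrib_right[symmetric])
  ultimately show ?thesis using left right by linarith
qed

text \<open>A horizontal move can cancel a vertical one only by \<open>3/2\<close> times the
  displacement of \<open>f\<close>. If that displacement is below 1/8 in units of
  \<open>\<delta>\<^sup>2 * lam k x\<close>, then of the vertical 3/8 at least 3/16
  survives.\<close>

lemma G_lower:
  assumes "y \<in> cantor" "z \<in> cantor" "(1/3) ^ k \<le> \<bar>y - z\<bar>"
  shows "\<delta>\<^sup>2 / 8 * lam k x \<le> \<bar>f x - f x'\<bar> \<or> \<delta>\<^sup>2 / 8 * lam k x \<le> \<bar>G x y - G x' z\<bar>"
proof -
  have "(0::real) < (1/3) ^ k" by simp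
  then have "0 < \<bar>y - z\<bar>" using assms(3) by (rule less_le_trans)
  then have "y \<noteq> z" by simp
  with assms(1,2) obtain j where j: "\<And>i. i < j \<Longrightarrow> block i y = block i z"
    "(1/3) ^ e j \<le> \<bar>block j y - block j z\<bar>" "\<bar>block j y - block j z\<bar> \<le> (1/3) ^ s j"
    "(3/4) * \<bar>y - z\<bar> \<le> \<bar>block j y - block j z\<bar>"
    by (rule first_block) blast
  let ?r = "\<bar>block j y - block j z\<bar>"
  have "(3/4) * lam k x \<le> 3 ^ s j * lam (s j) x * ?r"
    using j(4) assms(3) by (intro lam_block_lower j(2,3)) simp
  then have "\<delta>\<^sup>2 * ((3/4) * lam k x) \<le> \<delta>\<^sup>2 * (3 ^ s j * lam (s j) x * ?r)"
    by (intro mult_left_mono) auto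
  also have "\<dots> = \<delta>\<^sup>2 * (3 ^ s j * lam (s j) x) * ?r" by simp
  also have "\<dots> \<le> m j x * ?r" by (intro mult_right_mono m_lower) auto
  finally have "(3/4) * (\<delta>\<^sup>2 * lam k x) \<le> m j x * ?r" by simp
  moreover have "m j x * ?r = \<bar>m j x * (block j y - block j z)\<bar>" using m_pos[of j x] by (simp add: abs_mult)
  ultimately have "(3/8) * (\<delta>\<^sup>2 * lam k x) \<le> \<bar>G x y - G x z\<bar>"
    using G_diff_block[OF j(1,2), of x] by linarith
  moreover have "\<bar>G x z - G x' z\<bar> \<le> 3 / 2 * \<bar>f x - f x'\<bar>" by (rule G_diff_left)
  moreover have "\<bar>G x y - G x z\<bar> \<le> \<bar>G x y - G x' z\<bar> + \<bar>G x z - G x' z\<bar>" by linarith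
  moreover have "0 \<le> \<delta>\<^sup>2 * lam k x" using lam_pos[of k x] by simp
  moreover have "(3/8) * A \<le> P \<Longrightarrow> Q \<le> 3/2 * R \<Longrightarrow> P \<le> T + Q \<Longrightarrow> 0 \<le> A \<Longrightarrow> 1/8 * A \<le> R \<or> 1/8 * A \<le> T"
    for A P Q R T :: real by linarith
  ultimately have "1/8 * (\<delta>\<^sup>2 * lam k x) \<le> \<bar>f x - f x'\<bar> \<or> 1/8 * (\<delta>\<^sup>2 * lam k x) \<le> \<bar>G x y - G x' z\<bar>"
    by blast
  then show ?thesis by simp
qed

end

section \<open>Estimates for Hausdorff measures\<close>

lemma diam_pow_le:
  assumes "\<And>x y. x \<in> U \<Longrightarrow> y \<in> U \<Longrightarrow> mdist m x y \<le> r" "0 < r" "0 \<le> \<sigma>"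
  shows "diam_pow m \<sigma> U \<le> ennreal (r powr \<sigma>)"
proof -
  have "ediam m U \<le> ennreal r"
    unfolding ediam_def using assms(1) by (intro SUP_least ennreal_leI) auto
  then have "enn2real (ediam m U) \<le> r" using assms(2) by (intro enn2real_leI) auto
  then have "enn2real (ediam m U) powr \<sigma> \<le> r powr \<sigma>" using assms(3) by (intro powr_mono2) auto
  then show ?thesis using assms(2) unfolding diam_pow_def by (auto intro: ennreal_leI)
qed

lemma hausdorff_premeasure_le_finite_cover:
  fixes U :: "'i \<Rightarrow> 'a set"
  assumes "finite I" "A \<subseteq> (\<Union>i\<in>I. U i)" "\<And>i. i \<in> I \<Longrightarrow> U i \<subseteq> mspace m"
    and diam: "\<And>i x y. i \<in> I \<Longrightarrow> x \<in> U i \<Longrightarrow> y \<in> U i \<Longrightarrow> mdist m x y \<le> r"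
    and r: "0 < r" "r \<le> \<delta>" and "0 \<le> \<sigma>"
  shows "hausdorff_premeasure m \<sigma> \<delta> A \<le> ennreal (real (card I) * r powr \<sigma>)"
proof -
  obtain h where h: "bij_betw h {..<card I} I"
    using ex_bij_betw_nat_finite[OF assms(1)] by (auto simp: atLeast0LessThan)
  have hI: "h n \<in> I" if "n < card I" for n using h that by (auto simp: bij_betw_def)
  define V where "V n = (if n < card I then U (h n) else {})" for n
  have "ediam m (V n) \<le> ennreal \<delta>" for n
    unfolding ediam_def using order_trans[OF diam[OF hI] r(2)]
    by (intro SUP_least ennreal_leI) (auto simp: V_def split: if_splits)
  moreover have "A \<subseteq> (\<Union>n. V n)"
  proof
    fix x assume "x \<in> A"
    then obtain i where "i \<in> I" "x \<in> U i" using assms(2) by blast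
    moreover obtain n where "n < card I" "i = h n" using h \<open>i \<in> I\<close> unfolding bij_betw_def by blast
    ultimately have "x \<in> V n" by (simp add: V_def)
    then show "x \<in> (\<Union>n. V n)" by blast
  qed
  ultimately have "V \<in> fine_covers m \<delta> A"
    unfolding fine_covers_def using hI assms(3) by (auto simp: V_def)
  then have "hausdorff_premeasure m \<sigma> \<delta> A \<le> (\<Sum>n. diam_pow m \<sigma> (V n))"
    unfolding hausdorff_premeasure_def by (rule INF_lower)
  also have "\<dots> = (\<Sum>n<card I. diam_pow m \<sigma> (V n))"
    by (rule suminf_finite) (auto simp: V_def)
  also have "\<dots> \<le> (\<Sum>n<card I. ennreal (r powr \<sigma>))"
    using diam hI r(1) \<open>0 \<le> \<sigma>\<close> by (intro sum_mono diam_pow_le) (auto simp: V_def)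
  also have "\<dots> = ennreal (real (card I) * r powr \<sigma>)"
    by (simp add: ennreal_mult ennreal_of_nat_eq_real_of_nat)
  finally show ?thesis .
qed

lemma hausdorff_outer_eq_0I:
  assumes "\<And>\<delta> \<epsilon>. 0 < \<delta> \<Longrightarrow> 0 < \<epsilon> \<Longrightarrow> hausdorff_premeasure m \<sigma> \<delta> A \<le> ennreal \<epsilon>"
  shows "hausdorff_outer m \<sigma> A = 0"
proof -
  have "hausdorff_premeasure m \<sigma> \<delta> A \<le> 0" if "0 < \<delta>" for \<delta>
    by (rule ennreal_le_epsilon) (use assms that in simp)
  then show ?thesis unfolding hausdorff_outer_def by (auto simp: SUP_eq_iff intro!: antisym SUP_least)
qed

lemma hausdorff_outer_null_seq:
  fixes r c :: "nat \<Rightarrow> real"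
  assumes "r \<longlonglongrightarrow> 0" "c \<longlonglongrightarrow> 0"
    and le: "\<And>j \<delta>. J \<le> j \<Longrightarrow> r j \<le> \<delta> \<Longrightarrow> hausdorff_premeasure m \<sigma> \<delta> A \<le> ennreal (c j)"
  shows "hausdorff_outer m \<sigma> A = 0"
proof (rule hausdorff_outer_eq_0I)
  fix \<delta> \<epsilon> :: real assume "0 < \<delta>" "0 < \<epsilon>"
  have "\<forall>\<^sub>F j in sequentially. r j < \<delta> \<and> c j < \<epsilon> \<and> J \<le> j"
    using order_tendstoD(2)[OF assms(1) \<open>0 < \<delta>\<close>] order_tendstoD(2)[OF assms(2) \<open>0 < \<epsilon>\<close>]
      eventually_ge_at_top[of J] by eventually_elim auto
  then obtain j where j: "r j < \<delta>" "c j < \<epsilon>" "J \<le> j" by (auto dest: eventually_happens)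
  show "hausdorff_premeasure m \<sigma> \<delta> A \<le> ennreal \<epsilon>"
    by (rule order_trans[OF le[of j]]) (use j in \<open>auto intro: ennreal_leI\<close>)
qed

text \<open>A Borel-Cantelli argument: every tail of the sequence covers the limsup set, with cost
  given by the tail of a convergent series.\<close>

lemma hausdorff_outer_limsup_null:
  fixes r c :: "nat \<Rightarrow> real"
  assumes "r \<longlonglongrightarrow> 0" "summable c" "\<And>j. 0 \<le> c j"
    and le: "\<And>j \<delta>. r j \<le> \<delta> \<Longrightarrow> hausdorff_premeasure m \<sigma> \<delta> (A j) \<le> ennreal (c j)"
  shows "hausdorff_outer m \<sigma> (\<Inter>J. \<Union>j\<in>{J..}. A j) = 0"
proof (rule hausdorff_outer_eq_0I)
  fix \<delta> \<epsilon> :: real assume "0 < \<delta>" "0 < \<epsilon>"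
  obtain N1 where N1: "\<And>j. N1 \<le> j \<Longrightarrow> r j < \<delta>"
    using order_tendstoD(2)[OF assms(1) \<open>0 < \<delta>\<close>] unfolding eventually_sequentially by blast
  obtain N2 where N2: "\<And>n. N2 \<le> n \<Longrightarrow> norm (\<Sum>i. c (i + n)) < \<epsilon>"
    using suminf_exist_split[OF \<open>0 < \<epsilon>\<close> assms(2)] by blast
  define N where "N = max N1 N2"
  have "(\<Inter>J. \<Union>j\<in>{J..}. A j) \<subseteq> (\<Union>i. A (i + N))"
  proof
    fix x assume "x \<in> (\<Inter>J. \<Union>j\<in>{J..}. A j)"
    then obtain j where "N \<le> j" "x \<in> A j" by blast
    then have "x \<in> A ((j - N) + N)" by simp
    then show "x \<in> (\<Union>i. A (i + N))" by blast
  qed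
  then have "hausdorff_premeasure m \<sigma> \<delta> (\<Inter>J. \<Union>j\<in>{J..}. A j) \<le> hausdorff_premeasure m \<sigma> \<delta> (\<Union>i. A (i + N))"
    by (rule hausdorff_premeasure_mono)
  also have "\<dots> \<le> (\<Sum>i. hausdorff_premeasure m \<sigma> \<delta> (A (i + N)))" by (rule hausdorff_premeasure_UN)
  also have "\<dots> \<le> (\<Sum>i. ennreal (c (i + N)))"
    using N1 by (intro suminf_le le less_imp_le) (auto simp: N_def)
  also have "\<dots> = ennreal (\<Sum>i. c (i + N))"
    using assms(2,3) by (intro suminf_ennreal2) (auto simp: summable_iff_shift)
  also have "\<dots> \<le> ennreal \<epsilon>" using N2[of N] by (intro ennreal_leI) (auto simp: N_def)
  finally show "hausdorff_premeasure m \<sigma> \<delta> (\<Inter>J. \<Union>j\<in>{J..}. A j) \<le> ennreal \<epsilon>" .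
qed

lemma ediam_mono: "U \<subseteq> V \<Longrightarrow> ediam m U \<le> ediam m V"
  unfolding ediam_def by (intro SUP_subset_mono) auto

lemma ediam_submetric [simp]: "ediam (submetric m T) U = ediam m U"
  by (simp add: ediam_def)

lemma hausdorff_outer_submetric_le:
  assumes "B \<subseteq> T" "0 \<le> \<sigma>"
  shows "hausdorff_outer (submetric m T) \<sigma> B \<le> hausdorff_outer m \<sigma> B"
proof -
  have "hausdorff_premeasure (submetric m T) \<sigma> \<delta> B \<le> hausdorff_premeasure m \<sigma> \<delta> B" for \<delta>
    unfolding hausdorff_premeasure_def[of m]
  proof (rule INF_greatest)
    fix U assume U: "U \<in> fine_covers m \<delta> B"
    have d: "ediam m (U i \<inter> T) \<le> ediam m (U i)" "ediam m (U i) \<le> ennreal \<delta>" for i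
      using U by (auto simp: fine_covers_def intro: ediam_mono)
    have "(\<lambda>i. U i \<inter> T) \<in> fine_covers (submetric m T) \<delta> B"
      using U assms(1) d by (auto simp: fine_covers_def intro: order_trans)
    then have "hausdorff_premeasure (submetric m T) \<sigma> \<delta> B \<le> (\<Sum>i. diam_pow (submetric m T) \<sigma> (U i \<inter> T))"
      unfolding hausdorff_premeasure_def by (rule INF_lower)
    also have "\<dots> \<le> (\<Sum>i. diam_pow m \<sigma> (U i))"
    proof (intro suminf_le)
      fix i
      have "enn2real (ediam m (U i \<inter> T)) \<le> enn2real (ediam m (U i))"
        using d(1) le_less_trans[OF d(2) ennreal_less_top] by (intro enn2real_mono)
      then show "diam_pow (submetric m T) \<sigma> (U i \<inter> T) \<le> diam_pow m \<sigma> (U i)"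
        using assms(2) by (auto simp: diam_pow_def intro!: ennreal_leI powr_mono2)
    qed auto
    finally show "hausdorff_premeasure (submetric m T) \<sigma> \<delta> B \<le> (\<Sum>i. diam_pow m \<sigma> (U i))" .
  qed
  then show ?thesis unfolding hausdorff_outer_def by (intro SUP_mono') auto
qed

lemma measure_hausdorff_dim_le:
  assumes "A \<in> sets \<mu>" "emeasure \<mu> (space \<mu> - A) = 0" "hausdorff_outer m \<sigma> A = 0" "0 \<le> \<sigma>"
  shows "measure_hausdorff_dim m \<mu> \<le> ennreal \<sigma>"
proof -
  have "hausdorff_dim m A \<le> ennreal \<sigma>"
    unfolding hausdorff_dim_def using assms(3,4) by (intro Inf_lower) auto
  then show ?thesis
    unfolding measure_hausdorff_dim_def using assms(1,2) by (intro INF_lower2[of A]) auto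
qed

section \<open>Quasisymmetry from estimates at triadic scales\<close>

lemma homeomorphic_map_powr_sum:
  fixes K L g h :: real
  assumes "0 < K" "0 < L" "0 < g" "0 < h"
  shows "homeomorphic_map (top_of_set {0..}) (top_of_set {0..}) (\<lambda>t. K * ((L * t) powr g + (L * t) powr h))"
    (is "homeomorphic_map _ _ ?f")
proof -
  have cont: "continuous_on {0..} ?f"
    using assms by (intro continuous_intros continuous_on_powr') auto
  have mono: "?f x < ?f y" if "0 \<le> x" "x < y" for x y
    using assms that by (intro mult_strict_left_mono add_strict_mono powr_less_mono2) auto
  have inj: "inj_on ?f {0..}"
    by (rule inj_onI) (metis atLeast_iff less_irrefl linorder_less_linear mono)
  have surj: "?f ` {0..} = {0..}"
  proof
    show "?f ` {0..} \<subseteq> {0..}" using assms by auto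
    show "{0..} \<subseteq> ?f ` {0..}"
    proof
      fix y :: real assume "y \<in> {0..}"
      then have y: "0 \<le> y" by simp
      define z where "z = (y / K) powr (1 / g) / L"
      have z: "0 \<le> z" using assms by (simp add: z_def)
      have "(L * z) powr g = y / K" using assms y by (simp add: z_def powr_powr)
      then have "y = K * (L * z) powr g" using assms by simp
      also have "\<dots> \<le> ?f z" using assms by (intro mult_left_mono) auto
      finally have "y \<le> ?f z" .
      moreover have "?f 0 \<le> y" using y by simp
      moreover have "continuous_on {0..z} ?f" by (rule continuous_on_subset[OF cont]) auto
      ultimately obtain x where "0 \<le> x" "x \<le> z" "?f x = y" using IVT'[of ?f 0 y z] z by blast
      then show "y \<in> ?f ` {0..}" by (intro rev_image_eqI[of x]) auto
    qed
  qed
  have "path_connected {0::real..}" by (intro convex_imp_path_connected) simp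
  then obtain k where "homeomorphism {0..} {0..} ?f k"
    using homeomorphism_into_1d[OF _ cont surj inj] by blast
  then have "homeomorphic_maps (top_of_set {0..}) (top_of_set {0..}) ?f k"
    unfolding homeomorphism_def homeomorphic_maps_def by auto
  then show ?thesis unfolding homeomorphic_map_maps by blast
qed

lemma triadic_scale_exists:
  fixes r :: real
  assumes "0 < r" "r \<le> 1"
  obtains k :: nat where "(1/3) ^ Suc k < r" "r \<le> (1/3) ^ k"
proof -
  obtain n where n: "(1/3) ^ n < r" using real_arch_pow_inv[OF assms(1), of "1/3"] by auto
  define k where "k = (LEAST n. (1/3) ^ n < r)"
  have k: "(1/3) ^ k < r" unfolding k_def by (rule LeastI) fact
  then have "k \<noteq> 0" using assms(2) by (intro notI) simp
  then obtain l where l: "k = Suc l" by (cases k) auto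
  have "\<not> (1/3) ^ l < r" using not_less_Least[of l "\<lambda>n. (1/3) ^ n < r"] l unfolding k_def by simp
  then show thesis using that[of l] k l by simp
qed

text \<open>\<open>\<Lambda> k x\<close> plays the size of the image of a ball of radius 3^-k about
  \<open>x\<close>. Its two-sided geometric decay turns differences of scales into powers of
  distance ratios, so the distortion function can be a sum of two powers.\<close>

lemma quasisymmetric_if_triadic_estimates:
  fixes F :: "'a::metric_space \<Rightarrow> 'b::metric_space" and \<rho> :: "'a \<Rightarrow> 'a \<Rightarrow> real" and \<Lambda> :: "nat \<Rightarrow> 'a \<Rightarrow> real"
  assumes const: "0 < \<alpha>" "\<alpha> < 1" "0 < \<theta>" "\<theta> < 1" "0 < L" "0 < C" "0 < c"
    and \<Lambda>_pos: "\<And>k x. x \<in> T \<Longrightarrow> 0 < \<Lambda> k x"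
    and \<Lambda>_le: "\<And>k l x. x \<in> T \<Longrightarrow> k \<le> l \<Longrightarrow> \<Lambda> l x \<le> \<theta> ^ (l - k) * \<Lambda> k x"
    and \<Lambda>_ge: "\<And>k l x. x \<in> T \<Longrightarrow> k \<le> l \<Longrightarrow> \<alpha> ^ (l - k) * \<Lambda> k x \<le> \<Lambda> l x"
    and \<rho>: "\<And>x y. x \<in> T \<Longrightarrow> y \<in> T \<Longrightarrow> \<rho> x y \<le> 1 \<and> \<rho> x y \<le> dist x y \<and> dist x y \<le> L * \<rho> x y"
    and upper: "\<And>x y k. x \<in> T \<Longrightarrow> y \<in> T \<Longrightarrow> \<rho> x y \<le> (1/3) ^ k \<Longrightarrow> dist (F x) (F y) \<le> C * \<Lambda> k x"
    and lower: "\<And>x y k. x \<in> T \<Longrightarrow> y \<in> T \<Longrightarrow> (1/3) ^ k \<le> \<rho> x y \<Longrightarrow> c * \<Lambda> k x \<le> dist (F x) (F y)"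
    and target: "F ` T \<subseteq> T'"
  shows "quasisymmetric (submetric euclidean_metric T) (submetric euclidean_metric T') F"
proof -
  \<comment> \<open>\<open>g\<close> and \<open>h\<close> translate rates per triadic level into
    powers of length; the \<alpha> in \<open>K\<close> pays for one level between
    \<open>Suc kb\<close> and \<open>kb\<close>.\<close>
  define g where "g = log (1/3) \<theta>"
  define h where "h = log (1/3) \<alpha>"
  define K where "K = C / (c * \<alpha>)"
  have g: "0 < g" "(1/3) powr g = \<theta>" and h: "0 < h" "(1/3) powr h = \<alpha>"
    using const powr_log_cancel[of "1/3" \<theta>] powr_log_cancel[of "1/3" \<alpha>]
    by (auto simp: g_def h_def log_def intro!: divide_neg_neg)
  have K: "0 < K" using const by (simp add: K_def)
  \<comment> \<open>The factor 3 pays for rounding the distance to \<open>a\<close> to a triadic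
    scale, \<open>L\<close> for replacing \<rho> by the distance.\<close>
  let ?\<eta> = "\<lambda>t. K * ((3 * L * t) powr g + (3 * L * t) powr h)"
  have \<rho>_pos: "0 < \<rho> x y" if "x \<in> T" "y \<in> T" "x \<noteq> y" for x y
  proof -
    have "0 < dist x y" using that(3) by simp
    also have "\<dots> \<le> L * \<rho> x y" using \<rho>[OF that(1,2)] by blast
    finally show ?thesis using const(5) by (simp add: zero_less_mult_iff)
  qed
  have main: "F x \<noteq> F b \<and> dist (F x) (F a) / dist (F x) (F b) \<le> ?\<eta> (dist x a / dist x b)"
    if T: "x \<in> T" "a \<in> T" "b \<in> T" and xb: "x \<noteq> b" for x a b
  proof -
    obtain kb where kb: "(1/3) ^ Suc kb < \<rho> x b" "\<rho> x b \<le> (1/3) ^ kb"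
      using triadic_scale_exists[OF \<rho>_pos[OF T(1,3) xb]] \<rho>[OF T(1,3)] by blast
    have "c * (\<alpha> * \<Lambda> kb x) \<le> c * \<Lambda> (Suc kb) x"
      using \<Lambda>_ge[OF T(1), of kb "Suc kb"] const by (intro mult_left_mono) auto
    also have "\<dots> \<le> dist (F x) (F b)" using kb by (intro lower T) auto
    finally have Fb: "c * \<alpha> * \<Lambda> kb x \<le> dist (F x) (F b)" by simp
    moreover have "0 < c * \<alpha> * \<Lambda> kb x" using const \<Lambda>_pos[OF T(1)] by simp
    ultimately have Fb_pos: "0 < dist (F x) (F b)" by linarith
    moreover have "dist (F x) (F a) / dist (F x) (F b) \<le> ?\<eta> (dist x a / dist x b)"
    proof (cases "x = a")
      case True
      then show ?thesis using K by simp
    next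
      case False
      obtain ka where ka: "(1/3) ^ Suc ka < \<rho> x a" "\<rho> x a \<le> (1/3) ^ ka"
        using triadic_scale_exists[OF \<rho>_pos[OF T(1,2) False]] \<rho>[OF T(1,2)] by blast
      let ?t = "3 * L * (dist x a / dist x b)"
      have dxb: "0 < dist x b" using xb by simp
      have "(1/3) ^ Suc ka \<le> dist x a" using ka(1) \<rho>[OF T(1,2)] by linarith
      moreover have "dist x b \<le> L * (1/3) ^ kb"
        using \<rho>[OF T(1,3)] mult_left_mono[OF kb(2), of L] const by linarith
      ultimately have "(1/3) ^ Suc ka * dist x b \<le> dist x a * (L * (1/3) ^ kb)"
        by (intro mult_mono) auto
      then have scales: "(1/3) ^ ka \<le> ?t * (1/3) ^ kb"
        using dxb by (simp add: field_simps)
      have t: "0 \<le> ?t" using const by simp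
      \<comment> \<open>If \<open>a\<close> has the finer scale, the decay rate \<theta> applies;
        otherwise \<open>\<Lambda>\<close> grows towards coarser scales by at most 1/\<alpha> per
        level.\<close>
      have ratio: "\<Lambda> ka x \<le> (?t powr g + ?t powr h) * \<Lambda> kb x"
      proof (cases "kb \<le> ka")
        case True
        define n where "n = ka - kb"
        have "(1/3) ^ n * (1/3) ^ kb \<le> ?t * (1/3) ^ kb"
          using scales True by (simp add: n_def power_add[symmetric])
        then have n: "(1/3) ^ n \<le> ?t" by (rule mult_right_le_imp_le) simp
        have "\<theta> ^ n = ((1/3) powr real n) powr g"
          unfolding g(2)[symmetric] by (simp add: powr_powr powr_realpow[symmetric] mult.commute)
        also have "\<dots> \<le> ?t powr g"
          using n g(1) by (intro powr_mono2) (auto simp: powr_realpow)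
        finally have "\<theta> ^ n \<le> ?t powr g + ?t powr h" by (simp add: add_increasing2)
        then have "\<theta> ^ n * \<Lambda> kb x \<le> (?t powr g + ?t powr h) * \<Lambda> kb x"
          using \<Lambda>_pos[OF T(1), of kb] by (intro mult_right_mono) auto
        then show ?thesis using \<Lambda>_le[OF T(1) True] by (simp add: n_def)
      next
        case False
        define n where "n = kb - ka"
        have "(1/3) ^ ka \<le> ?t * (1/3) ^ n * (1/3) ^ ka"
          using scales False by (simp add: n_def power_add[symmetric] mult.assoc)
        then have "1 * (1/3) ^ ka \<le> (?t * (1/3) ^ n) * (1/3) ^ ka" by simp
        then have "1 \<le> ?t * (1/3) ^ n" by (rule mult_right_le_imp_le) simp
        then have "3 ^ n * 1 \<le> 3 ^ n * (?t * (1/3) ^ n)" by (intro mult_left_mono) auto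
        also have "\<dots> = (3 ^ n * (1/3) ^ n) * ?t" by (simp only: ac_simps)
        also have "\<dots> = ?t" by (simp add: power_mult_distrib[symmetric])
        finally have n: "3 ^ n \<le> ?t" by simp
        have "(1/\<alpha>) ^ n = (3 powr real n) powr h"
        proof -
          have "1 / \<alpha> = 3 powr h" unfolding h(2)[symmetric] by (simp add: powr_divide)
          then show ?thesis by (simp add: powr_powr powr_realpow[symmetric] mult.commute)
        qed
        also have "\<dots> \<le> ?t powr h"
          using n h(1) by (intro powr_mono2) (auto simp: powr_realpow)
        finally have "(1/\<alpha>) ^ n \<le> ?t powr g + ?t powr h" by (simp add: add_increasing)
        then have le: "(1/\<alpha>) ^ n * \<Lambda> kb x \<le> (?t powr g + ?t powr h) * \<Lambda> kb x"
          using \<Lambda>_pos[OF T(1), of kb] by (intro mult_right_mono) auto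
        have "\<alpha> ^ n * \<Lambda> ka x \<le> \<Lambda> kb x" using \<Lambda>_ge[OF T(1), of ka kb] False by (simp add: n_def)
        then have "(1/\<alpha>) ^ n * (\<alpha> ^ n * \<Lambda> ka x) \<le> (1/\<alpha>) ^ n * \<Lambda> kb x"
          using const by (intro mult_left_mono) auto
        moreover have "(1/\<alpha>) ^ n * (\<alpha> ^ n * \<Lambda> ka x) = \<Lambda> ka x"
          using const by (simp add: power_divide)
        ultimately show ?thesis using le by simp
      qed
      have "dist (F x) (F a) \<le> C * \<Lambda> ka x" using ka by (intro upper T) auto
      also have "\<dots> \<le> C * ((?t powr g + ?t powr h) * \<Lambda> kb x)"
        using const ratio by (intro mult_left_mono) auto
      also have "\<dots> = K * (?t powr g + ?t powr h) * (c * \<alpha> * \<Lambda> kb x)"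
        using const by (simp add: K_def)
      also have "\<dots> \<le> K * (?t powr g + ?t powr h) * dist (F x) (F b)"
        using K Fb by (intro mult_left_mono) auto
      finally show ?thesis using Fb_pos by (simp add: divide_le_eq)
    qed
    ultimately show ?thesis by auto
  qed
  have "homeomorphic_map (top_of_set {0..}) (top_of_set {0..}) ?\<eta>"
    using const by (intro homeomorphic_map_powr_sum K g h) auto
  then show ?thesis
    unfolding quasisymmetric_def using target main by (intro conjI exI[of _ ?\<eta>]) auto
qed

section \<open>The twisted embedding\<close>

lemma Basis_real_vec:
  "(Basis :: (real \<times> (real ^ 'n)) set) = insert (1, 0) ((\<lambda>i. (0, axis i 1)) ` UNIV)"
  by (auto simp: Basis_prod_def Basis_vec_def)

lemma infnorm_real_vec_le_iff:
  fixes p :: "real \<times> (real ^ 'n)"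
  shows "infnorm p \<le> c \<longleftrightarrow> \<bar>fst p\<bar> \<le> c \<and> (\<forall>i. \<bar>snd p $ i\<bar> \<le> c)"
  by (simp add: infnorm_Max Basis_real_vec inner_prod_def inner_axis)

lemma infnorm_real_vec_ge_iff:
  fixes p :: "real \<times> (real ^ 'n)"
  shows "c \<le> infnorm p \<longleftrightarrow> c \<le> \<bar>fst p\<bar> \<or> (\<exists>i. c \<le> \<bar>snd p $ i\<bar>)"
  by (simp add: infnorm_Max Basis_real_vec inner_prod_def inner_axis Max_ge_iff le_max_iff_disj)

section \<open>Coding and counting the cells of the strip\<close>

context phases
begin

definition cube :: "(real ^ 'n) set" where
  "cube = {y. \<forall>i. y $ i \<in> cantor}"

definition strip :: "(real \<times> (real ^ 'n)) set" where
  "strip = {0..1} \<times> cube"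

lemma compact_cube: "compact cube"
proof -
  have "closed {y :: real ^ 'n. y $ i \<in> cantor}" for i
    using closed_vimage[OF closed_cantor, of "\<lambda>y. y $ i"] by (simp add: vimage_def continuous_on_component)
  then have "closed (cube :: (real ^ 'n) set)" unfolding cube_def by (intro closed_Collect_all) auto
  moreover have "bounded (cube :: (real ^ 'n) set)"
  proof (rule bounded_subset[OF bounded_cbox])
    show "cube \<subseteq> cbox 0 (1 :: real ^ 'n)"
    proof
      fix y :: "real ^ 'n" assume "y \<in> cube"
      then have "y $ i \<in> {0..<1}" for i using cantor_subset unfolding cube_def by blast
      then show "y \<in> cbox 0 1" by (simp add: mem_box_cart less_imp_le)
    qed
  qed
  ultimately show ?thesis by (simp add: compact_eq_bounded_closed)
qed

lemma compact_strip: "compact strip"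
  unfolding strip_def by (intro compact_Times compact_cube compact_Icc)

lemma infnorm_strip_le_1:
  assumes "p \<in> strip" "q \<in> strip"
  shows "infnorm (p - q) \<le> 1"
proof -
  have "\<bar>snd p $ i - snd q $ i\<bar> \<le> 1" for i
  proof -
    have "snd p $ i \<in> cantor" "snd q $ i \<in> cantor"
      using assms by (auto simp: strip_def cube_def)
    then have "snd p $ i \<in> {0..<1}" "snd q $ i \<in> {0..<1}" using cantor_subset by blast+
    then show ?thesis by auto
  qed
  then show ?thesis using assms by (auto simp: strip_def infnorm_real_vec_le_iff)
qed

definition digits_before :: "nat \<Rightarrow> nat" where
  "digits_before j = (\<Sum>i<j. e i - s i)"

definition cylinders :: "nat \<Rightarrow> int set" where
  "cylinders k = (\<lambda>y. \<lfloor>3 ^ k * y\<rfloor>) ` cantor"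

text \<open>A cylinder of level \<open>s (Suc j)\<close> is determined by its ancestor of level
  \<open>s j\<close> and \<open>e j - s j\<close> free digits.\<close>

lemma card_cylinders: "finite (cylinders (s j)) \<and> card (cylinders (s j)) \<le> 3 ^ digits_before j"
proof (induction j)
  case 0
  have "cylinders (s 0) \<subseteq> {0}"
    using cantor_subset by (auto simp: cylinders_def s_0 floor_eq_iff)
  then show ?case using card_mono[of "{0}" "cylinders (s 0)"] finite_subset by (auto simp: digits_before_def)
next
  case (Suc j)
  let ?d = "e j - s j"
  let ?h = "\<lambda>(v, r). 3 ^ (s (Suc j) - e j) * (3 ^ ?d * v + r) :: int"
  let ?D = "cylinders (s j) \<times> {0..<3 ^ ?d :: int}"
  have sub: "cylinders (s (Suc j)) \<subseteq> ?h ` ?D"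
  proof
    fix c assume "c \<in> cylinders (s (Suc j))"
    then obtain y where y: "y \<in> cantor" "c = \<lfloor>3 ^ s (Suc j) * y\<rfloor>" by (auto simp: cylinders_def)
    let ?q = "\<lfloor>3 ^ e j * y\<rfloor>"
    have "(3::real) ^ e j = 3 ^ s j * 3 ^ ?d" using s_le_e[of j] by (simp add: power_add[symmetric])
    then have "3 ^ e j * y / real_of_int (3 ^ ?d) = 3 ^ s j * y" by (simp only: of_int_power of_int_numeral) simp
    then have eq: "?q div 3 ^ ?d = \<lfloor>3 ^ s j * y\<rfloor>"
      using floor_divide_real_eq_div[of "3 ^ ?d" "3 ^ e j * y"] by simp
    have "?q div 3 ^ ?d \<in> cylinders (s j)" unfolding cylinders_def by (rule image_eqI[of _ _ y]) (use eq y in simp_all)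
    then have "(?q div 3 ^ ?d, ?q mod 3 ^ ?d) \<in> ?D" by simp
    moreover have "c = ?h (?q div 3 ^ ?d, ?q mod 3 ^ ?d)" using y ix_cantor[OF y(1), of j] by simp
    ultimately show "c \<in> ?h ` ?D" by blast
  qed
  have fin: "finite ?D" using Suc by simp
  have "card (cylinders (s (Suc j))) \<le> card ?D"
    using card_mono[OF finite_imageI[OF fin] sub] card_image_le[OF fin, of ?h] by linarith
  also have "\<dots> = card (cylinders (s j)) * 3 ^ ?d" by (simp add: card_cartesian_product nat_power_eq)
  also have "\<dots> \<le> 3 ^ digits_before j * 3 ^ ?d" using Suc by (intro mult_right_mono) auto
  also have "\<dots> = 3 ^ digits_before (Suc j)" by (simp add: digits_before_def power_add)
  finally show ?case using finite_subset[OF sub] fin by blast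
qed

definition boxes :: "nat \<Rightarrow> ('n::finite \<Rightarrow> int) set" where
  "boxes j = PiE UNIV (\<lambda>_. cylinders (s j))"

lemma finite_boxes: "finite (boxes j :: ('n::finite \<Rightarrow> int) set)"
  unfolding boxes_def using card_cylinders by (intro finite_PiE) auto

lemma card_boxes: "card (boxes j :: ('n::finite \<Rightarrow> int) set) \<le> 3 ^ (CARD('n) * digits_before j)"
proof -
  have "card (boxes j :: ('n \<Rightarrow> int) set) = card (cylinders (s j)) ^ CARD('n)"
    unfolding boxes_def by (simp add: card_PiE)
  also have "\<dots> \<le> (3 ^ digits_before j) ^ CARD('n)" using card_cylinders by (intro power_mono) auto
  finally show ?thesis by (simp add: power_mult[symmetric] mult.commute)
qed

definition box_of :: "nat \<Rightarrow> real ^ 'n \<Rightarrow> 'n::finite \<Rightarrow> int" where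
  "box_of j y = (\<lambda>i. \<lfloor>3 ^ s j * y $ i\<rfloor>)"

lemma box_of_in_boxes: "y \<in> cube \<Longrightarrow> box_of j y \<in> boxes j"
  by (auto simp: boxes_def box_of_def cylinders_def cube_def PiE_def extensional_def)

lemma box_of_eq_imp_near:
  assumes "box_of j y = box_of j z"
  shows "\<bar>y $ i - z $ i\<bar> \<le> (1/3) ^ s j"
proof -
  have "trunc (s j) (y $ i) = trunc (s j) (z $ i)"
    using fun_cong[OF assms, of i] by (simp add: trunc_def box_of_def)
  then show ?thesis
    using trunc_bounds(1)[of "s j" "y $ i"] trunc_bounds(1)[of "s j" "z $ i"]
      trunc_bounds(2)[of "y $ i" "s j"] trunc_bounds(2)[of "z $ i" "s j"] by linarith
qed

text \<open>Both inequalities are weak, which makes columns compact and their images Borel. A point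
  of column \<open>i\<close> may then have floor \<open>i + 1\<close>; \<open>twist_cell\<close>
  absorbs this by \<open>W_neighbour\<close>.\<close>

definition columns :: "nat \<Rightarrow> int set \<Rightarrow> (real \<times> (real ^ 'n)) set" where
  "columns j I = {p \<in> strip. \<exists>i\<in>I. of_int i \<le> 3 ^ s j * fst p \<and> 3 ^ s j * fst p \<le> of_int i + 1}"

definition cell :: "nat \<Rightarrow> int \<times> ('n \<Rightarrow> int) \<Rightarrow> (real \<times> (real ^ 'n::finite)) set" where
  "cell j = (\<lambda>(i, v). {p \<in> strip. of_int i \<le> 3 ^ s j * fst p \<and> 3 ^ s j * fst p \<le> of_int i + 1 \<and> box_of j (snd p) = v})"

lemma columns_subset_cells: "columns j I \<subseteq> (\<Union>c\<in>I \<times> boxes j. cell j c)"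
proof
  fix p assume "p \<in> columns j I"
  then obtain i where i: "i \<in> I" "p \<in> cell j (i, box_of j (snd p))" and p: "p \<in> strip"
    by (auto simp: columns_def cell_def)
  have "box_of j (snd p) \<in> boxes j" using p by (auto simp: strip_def intro: box_of_in_boxes)
  with i show "p \<in> (\<Union>c\<in>I \<times> boxes j. cell j c)" by blast
qed

lemma infnorm_cell_le:
  assumes "p \<in> cell j c" "q \<in> cell j c"
  shows "infnorm (p - q) \<le> (1/3) ^ s j"
proof -
  obtain i v where c: "c = (i, v)" by (cases c)
  have "\<bar>3 ^ s j * (fst p - fst q)\<bar> \<le> 1" using assms unfolding c cell_def right_diff_distrib by auto
  then have "(1/3) ^ s j * (3 ^ s j * \<bar>fst p - fst q\<bar>) \<le> (1/3) ^ s j * 1"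
    by (intro mult_left_mono) (auto simp: abs_mult)
  moreover have "(1/3) ^ s j * (3 ^ s j * \<bar>fst p - fst q\<bar>) = (3 ^ s j * (1/3) ^ s j) * \<bar>fst p - fst q\<bar>"
    by (simp only: ac_simps)
  ultimately have "\<bar>fst p - fst q\<bar> \<le> (1/3) ^ s j" unfolding power_third_cancel by simp
  moreover have "box_of j (snd p) = box_of j (snd q)" using assms unfolding c cell_def by auto
  ultimately show ?thesis using box_of_eq_imp_near by (auto simp: infnorm_real_vec_le_iff)
qed

lemma compact_columns:
  assumes "finite I"
  shows "compact (columns j I :: (real \<times> (real ^ 'n)) set)"
proof -
  have eq: "(columns j I :: (real \<times> (real ^ 'n)) set) = strip \<inter> (\<Union>i\<in>I. {p. of_int i \<le> 3 ^ s j * fst p \<and> 3 ^ s j * fst p \<le> of_int i + 1})"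
    by (auto simp: columns_def)
  have "closed (\<Union>i\<in>I. {p :: real \<times> (real ^ 'n). of_int i \<le> 3 ^ s j * fst p \<and> 3 ^ s j * fst p \<le> of_int i + 1})"
    using assms by (intro closed_UN ballI closed_Collect_conj closed_Collect_le continuous_intros)
  then show ?thesis unfolding eq by (intro compact_Int_closed compact_strip)
qed

text \<open>The map is arbitrary because the count serves twice: with \<open>twist\<close> on good
  columns and with the identity on bad ones.\<close>

lemma columns_premeasure:
  fixes H :: "real \<times> (real ^ 'n) \<Rightarrow> 'b::metric_space"
  assumes "finite I" "0 \<le> \<sigma>" "0 < r" "r \<le> \<epsilon>"
    and "\<And>c p q. c \<in> I \<times> boxes j \<Longrightarrow> p \<in> cell j c \<Longrightarrow> q \<in> cell j c \<Longrightarrow> dist (H p) (H q) \<le> r"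
  shows "hausdorff_premeasure euclidean_metric \<sigma> \<epsilon> (H ` columns j I)
    \<le> ennreal (real (card I) * 3 ^ (CARD('n) * digits_before j) * r powr \<sigma>)"
proof -
  have "H ` columns j I \<subseteq> (\<Union>c\<in>I \<times> boxes j. H ` cell j c)" using columns_subset_cells[of j I] by blast
  then have "hausdorff_premeasure euclidean_metric \<sigma> \<epsilon> (H ` columns j I)
      \<le> ennreal (real (card (I \<times> (boxes j :: ('n \<Rightarrow> int) set))) * r powr \<sigma>)"
    using assms(2-5) by (intro hausdorff_premeasure_le_finite_cover finite_cartesian_product assms(1) finite_boxes) auto
  also have "\<dots> \<le> ennreal (real (card I) * 3 ^ (CARD('n) * digits_before j) * r powr \<sigma>)"
  proof (intro ennreal_leI mult_right_mono)
    have "card (I \<times> (boxes j :: ('n \<Rightarrow> int) set)) \<le> card I * 3 ^ (CARD('n) * digits_before j)"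
      unfolding card_cartesian_product by (intro mult_left_mono card_boxes) auto
    then have "real (card (I \<times> (boxes j :: ('n \<Rightarrow> int) set))) \<le> real (card I * 3 ^ (CARD('n) * digits_before j))"
      by (rule of_nat_mono)
    then show "real (card (I \<times> (boxes j :: ('n \<Rightarrow> int) set))) \<le> real (card I) * 3 ^ (CARD('n) * digits_before j)"
      by simp
  qed auto
  finally show ?thesis .
qed

end

section \<open>Distortion and dimension estimates for the twisted map\<close>

context twisted_phases
begin

definition twist :: "real \<times> (real ^ 'n) \<Rightarrow> real \<times> (real ^ 'n)" where
  "twist p = (f (fst p), \<chi> i. G (fst p) (snd p $ i))"

lemma twist_upper:
  fixes p q :: "real \<times> (real ^ 'n)"
  assumes "p \<in> strip" "q \<in> strip" "infnorm (p - q) \<le> (1/3) ^ k"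
  shows "dist (twist p) (twist q) \<le> sqrt (real DIM(real \<times> (real ^ 'n))) * (6 / \<delta>) * lam k (fst p)"
proof -
  have near: "\<bar>fst p - fst q\<bar> \<le> (1/3) ^ k" "\<bar>snd p $ i - snd q $ i\<bar> \<le> (1/3) ^ k" for i
    using assms(3) by (auto simp: infnorm_real_vec_le_iff)
  have "\<bar>f (fst p) - f (fst q)\<bar> \<le> (2 / \<delta>) * lam k (fst p)" by (rule f_near[OF near(1)])
  also have "\<dots> \<le> (6 / \<delta>) * lam k (fst p)"
    using \<delta>_pos lam_pos[of k "fst p"] by (intro mult_right_mono divide_right_mono) auto
  finally have "\<bar>f (fst p) - f (fst q)\<bar> \<le> (6 / \<delta>) * lam k (fst p)" .
  moreover have "\<bar>G (fst p) (snd p $ i) - G (fst q) (snd q $ i)\<bar> \<le> (6 / \<delta>) * lam k (fst p)" for i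
    using assms(1,2) near by (intro G_upper) (auto simp: strip_def cube_def)
  ultimately have "infnorm (twist p - twist q) \<le> (6 / \<delta>) * lam k (fst p)"
    by (simp add: infnorm_real_vec_le_iff twist_def)
  then have "sqrt (real DIM(real \<times> (real ^ 'n))) * infnorm (twist p - twist q)
      \<le> sqrt (real DIM(real \<times> (real ^ 'n))) * ((6 / \<delta>) * lam k (fst p))" by (intro mult_left_mono) auto
  then show ?thesis using norm_le_infnorm[of "twist p - twist q"] by (simp add: dist_norm)
qed

lemma twist_lower:
  fixes p q :: "real \<times> (real ^ 'n)"
  assumes "p \<in> strip" "q \<in> strip" "(1/3) ^ k \<le> infnorm (p - q)"
  shows "\<delta>\<^sup>2 / 8 * lam k (fst p) \<le> dist (twist p) (twist q)"
proof -
  consider "(1/3) ^ k \<le> \<bar>fst p - fst q\<bar>" | i where "(1/3) ^ k \<le> \<bar>snd p $ i - snd q $ i\<bar>"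
    using assms(3) by (auto simp: infnorm_real_vec_ge_iff)
  then have "\<delta>\<^sup>2 / 8 * lam k (fst p) \<le> infnorm (twist p - twist q)"
  proof cases
    case 1
    have "\<delta>\<^sup>2 / 8 * lam k (fst p) \<le> \<delta>\<^sup>2 * lam k (fst p)" using lam_pos[of k "fst p"] by (intro mult_right_mono) auto
    then show ?thesis using f_far[OF 1] by (simp add: infnorm_real_vec_ge_iff twist_def)
  next
    case 2
    have "snd p $ i \<in> cantor" "snd q $ i \<in> cantor" using assms(1,2) by (auto simp: strip_def cube_def)
    from G_lower[OF this 2, of "fst p" "fst q"] show ?thesis
      by (auto simp: infnorm_real_vec_ge_iff twist_def)
  qed
  then show ?thesis using infnorm_le_norm[of "twist p - twist q"] by (simp add: dist_norm)
qed

lemma inj_on_twist: "inj_on twist (strip :: (real \<times> (real ^ 'n)) set)"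
proof (rule inj_onI, rule ccontr)
  fix p q :: "real \<times> (real ^ 'n)"
  assume p: "p \<in> strip" "q \<in> strip" "twist p = twist q" "p \<noteq> q"
  then have "0 < infnorm (p - q)" by (simp add: infnorm_pos_lt)
  then obtain k where "(1/3) ^ k < infnorm (p - q)" using real_arch_pow_inv[of "infnorm (p - q)" "1/3"] by auto
  then have "\<delta>\<^sup>2 / 8 * lam k (fst p) \<le> dist (twist p) (twist q)" using p by (intro twist_lower) auto
  moreover have "0 < \<delta>\<^sup>2 / 8 * lam k (fst p)" using \<delta>_pos lam_pos by simp
  ultimately show False using p(3) by simp
qed

lemma continuous_on_twist: "continuous_on (strip :: (real \<times> (real ^ 'n)) set) twist"
  unfolding continuous_on_iff
proof (intro ballI allI impI)
  fix p :: "real \<times> (real ^ 'n)" and \<epsilon> :: real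
  assume p: "p \<in> strip" and \<epsilon>: "0 < \<epsilon>"
  let ?C = "sqrt (real DIM(real \<times> (real ^ 'n))) * (6 / \<delta>)"
  have "(\<lambda>k. ?C * lam k (fst p)) \<longlonglongrightarrow> ?C * 0" by (intro tendsto_mult_left lam_tendsto_0)
  then have "\<forall>\<^sub>F k in sequentially. ?C * lam k (fst p) < \<epsilon>" using \<epsilon> by (intro order_tendstoD(2)) auto
  then obtain k where k: "?C * lam k (fst p) < \<epsilon>" by (auto dest: eventually_happens)
  show "\<exists>d>0. \<forall>q\<in>strip. dist q p < d \<longrightarrow> dist (twist q) (twist p) < \<epsilon>"
  proof (intro exI[of _ "(1/3) ^ k"] conjI ballI impI)
    fix q :: "real \<times> (real ^ 'n)" assume q: "q \<in> strip" "dist q p < (1/3) ^ k"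
    have "infnorm (p - q) \<le> (1/3) ^ k"
      using infnorm_le_norm[of "p - q"] q(2) by (simp add: dist_norm norm_minus_commute)
    then have "dist (twist p) (twist q) \<le> ?C * lam k (fst p)" by (rule twist_upper[OF p q(1)])
    then show "dist (twist q) (twist p) < \<epsilon>" using k by (simp add: dist_commute)
  qed simp
qed

text \<open>The sup norm is the reference distance, since triadic scales act coordinatewise. Domain
  and target vary: the strip into the whole space gives the embedding, the support onto its image
  gives the competitor for the conformal dimension.\<close>

lemma quasisymmetric_twist:
  assumes "T \<subseteq> (strip :: (real \<times> (real ^ 'n)) set)" "twist ` T \<subseteq> T'"
  shows "quasisymmetric (submetric euclidean_metric T) (submetric euclidean_metric T') twist"
proof (rule quasisymmetric_if_triadic_estimates[where \<rho> = "\<lambda>p q. infnorm (p - q)" and \<Lambda> = "\<lambda>k p. lam k (fst p)"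
      and \<alpha> = \<delta> and \<theta> = "1 - 2 * \<delta>" and L = "sqrt (real DIM(real \<times> (real ^ 'n)))"
      and C = "sqrt (real DIM(real \<times> (real ^ 'n))) * (6 / \<delta>)" and c = "\<delta>\<^sup>2 / 8"])
  show "infnorm (p - q) \<le> 1 \<and> infnorm (p - q) \<le> dist p q \<and>
      dist p q \<le> sqrt (real DIM(real \<times> (real ^ 'n))) * infnorm (p - q)" if "p \<in> T" "q \<in> T" for p q
    using that assms(1) infnorm_strip_le_1[of p q] infnorm_le_norm[of "p - q"] norm_le_infnorm[of "p - q"]
    by (auto simp: dist_norm)
  show "dist (twist p) (twist q) \<le> sqrt (real DIM(real \<times> (real ^ 'n))) * (6 / \<delta>) * lam k (fst p)"
    if "p \<in> T" "q \<in> T" "infnorm (p - q) \<le> (1/3) ^ k" for p q k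
    using that assms(1) by (intro twist_upper) auto
  show "\<delta>\<^sup>2 / 8 * lam k (fst p) \<le> dist (twist p) (twist q)"
    if "p \<in> T" "q \<in> T" "(1/3) ^ k \<le> infnorm (p - q)" for p q k
    using that assms(1) by (intro twist_lower) auto
qed (use \<delta>_pos \<delta>_le lam_pos lam_le_power lam_ge_power assms(2) in auto)

text \<open>Triadic intervals on which \<open>f\<close> contracts less than by the exponent \<open>Q\<close>.\<close>

definition bad :: "real \<Rightarrow> nat \<Rightarrow> int set" where
  "bad Q j = {i \<in> {0..<2 * 3 ^ s j}. (1/3) powr (Q * s j) < W (s j) i}"

lemma twist_cell:
  fixes p q :: "real \<times> (real ^ 'n)"
  assumes "p \<in> cell j (i, v)" "q \<in> cell j (i, v)" "W (s j) i \<le> c"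
  shows "dist (twist p) (twist q) \<le> sqrt (real DIM(real \<times> (real ^ 'n))) * (6 / \<delta>\<^sup>2) * c"
proof -
  let ?C = "sqrt (real DIM(real \<times> (real ^ 'n))) * (6 / \<delta>)"
  have "of_int i \<le> 3 ^ s j * fst p" "3 ^ s j * fst p \<le> of_int i + 1" using assms(1) by (auto simp: cell_def)
  then have "ix (s j) (fst p) = i \<or> ix (s j) (fst p) = i + 1" by linarith
  then have "\<delta> * lam (s j) (fst p) \<le> W (s j) i"
    using W_neighbour(2)[of "s j" i] \<delta>_le mult_right_mono[of \<delta> 1 "W (s j) i"] W_pos[of "s j" i]
    unfolding lam_def by auto
  then have "lam (s j) (fst p) \<le> c / \<delta>" using assms(3) \<delta>_pos by (simp add: field_simps)
  then have "?C * lam (s j) (fst p) \<le> ?C * (c / \<delta>)" using \<delta>_pos by (intro mult_left_mono) auto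
  moreover have "dist (twist p) (twist q) \<le> ?C * lam (s j) (fst p)"
    using assms(1,2) infnorm_cell_le[OF assms(1,2)] by (intro twist_upper) (auto simp: cell_def)
  ultimately show ?thesis by (simp add: power2_eq_square)
qed

text \<open>\<open>A\<close> collects the images of points lying in good columns for infinitely many
  \<open>j\<close>. Up to constants there are at most 3^((1+t) s j) good cells, with images of
  diameter 3^(-Q s j), so Q\<sigma> \<ge> 2 + t leaves a summable 3^(-s j). Points mapped outside
  \<open>A\<close> lie in bad columns from some index on, where the (1+t)-dimensional cost is a
  constant times the proportion of bad columns.\<close>

lemma twist_small_dimension:
  fixes t \<sigma> Q :: real
  assumes "0 \<le> t" "0 < \<sigma>" "2 + t \<le> Q * \<sigma>"
    and digits: "\<And>j. real (CARD('n) * digits_before j) \<le> t * s j + real CARD('n)"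
    and bad: "(\<lambda>j. real (card (bad Q j)) / 3 ^ s j) \<longlonglongrightarrow> 0"
  obtains A :: "(real \<times> (real ^ 'n)) set" where "A \<in> sets borel"
    "hausdorff_outer euclidean_metric \<sigma> A = 0"
    "hausdorff_outer euclidean_metric (1 + t) {p \<in> strip. twist p \<notin> A} = 0"
proof -
  let ?n = "CARD('n)"
  let ?L = "sqrt (real DIM(real \<times> (real ^ 'n)))"
  let ?C = "?L * (6 / \<delta>\<^sup>2)"
  have L: "0 < ?L" by simp
  have C: "0 < ?C" using \<delta>_pos by simp
  have inv3: "(1/3 :: real) powr x = 3 powr (- x)" for x by (simp add: powr_divide powr_minus_divide)
  have third: "(1/3 :: real) ^ s j = 3 powr (- real (s j))" for j
    by (simp add: powr_minus_divide powr_realpow power_divide)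
  have boxes: "3 ^ (?n * digits_before j) \<le> 3 powr (t * s j) * 3 ^ ?n" for j
  proof -
    have "3 ^ (?n * digits_before j) = 3 powr real (?n * digits_before j)" by (rule powr_realpow[symmetric]) simp
    also have "\<dots> \<le> 3 powr (t * s j + real ?n)" using digits by (intro powr_mono) auto
    also have "\<dots> = 3 powr (t * s j) * 3 ^ ?n" by (simp add: powr_add powr_realpow)
    finally show ?thesis .
  qed
  have third_0: "(\<lambda>j. (1/3::real) ^ s j) \<longlonglongrightarrow> 0"
  proof (rule tendsto_sandwich[OF _ _ tendsto_const])
    show "\<forall>\<^sub>F j in sequentially. (1/3::real) ^ s j \<le> (1/3) ^ j" by (simp add: power_third_mono le_s del: power_one_over)
    show "(\<lambda>j. (1/3::real) ^ j) \<longlonglongrightarrow> 0" by (intro LIMSEQ_power_zero) auto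
  qed simp
  define good where "good j = {0..<2 * 3 ^ s j} - bad Q j" for j
  define A where "A = (\<Inter>J. \<Union>j\<in>{J..}. twist ` (columns j (good j) :: (real \<times> (real ^ 'n)) set))"
  have fin: "finite (good j)" "finite (bad Q j)" for j
  proof -
    show "finite (bad Q j)" by (rule finite_subset[of _ "{0..<2 * 3 ^ s j}"]) (auto simp: bad_def)
  qed (simp add: good_def)
  have "compact (twist ` (columns j (good j) :: (real \<times> (real ^ 'n)) set))" for j
    using fin by (intro compact_continuous_image continuous_on_subset[OF continuous_on_twist] compact_columns)
      (auto simp: columns_def)
  then have "twist ` (columns j (good j) :: (real \<times> (real ^ 'n)) set) \<in> sets borel" for j
    by (simp add: borel_closed compact_imp_closed)
  then have "(\<Union>j\<in>{J..}. twist ` (columns j (good j) :: (real \<times> (real ^ 'n)) set)) \<in> sets borel" for J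
    by (intro sets.countable_UN') auto
  then have "A \<in> sets borel"
    unfolding A_def by (intro sets.countable_INT'') auto
  moreover have "hausdorff_outer euclidean_metric \<sigma> A = 0"
    unfolding A_def
  proof (rule hausdorff_outer_limsup_null)
    let ?r = "\<lambda>j. ?C * (1/3) powr (Q * s j)"
    let ?c = "\<lambda>j. 2 * 3 ^ ?n * ?C powr \<sigma> * (1/3) ^ j"
    have "0 < Q * \<sigma>" using assms(1,3) by simp
    then have Q: "0 < Q" using assms(2) by (simp add: zero_less_mult_iff)
    show "?r \<longlonglongrightarrow> 0"
    proof -
      have "(\<lambda>j. ((1/3) ^ s j) powr Q) \<longlonglongrightarrow> 0"
        using tendsto_powr'[OF third_0 tendsto_const[of Q]] Q by simp
      moreover have "((1/3) ^ s j) powr Q = (1/3) powr (Q * s j)" for j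
        unfolding third inv3 by (simp add: powr_powr mult.commute)
      ultimately show ?thesis by (intro tendsto_mult_right_zero) simp
    qed
    show "summable ?c" by (intro summable_mult summable_geometric) simp
    show "0 \<le> ?c j" for j by simp
    fix j \<epsilon> assume r: "?r j \<le> \<epsilon>"
    have "hausdorff_premeasure euclidean_metric \<sigma> \<epsilon> (twist ` (columns j (good j) :: (real \<times> (real ^ 'n)) set))
        \<le> ennreal (real (card (good j)) * 3 ^ (?n * digits_before j) * ?r j powr \<sigma>)"
    proof (rule columns_premeasure[OF fin(1) _ _ r])
      show "0 \<le> \<sigma>" using assms(2) by simp
      show "0 < ?r j" by (rule mult_pos_pos[OF C]) simp
      fix c and p q :: "real \<times> (real ^ 'n)"
      assume c: "c \<in> good j \<times> boxes j" "p \<in> cell j c" "q \<in> cell j c"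
      obtain i v where iv: "c = (i, v)" by (cases c)
      then have "W (s j) i \<le> (1/3) powr (Q * s j)" using c(1) by (auto simp: good_def bad_def not_less)
      then show "dist (twist p) (twist q) \<le> ?r j" using c(2,3) unfolding iv by (intro twist_cell)
    qed
    also have "real (card (good j)) * 3 ^ (?n * digits_before j) * ?r j powr \<sigma>
        \<le> (2 * 3 ^ s j) * (3 powr (t * s j) * 3 ^ ?n) * ?r j powr \<sigma>"
    proof (intro mult_right_mono mult_mono boxes)
      have "card (good j) \<le> card {0..<2 * 3 ^ s j :: int}" unfolding good_def by (intro card_mono) auto
      also have "\<dots> = 2 * 3 ^ s j" by (simp add: nat_mult_distrib nat_power_eq)
      finally have "real (card (good j)) \<le> real (2 * 3 ^ s j)" by (rule of_nat_mono)
      then show "real (card (good j)) \<le> 2 * 3 ^ s j" by simp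
    qed auto
    also have "\<dots> = 2 * 3 ^ ?n * ?C powr \<sigma> * 3 powr (s j * (1 + t - Q * \<sigma>))"
    proof -
      have "?r j powr \<sigma> = ?C powr \<sigma> * 3 powr (- (Q * s j * \<sigma>))"
        using C unfolding inv3 by (subst powr_mult) (auto simp: powr_powr)
      moreover have "3 powr (s j * (1 + t - Q * \<sigma>)) = 3 ^ s j * 3 powr (t * s j) * 3 powr (- (Q * s j * \<sigma>))"
        unfolding powr_realpow[of 3 "s j", simplified, symmetric] powr_add[symmetric] by (simp add: algebra_simps)
      ultimately show ?thesis by simp
    qed
    also have "\<dots> \<le> ?c j"
    proof (intro mult_left_mono)
      have "real (s j) * (1 + t - Q * \<sigma>) \<le> real (s j) * (- 1)" using assms(3) by (intro mult_left_mono) auto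
      then have "3 powr (s j * (1 + t - Q * \<sigma>)) \<le> 3 powr (- real (s j))" by (intro powr_mono) auto
      also have "\<dots> = (1/3) ^ s j" by (rule third[symmetric])
      also have "\<dots> \<le> (1/3) ^ j" by (rule power_third_mono[OF le_s])
      finally show "3 powr (s j * (1 + t - Q * \<sigma>)) \<le> (1/3) ^ j" .
    qed simp
    finally show "hausdorff_premeasure euclidean_metric \<sigma> \<epsilon> (twist ` (columns j (good j) :: (real \<times> (real ^ 'n)) set))
        \<le> ennreal (?c j)" by (simp add: ennreal_leI)
  qed
  moreover have "hausdorff_outer euclidean_metric (1 + t) {p \<in> strip. twist p \<notin> A} = 0"
  proof -
    define N where "N J = (\<Inter>j\<in>{J..}. columns j (bad Q j) :: (real \<times> (real ^ 'n)) set)" for J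
    have "{p \<in> strip. twist p \<notin> A} \<subseteq> (\<Union>J. N J)"
    proof
      fix p assume "p \<in> {p \<in> strip. twist p \<notin> A}"
      then obtain J where p: "p \<in> strip" "\<And>j. J \<le> j \<Longrightarrow> twist p \<notin> twist ` columns j (good j)"
        unfolding A_def by blast
      have "p \<in> columns j (bad Q j)" if "J \<le> j" for j
      proof -
        let ?i = "ix (s j) (fst p)"
        have i: "of_int ?i \<le> 3 ^ s j * fst p" "3 ^ s j * fst p \<le> of_int ?i + 1" by linarith+
        have "0 \<le> fst p" "fst p \<le> 1" using p(1) by (auto simp: strip_def)
        then have "0 \<le> 3 ^ s j * fst p" "3 ^ s j * fst p \<le> 3 ^ s j * 1" by (auto intro: mult_left_mono)
        then have "0 \<le> ?i" "?i < 2 * 3 ^ s j" by (auto simp: floor_less_iff intro: le_less_trans)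
        moreover have "?i \<notin> good j" using p(1) p(2)[OF that] i unfolding columns_def by blast
        ultimately have "?i \<in> bad Q j" by (simp add: good_def)
        then show ?thesis using p(1) i unfolding columns_def by blast
      qed
      then show "p \<in> (\<Union>J. N J)" by (auto simp: N_def)
    qed
    then have "hausdorff_outer euclidean_metric (1 + t) {p \<in> strip. twist p \<notin> A}
        \<le> hausdorff_outer euclidean_metric (1 + t) (\<Union>J. N J)" by (rule hausdorff_outer_mono)
    also have "\<dots> \<le> (\<Sum>J. hausdorff_outer euclidean_metric (1 + t) (N J))" by (rule hausdorff_outer_UN)
    finally have le: "hausdorff_outer euclidean_metric (1 + t) {p \<in> strip. twist p \<notin> A}
        \<le> (\<Sum>J. hausdorff_outer euclidean_metric (1 + t) (N J))" .
    have "hausdorff_outer euclidean_metric (1 + t) (N J) = 0" for J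
    proof (rule hausdorff_outer_null_seq)
      let ?r = "\<lambda>j. ?L * (1/3) ^ s j"
      let ?c = "\<lambda>j. 3 ^ ?n * ?L powr (1 + t) * (real (card (bad Q j)) / 3 ^ s j)"
      show "?r \<longlonglongrightarrow> 0" by (rule tendsto_mult_right_zero[OF third_0])
      show "?c \<longlonglongrightarrow> 0" by (rule tendsto_mult_right_zero[OF bad])
      fix j \<epsilon> assume j: "J \<le> j" "?r j \<le> \<epsilon>"
      have "N J \<subseteq> id ` columns j (bad Q j)" using j(1) by (auto simp: N_def)
      then have "hausdorff_premeasure euclidean_metric (1 + t) \<epsilon> (N J)
          \<le> hausdorff_premeasure euclidean_metric (1 + t) \<epsilon> (id ` (columns j (bad Q j) :: (real \<times> (real ^ 'n)) set))"
        by (rule hausdorff_premeasure_mono)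
      also have "\<dots> \<le> ennreal (real (card (bad Q j)) * 3 ^ (?n * digits_before j) * ?r j powr (1 + t))"
      proof (intro columns_premeasure fin j)
        fix c and p q :: "real \<times> (real ^ 'n)" assume "p \<in> cell j c" "q \<in> cell j c"
        then have "?L * infnorm (p - q) \<le> ?L * (1/3) ^ s j" by (intro mult_left_mono infnorm_cell_le) auto
        from order_trans[OF norm_le_infnorm this] show "dist (id p) (id q) \<le> ?L * (1/3) ^ s j"
          unfolding dist_norm id_apply .
      qed (use assms(1) in auto)
      also have "real (card (bad Q j)) * 3 ^ (?n * digits_before j) * ?r j powr (1 + t)
          \<le> real (card (bad Q j)) * (3 powr (t * s j) * 3 ^ ?n) * ?r j powr (1 + t)"
        by (intro mult_right_mono mult_left_mono boxes) auto
      also have "\<dots> = ?c j"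
      proof -
        have "?r j powr (1 + t) = ?L powr (1 + t) * 3 powr (- real (s j) * (1 + t))"
          unfolding third using L by (subst powr_mult) (auto simp: powr_powr)
        moreover have "3 powr (t * s j) * 3 powr (- real (s j) * (1 + t)) = 1 / 3 ^ s j"
          unfolding powr_add[symmetric]
          by (simp add: algebra_simps powr_minus_divide powr_realpow)
        ultimately show ?thesis by (simp add: mult_ac)
      qed
      finally show "hausdorff_premeasure euclidean_metric (1 + t) \<epsilon> (N J) \<le> ennreal (?c j)"
        by (simp add: ennreal_leI)
    qed
    with le show ?thesis by simp
  qed
  ultimately show thesis by (rule that)
qed

end

section \<open>The Hausdorff measure of the Cantor cube\<close>

context phases
begin

lemma digits_before_Suc: "digits_before (Suc j) = digits_before j + (e j - s j)"
  by (simp add: digits_before_def)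

text \<open>Covers by boxes of level \<open>s j\<close> alone suffice; the bounded surplus of free
  digits only enters the constant.\<close>

lemma hausdorff_outer_cube_finite:
  fixes t :: real
  assumes "0 \<le> t" and digits: "\<And>j. real (CARD('n) * digits_before j) \<le> t * s j + real CARD('n)"
  shows "hausdorff_outer euclidean_metric t (cube :: (real ^ 'n) set) < \<infinity>"
proof -
  let ?n = "CARD('n)"
  let ?c = "3 ^ ?n * real ?n powr t"
  have "hausdorff_premeasure euclidean_metric t \<epsilon> (cube :: (real ^ 'n) set) \<le> ennreal ?c" if "0 < \<epsilon>" for \<epsilon>
  proof -
    have "0 < \<epsilon> / ?n" using that by (simp add: zero_less_divide_iff card_gt_0_iff)
    then obtain j where "(1/3) ^ j < \<epsilon> / ?n"
      using real_arch_pow_inv[of "\<epsilon> / ?n" "1/3"] by auto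
    moreover have "(1/3 :: real) ^ s j \<le> (1/3) ^ j" by (rule power_third_mono[OF le_s])
    ultimately have "(1/3) ^ s j \<le> \<epsilon> / ?n" by linarith
    then have r: "?n * (1/3) ^ s j \<le> \<epsilon>" by (simp add: field_simps)
    have "hausdorff_premeasure euclidean_metric t \<epsilon> (cube :: (real ^ 'n) set)
        \<le> ennreal (real (card (boxes j :: ('n \<Rightarrow> int) set)) * (?n * (1/3) ^ s j) powr t)"
    proof (rule hausdorff_premeasure_le_finite_cover[where U = "\<lambda>v. {y \<in> cube. box_of j y = v}"])
      show "cube \<subseteq> (\<Union>v\<in>boxes j. {y :: real ^ 'n. y \<in> cube \<and> box_of j y = v})"
        using box_of_in_boxes by blast
      fix v and y z :: "real ^ 'n" assume "y \<in> {y \<in> cube. box_of j y = v}" "z \<in> {y \<in> cube. box_of j y = v}"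
      then have "box_of j y = box_of j z" by simp
      then have "(\<Sum>i\<in>UNIV. \<bar>(y - z) $ i\<bar>) \<le> (\<Sum>i\<in>(UNIV :: 'n set). (1/3) ^ s j)"
        using box_of_eq_imp_near by (intro sum_mono) simp
      then show "mdist euclidean_metric y z \<le> ?n * (1/3) ^ s j"
        using norm_le_l1_cart[of "y - z"] by (simp add: dist_norm)
    qed (use finite_boxes r assms(1) in auto)
    also have "real (card (boxes j :: ('n \<Rightarrow> int) set)) * (?n * (1/3) ^ s j) powr t
        \<le> 3 powr (t * s j + ?n) * (?n * (1/3) ^ s j) powr t"
    proof (intro mult_right_mono)
      have "real (card (boxes j :: ('n \<Rightarrow> int) set)) \<le> real (3 ^ (?n * digits_before j))"
        by (intro of_nat_mono card_boxes)
      also have "\<dots> = 3 powr real (?n * digits_before j)"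
        unfolding of_nat_power of_nat_numeral by (rule powr_realpow[symmetric]) simp
      also have "\<dots> \<le> 3 powr (t * s j + ?n)" using digits by (intro powr_mono) auto
      finally show "real (card (boxes j :: ('n \<Rightarrow> int) set)) \<le> 3 powr (t * s j + ?n)" .
    qed simp
    also have "\<dots> = ?c"
    proof -
      have "(1/3 :: real) ^ s j = 3 powr (- real (s j))"
        by (simp add: powr_minus_divide powr_realpow power_divide)
      then have "(?n * (1/3) ^ s j) powr t = real ?n powr t * 3 powr (- (t * s j))"
        by (simp only:, subst powr_mult) (auto simp: powr_powr mult.commute)
      moreover have "3 powr (t * s j + ?n) * 3 powr (- (t * s j)) = 3 ^ ?n"
        unfolding powr_add[symmetric] by (simp add: powr_realpow)
      ultimately show ?thesis by (simp add: mult_ac)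
    qed
    finally show ?thesis by (simp add: ennreal_leI)
  qed
  then have "hausdorff_outer euclidean_metric t (cube :: (real ^ 'n) set) \<le> ennreal ?c"
    unfolding hausdorff_outer_def by (intro SUP_least) auto
  then show ?thesis by (simp add: le_less_trans)
qed

text \<open>Spreading the triadic digits of \<open>z\<close> over the free positions gives an inverse of a Hoelder
  map from the Cantor set onto the unit interval.\<close>

definition spread_digit :: "nat \<Rightarrow> real \<Rightarrow> real" where
  "spread_digit j z = of_int (\<lfloor>3 ^ digits_before (Suc j) * z\<rfloor> mod 3 ^ (e j - s j)) * (1/3) ^ e j"

definition spread :: "real \<Rightarrow> real" where
  "spread z = (\<Sum>j. spread_digit j z)"

lemma power_third_diff: "3 ^ (e j - s j) * (1/3 :: real) ^ e j = (1/3) ^ s j"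
proof -
  have "(1/3::real) ^ e j = (1/3) ^ (e j - s j) * (1/3) ^ s j"
    using s_le_e[of j] by (simp add: power_add[symmetric])
  then show ?thesis using power_third_cancel[of "e j - s j"] by (simp only: mult.assoc[symmetric])
qed

lemma spread_digit_bounds: "0 \<le> spread_digit j z" "spread_digit j z \<le> (1/3) ^ s j - (1/3) ^ e j"
proof -
  show "0 \<le> spread_digit j z" by (simp add: spread_digit_def)
  let ?r = "\<lfloor>3 ^ digits_before (Suc j) * z\<rfloor> mod 3 ^ (e j - s j)"
  have "?r < 3 ^ (e j - s j)" by simp
  then have "?r \<le> 3 ^ (e j - s j) - 1" by simp
  then have "real_of_int ?r \<le> real_of_int (3 ^ (e j - s j) - 1)" by (simp only: of_int_le_iff)
  then have "real_of_int ?r * (1/3) ^ e j \<le> (3 ^ (e j - s j) - 1) * (1/3) ^ e j"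
    by (intro mult_right_mono) auto
  then show "spread_digit j z \<le> (1/3) ^ s j - (1/3) ^ e j"
    unfolding spread_digit_def left_diff_distrib power_third_diff by simp
qed

lemma spread_digit_le: "\<bar>spread_digit j z\<bar> \<le> (1/3) ^ s j"
proof -
  have "(0::real) < (1/3) ^ e j" by simp
  then show ?thesis using spread_digit_bounds[of j z] by linarith
qed

lemma summable_third_tail:
  fixes a :: "nat \<Rightarrow> real"
  assumes "\<And>i. \<bar>a i\<bar> \<le> (1/3) ^ s i"
  shows "summable a" "\<bar>\<Sum>i. a (i + Suc j)\<bar> \<le> (1/2) * (1/3) ^ e j"
proof -
  have bound: "norm (a (i + Suc j)) \<le> (1/3) ^ i * ((1/3) ^ Suc (e j))" for i j
  proof -
    have "s (Suc j) + i \<le> s (i + Suc j)"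
    proof (induction i)
      case (Suc i)
      then show ?case using s_le_e[of "i + Suc j"] e_less_s[of "i + Suc j"] by simp
    qed simp
    then have "Suc (e j) + i \<le> s (i + Suc j)" using e_less_s[of j] by simp
    then have "(1/3 :: real) ^ s (i + Suc j) \<le> (1/3) ^ (Suc (e j) + i)" by (rule power_third_mono)
    then show ?thesis using assms[of "i + Suc j"] by (simp add: power_add mult_ac)
  qed
  have g: "(\<lambda>i. (1/3 :: real) ^ i * c) sums (3 / 2 * c)" for c
    using sums_mult2[OF geometric_sums[of "1/3 :: real"], of c] by simp
  have "summable (\<lambda>i. a (i + Suc 0))" by (rule summable_comparison_test'[OF sums_summable[OF g] bound])
  then show "summable a" by (subst (asm) summable_iff_shift)
  show "\<bar>\<Sum>i. a (i + Suc j)\<bar> \<le> (1/2) * (1/3) ^ e j"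
    using norm_suminf_le[OF bound sums_summable[OF g], of j] sums_unique[OF g, of "(1/3) ^ Suc (e j)"] by simp
qed

lemma spread_split: "spread z = (\<Sum>i. spread_digit (i + Suc j) z) + (\<Sum>i<Suc j. spread_digit i z)"
  unfolding spread_def by (intro suminf_split_initial_segment summable_third_tail spread_digit_le)

lemma spread_tail:
  shows "0 \<le> (\<Sum>i. spread_digit (i + Suc j) z)" "(\<Sum>i. spread_digit (i + Suc j) z) \<le> (1/2) * (1/3) ^ e j"
proof -
  have "summable (\<lambda>i. spread_digit i z)" by (intro summable_third_tail spread_digit_le)
  then have "summable (\<lambda>i. spread_digit (i + Suc j) z)" by (subst summable_iff_shift)
  then show "0 \<le> (\<Sum>i. spread_digit (i + Suc j) z)" by (intro suminf_nonneg spread_digit_bounds)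
  show "(\<Sum>i. spread_digit (i + Suc j) z) \<le> (1/2) * (1/3) ^ e j"
    using summable_third_tail(2)[of "\<lambda>i. spread_digit i z" j] spread_digit_le by auto
qed

lemma spread_in_cantor: "spread z \<in> cantor"
proof -
  have top: "0 \<le> spread z" "spread z \<le> 1 - (1/2) * (1/3) ^ e 0"
    using spread_split[of z 0] spread_tail[where j = 0 and z = z] spread_digit_bounds[of 0 z] by (auto simp: s_0)
  have "\<exists>i\<in>{0..3 ^ e j :: int}. of_int i \<le> 3 ^ e j * spread z \<and>
      3 ^ e j * spread z \<le> of_int i + 3 ^ e j * ((1/3) ^ s (Suc j) - (1/2) * (1/3) ^ e (Suc j))" for j
  proof -
    \<comment> \<open>The integer formed by all digits up to position \<open>e j\<close>. The rest
      is at most the largest value of digit group \<open>Suc j\<close> plus half of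
      \<open>(1/3) ^ e (Suc j)\<close>, exactly the bound in \<open>cantor\<close>.\<close>
    define i :: int where
      "i = (\<Sum>l<Suc j. (\<lfloor>3 ^ digits_before (Suc l) * z\<rfloor> mod 3 ^ (e l - s l)) * 3 ^ (e j - e l))"
    have "3 ^ e j * (\<Sum>l<Suc j. spread_digit l z) = of_int i"
      unfolding i_def of_int_sum sum_distrib_left
    proof (rule sum.cong)
      fix l assume "l \<in> {..<Suc j}"
      then have "e l \<le> e j" by (intro e_mono) simp
      then have "(3::real) ^ e j = 3 ^ (e j - e l) * 3 ^ e l" by (simp add: power_add[symmetric])
      then have "(3::real) ^ e j * (1/3) ^ e l = 3 ^ (e j - e l)"
        using power_third_cancel[of "e l"] by (simp only: mult.assoc mult_1_right)
      then show "3 ^ e j * spread_digit l z =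
          of_int ((\<lfloor>3 ^ digits_before (Suc l) * z\<rfloor> mod 3 ^ (e l - s l)) * 3 ^ (e j - e l))"
        unfolding spread_digit_def by (simp add: mult.left_commute)
    qed simp
    then have eq: "3 ^ e j * spread z = of_int i + 3 ^ e j * (\<Sum>l. spread_digit (l + Suc j) z)"
      using spread_split[of z j] by (simp add: distrib_left)
    have "(\<Sum>l. spread_digit (l + Suc j) z) = (\<Sum>l. spread_digit (l + Suc (Suc j)) z) + spread_digit (Suc j) z"
      using spread_split[of z j] spread_split[of z "Suc j"] by simp
    also have "\<dots> \<le> (1/3) ^ s (Suc j) - (1/2) * (1/3) ^ e (Suc j)"
      using spread_tail(2)[where j = "Suc j" and z = z] spread_digit_bounds(2)[of "Suc j" z] by simp
    finally have up: "3 ^ e j * (\<Sum>l. spread_digit (l + Suc j) z)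
        \<le> 3 ^ e j * ((1/3) ^ s (Suc j) - (1/2) * (1/3) ^ e (Suc j))" by (intro mult_left_mono) auto
    have lo: "0 \<le> 3 ^ e j * (\<Sum>l. spread_digit (l + Suc j) z)"
      by (intro mult_nonneg_nonneg spread_tail) simp
    have "of_int i \<le> 3 ^ e j * spread z" using eq lo by linarith
    also have "\<dots> \<le> 3 ^ e j * 1"
    proof (intro mult_left_mono)
      have "(0::real) < (1/3) ^ e 0" by simp
      then show "spread z \<le> 1" using top(2) by linarith
    qed simp
    finally have "real_of_int i \<le> real_of_int (3 ^ e j)" by simp
    then have "i \<le> 3 ^ e j" by (simp only: of_int_le_iff)
    moreover have "0 \<le> i" unfolding i_def by (intro sum_nonneg) simp
    ultimately show ?thesis using eq up lo by (intro bexI[of _ i]) auto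
  qed
  then show ?thesis unfolding cantor_def using top by auto
qed

text \<open>At the first group where the digits differ, by \<open>N\<close> as integers,
  \<open>z - z'\<close> is at most 2|N| units of the last digit of that group, while the images
  differ by at least half of |N| units of the spread position. The assumption on the digit count
  compares these units.\<close>

lemma spread_holder:
  fixes \<gamma> :: real
  assumes z: "z \<in> {0..<1}" "z' \<in> {0..<1}"
    and \<gamma>: "0 < \<gamma>" "\<gamma> \<le> 1" and digits: "\<And>j. \<gamma> * s j \<le> digits_before j"
  shows "\<bar>z - z'\<bar> \<le> 4 * \<bar>spread z - spread z'\<bar> powr \<gamma>"
proof (cases "z = z'")
  case False
  let ?fl = "\<lambda>j (z :: real). \<lfloor>3 ^ digits_before j * z\<rfloor>"
  have near: "\<bar>z - z'\<bar> * 3 ^ digits_before j \<le> \<bar>of_int (?fl j z - ?fl j z')\<bar> + 1" for j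
  proof -
    have "\<bar>z - z'\<bar> * 3 ^ digits_before j = \<bar>3 ^ digits_before j * z - 3 ^ digits_before j * z'\<bar>"
      by (simp add: right_diff_distrib[symmetric] abs_mult)
    then show ?thesis by linarith
  qed
  have "\<exists>j. ?fl j z \<noteq> ?fl j z'"
  proof (rule ccontr)
    assume "\<not> ?thesis"
    then have le: "\<bar>z - z'\<bar> * 3 ^ digits_before j \<le> 1" for j using near[of j] by simp
    obtain k where k: "(1/3) ^ k < \<bar>z - z'\<bar>" using real_arch_pow_inv[of "\<bar>z - z'\<bar>" "1/3"] False by auto
    obtain j where "real k / \<gamma> \<le> real j" using real_arch_simple by blast
    then have "real k \<le> \<gamma> * j" using \<gamma> by (simp add: field_simps)
    also have "\<dots> \<le> \<gamma> * s j" using le_s[of j] \<gamma> by (intro mult_left_mono) auto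
    also have "\<dots> \<le> digits_before j" by (rule digits)
    finally have "k \<le> digits_before j" by simp
    then have "(3::real) ^ k \<le> 3 ^ digits_before j" by (intro power_increasing) auto
    then have "\<bar>z - z'\<bar> * 3 ^ k \<le> 1" using le[of j] mult_left_mono[of "3 ^ k" "3 ^ digits_before j" "\<bar>z - z'\<bar>"] by linarith
    moreover have "(1/3) ^ k * 3 ^ k < \<bar>z - z'\<bar> * 3 ^ k" using k by (intro mult_strict_right_mono) auto
    ultimately show False using power_third_cancel[of k] by (simp add: mult.commute)
  qed
  then obtain j1 where "?fl j1 z \<noteq> ?fl j1 z'" ..
  define l where "l = (LEAST j. ?fl j z \<noteq> ?fl j z')"
  have l: "?fl l z \<noteq> ?fl l z'" unfolding l_def by (rule LeastI) fact
  have least: "?fl i z = ?fl i z'" if "i < l" for i using that not_less_Least unfolding l_def by blast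
  have "\<lfloor>z\<rfloor> = 0" "\<lfloor>z'\<rfloor> = 0" using z by (auto simp: floor_eq_iff)
  then have "?fl 0 z = ?fl 0 z'" by (simp add: digits_before_def)
  then obtain j where j: "l = Suc j" using l by (cases l) auto
  let ?d = "e j - s j"
  have fl_div: "?fl (Suc j) x div 3 ^ ?d = ?fl j x" for x :: real
  proof -
    have "3 ^ digits_before (Suc j) * x / real_of_int (3 ^ ?d) = 3 ^ digits_before j * x"
      by (simp add: digits_before_Suc power_add)
    then show ?thesis using floor_divide_real_eq_div[of "3 ^ ?d" "3 ^ digits_before (Suc j) * x"] by simp
  qed
  define N where "N = ?fl (Suc j) z - ?fl (Suc j) z'"
  have N0: "N \<noteq> 0" using l by (simp add: N_def j)
  have "?fl j z = ?fl j z'" using least[of j] by (simp add: j)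
  then have N: "?fl (Suc j) z mod 3 ^ ?d - ?fl (Suc j) z' mod 3 ^ ?d = N"
    unfolding N_def minus_div_mult_eq_mod[symmetric] fl_div by simp
  define R where "R = \<bar>of_int N\<bar> * (1/3 :: real) ^ e j"
  have "spread_digit j z - spread_digit j z' = of_int N * (1/3) ^ e j"
    unfolding spread_digit_def N[symmetric] by (simp add: left_diff_distrib)
  then have R: "R = \<bar>spread_digit j z - spread_digit j z'\<bar>" by (simp add: R_def abs_mult)
  have N1: "1 \<le> \<bar>real_of_int N\<bar>" using N0 by linarith
  have R_ge: "(1/3) ^ e j \<le> R" unfolding R_def using mult_right_mono[OF N1, of "(1/3) ^ e j"] by simp
  have R_pos: "0 < R" using R_ge zero_less_power[of "1/3::real" "e j"] by linarith
  have R_le: "R \<le> (1/3) ^ s j"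
  proof -
    have "(0::real) < (1/3) ^ e j" by simp
    then show ?thesis
      unfolding R using spread_digit_bounds[of j z] spread_digit_bounds[of j z'] by linarith
  qed
  have "\<bar>z - z'\<bar> * 3 ^ digits_before (Suc j) \<le> 2 * \<bar>of_int N\<bar>"
    using near[of "Suc j"] N1 unfolding N_def[symmetric] by linarith
  also have "\<dots> = 2 * (R * 3 ^ e j)"
    unfolding R_def using power_third_cancel[of "e j"] by (simp add: mult_ac)
  finally have "\<bar>z - z'\<bar> * 3 ^ digits_before j * 3 ^ ?d \<le> 2 * R * 3 ^ s j * 3 ^ ?d"
    using s_le_e[of j] by (simp add: digits_before_Suc power_add[symmetric] mult_ac)
  then have "\<bar>z - z'\<bar> * 3 ^ digits_before j \<le> 2 * R * 3 ^ s j" by (rule mult_right_le_imp_le) simp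
  moreover have "\<bar>z - z'\<bar> * 3 powr (\<gamma> * s j) \<le> \<bar>z - z'\<bar> * 3 ^ digits_before j"
    using digits[of j] by (intro mult_left_mono) (auto simp: powr_realpow[symmetric] intro: powr_mono)
  ultimately have 1: "\<bar>z - z'\<bar> * 3 powr (\<gamma> * s j) \<le> 2 * R * 3 ^ s j" by linarith
  have "R * 3 ^ s j \<le> 1"
    using mult_right_mono[OF R_le, of "3 ^ s j"] power_third_cancel[of "s j"] by (simp add: mult.commute)
  \<comment> \<open>As \<open>R * 3 ^ s j\<close> is at most 1, lowering the exponent to \<gamma>
    enlarges it; therefore the digit count at \<open>s j\<close> controls all scales of the
    group.\<close>
  then have "(R * 3 ^ s j) powr 1 \<le> (R * 3 ^ s j) powr \<gamma>" using R_pos \<gamma> by (intro powr_mono') auto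
  also have "\<dots> = R powr \<gamma> * 3 powr (\<gamma> * s j)"
    using R_pos by (simp add: powr_mult powr_powr powr_realpow[symmetric] mult.commute)
  finally have "R * 3 ^ s j \<le> R powr \<gamma> * 3 powr (\<gamma> * s j)" using R_pos by simp
  with 1 have "\<bar>z - z'\<bar> * 3 powr (\<gamma> * s j) \<le> 2 * R powr \<gamma> * 3 powr (\<gamma> * s j)" by linarith
  then have zR: "\<bar>z - z'\<bar> \<le> 2 * R powr \<gamma>" by (rule mult_right_le_imp_le) simp
  have dig: "spread_digit i z = spread_digit i z'" if "i < j" for i
    unfolding spread_digit_def using least[of "Suc i"] that by (simp add: j)
  let ?a = "\<lambda>i. spread_digit i z - spread_digit i z'"
  have a: "\<bar>?a i\<bar> \<le> (1/3) ^ s i" for i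
  proof -
    have "(0::real) < (1/3) ^ e i" by simp
    then show ?thesis using spread_digit_bounds[of i z] spread_digit_bounds[of i z'] by linarith
  qed
  have "spread z - spread z' = (\<Sum>i. ?a i)"
    unfolding spread_def by (intro suminf_diff summable_third_tail spread_digit_le)
  also have "\<dots> = (\<Sum>i. ?a (i + Suc j)) + (\<Sum>i<Suc j. ?a i)"
    by (rule suminf_split_initial_segment[OF summable_third_tail(1)[OF a]])
  also have "(\<Sum>i<Suc j. ?a i) = ?a j" using dig by simp
  finally have "\<bar>spread z - spread z' - ?a j\<bar> \<le> (1/2) * (1/3) ^ e j"
    using summable_third_tail(2)[of ?a, OF a, of j] by simp
  then have "R - \<bar>spread z - spread z'\<bar> \<le> (1/2) * (1/3) ^ e j"
    unfolding R by (rule order_trans[OF abs_triangle_ineq2_sym])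
  also have "\<dots> \<le> (1/2) * R" using R_ge by (intro mult_left_mono) auto
  finally have "R \<le> 2 * \<bar>spread z - spread z'\<bar>" by simp
  then have "R powr \<gamma> \<le> (2 * \<bar>spread z - spread z'\<bar>) powr \<gamma>" using R_pos \<gamma> by (intro powr_mono2) auto
  also have "\<dots> = 2 powr \<gamma> * \<bar>spread z - spread z'\<bar> powr \<gamma>" by (simp add: powr_mult)
  also have "\<dots> \<le> 2 powr 1 * \<bar>spread z - spread z'\<bar> powr \<gamma>" using \<gamma> by (intro mult_right_mono powr_mono) auto
  finally show ?thesis using zR by simp
qed simp

lemma spread_0_in_cube: "(\<chi> i. spread 0) \<in> cube"
  by (simp add: cube_def spread_in_cantor)

text \<open>A mass distribution argument: the preimage under the spreading map of a set of diameter
  \<open>d\<close> lies in a cube of volume \<open>8 ^ n * d powr t\<close>, with \<open>n\<close>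
  the number of coordinates, so subadditivity of Lebesgue measure bounds every cover sum below.
  Enclosing preimages in closed boxes makes their own measurability irrelevant.\<close>

lemma hausdorff_outer_cube_pos:
  fixes t :: real
  assumes "0 \<le> t" "t \<le> CARD('n)" and digits: "\<And>j. t * s j \<le> real (CARD('n) * digits_before j)"
  shows "0 < hausdorff_outer euclidean_metric t (cube :: (real ^ 'n) set)"
proof -
  let ?n = "CARD('n)"
  let ?m = "euclidean_metric :: (real ^ 'n) metric"
  have "\<exists>c>0. \<forall>U\<in>fine_covers ?m 1 cube. ennreal c \<le> (\<Sum>i. diam_pow ?m t (U i))"
  proof (cases "t = 0")
    \<comment> \<open>For \<open>t = 0\<close> the Hoelder exponent would vanish; here any cover has
      a nonempty member, which counts 1.\<close>
    case True
    have "ennreal 1 \<le> (\<Sum>i. diam_pow ?m t (U i))" if U: "U \<in> fine_covers ?m 1 cube" for U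
    proof -
      obtain k where "(\<chi> i. spread 0) \<in> U k" using U spread_0_in_cube unfolding fine_covers_def by blast
      then have "ennreal 1 = diam_pow ?m t (U k)" using True by (auto simp: diam_pow_def)
      also have "\<dots> = (\<Sum>i\<in>{k}. diam_pow ?m t (U i))" by simp
      also have "\<dots> \<le> (\<Sum>i. diam_pow ?m t (U i))" by (intro sum_le_suminf) auto
      finally show ?thesis .
    qed
    then show ?thesis by (intro exI[of _ 1]) auto
  next
    case False
    then have t: "0 < t" using assms(1) by simp
    \<comment> \<open>Equal exponents for the coordinates, so that side lengths of order
      \<open>d powr \<gamma>\<close> multiply to \<open>d powr t\<close>.\<close>
    define \<gamma> where "\<gamma> = t / ?n"
    have \<gamma>: "0 < \<gamma>" "\<gamma> \<le> 1" "\<And>j. \<gamma> * s j \<le> digits_before j"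
      using t assms(2) digits by (auto simp: \<gamma>_def field_simps)
    have "ennreal (1 / 8 ^ ?n) \<le> (\<Sum>i. diam_pow ?m t (U i))" if U: "U \<in> fine_covers ?m 1 cube" for U
    proof -
      define H :: "real ^ 'n \<Rightarrow> real ^ 'n" where "H z = (\<chi> i. spread (z $ i))" for z
      have fin: "ediam ?m (U k) < top" for k
      proof -
        have "ediam ?m (U k) \<le> ennreal 1" using U unfolding fine_covers_def by blast
        then show ?thesis by (rule le_less_trans) (rule ennreal_less_top)
      qed
      have "\<forall>k. \<exists>Q. {z \<in> box 0 1. H z \<in> U k} \<subseteq> Q \<and> Q \<in> sets lborel \<and>
          emeasure lborel Q \<le> ennreal (8 ^ ?n) * diam_pow ?m t (U k)"
      proof
        fix k
        show "\<exists>Q. {z \<in> box 0 1. H z \<in> U k} \<subseteq> Q \<and> Q \<in> sets lborel \<and>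
            emeasure lborel Q \<le> ennreal (8 ^ ?n) * diam_pow ?m t (U k)"
        proof (cases "\<exists>z0\<in>box 0 1. H z0 \<in> U k")
          case True
          then obtain z0 where z0: "z0 \<in> box 0 1" "H z0 \<in> U k" by blast
          define d where "d = enn2real (ediam ?m (U k))"
          define c where "c = 4 * d powr \<gamma>"
          let ?l = "(\<chi> i. z0 $ i - c) :: real ^ 'n" and ?u = "(\<chi> i. z0 $ i + c) :: real ^ 'n"
          have c: "0 \<le> c" by (simp add: c_def)
          have "{z \<in> box 0 1. H z \<in> U k} \<subseteq> cbox ?l ?u"
          proof
            fix z assume z: "z \<in> {z \<in> box 0 1. H z \<in> U k}"
            have "ennreal (dist (H z) (H z0)) \<le> ediam ?m (U k)"
              using ediam_ge[of "H z" "U k" "H z0" ?m] z z0 by simp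
            then have dist: "dist (H z) (H z0) \<le> d"
              using fin[of k] unfolding d_def by (metis enn2real_ennreal enn2real_mono zero_le_dist)
            have "\<bar>z $ i - z0 $ i\<bar> \<le> c" for i
            proof -
              have "\<bar>spread (z $ i) - spread (z0 $ i)\<bar> \<le> d"
                using component_le_norm_cart[of "H z - H z0" i] dist by (simp add: dist_norm H_def)
              then have "\<bar>spread (z $ i) - spread (z0 $ i)\<bar> powr \<gamma> \<le> d powr \<gamma>"
                using \<gamma> by (intro powr_mono2) auto
              moreover have "z $ i \<in> {0..<1}" "z0 $ i \<in> {0..<1}"
                using z z0 by (auto simp: mem_box_cart less_imp_le)
              ultimately show ?thesis using spread_holder[OF _ _ \<gamma>, of "z $ i" "z0 $ i"] by (simp add: c_def)
            qed
            then show "z \<in> cbox ?l ?u" by (simp add: mem_box_cart abs_le_iff algebra_simps)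
          qed
          moreover have "emeasure lborel (cbox ?l ?u) \<le> ennreal (8 ^ ?n) * diam_pow ?m t (U k)"
          proof -
            have diff: "(?u - ?l) \<bullet> b = 2 * c" if "b \<in> Basis" for b
              using that by (auto simp: Basis_vec_def inner_axis)
            then have "?l \<bullet> b \<le> ?u \<bullet> b" if "b \<in> Basis" for b
              using c that[THEN diff] by (simp add: inner_diff_left)
            then have "emeasure lborel (cbox ?l ?u) = ennreal (\<Prod>b\<in>Basis. (?u - ?l) \<bullet> b)"
              by (rule emeasure_lborel_cbox)
            also have "(\<Prod>b\<in>Basis. (?u - ?l) \<bullet> b) = (2 * c) ^ ?n" using diff by simp
            also have "2 * c = 8 * d powr \<gamma>" by (simp add: c_def)
            also have "(8 * d powr \<gamma>) ^ ?n = 8 ^ ?n * (d powr \<gamma>) ^ ?n" by (rule power_mult_distrib)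
            also have "(d powr \<gamma>) ^ ?n = d powr t"
            proof -
              have "(d powr \<gamma>) ^ ?n = (d powr \<gamma>) powr real ?n"
                by (cases "d = 0") (auto simp: powr_realpow d_def)
              then show ?thesis by (simp add: powr_powr \<gamma>_def)
            qed
            also have "ennreal (8 ^ ?n * d powr t) = ennreal (8 ^ ?n) * diam_pow ?m t (U k)"
              using z0 t by (auto simp: diam_pow_def d_def ennreal_mult)
            finally show ?thesis by simp
          qed
          ultimately show ?thesis by (intro exI[of _ "cbox ?l ?u"]) auto
        next
          case False
          then have "{z \<in> box 0 1. H z \<in> U k} \<subseteq> {}" by blast
          then show ?thesis by (intro exI[of _ "{}"]) simp
        qed
      qed
      then obtain Q where Q: "\<And>k. {z \<in> box 0 1. H z \<in> U k} \<subseteq> Q k" "\<And>k. Q k \<in> sets lborel"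
          "\<And>k. emeasure lborel (Q k) \<le> ennreal (8 ^ ?n) * diam_pow ?m t (U k)"
        unfolding choice_iff by blast
      have "H z \<in> cube" for z by (simp add: H_def cube_def spread_in_cantor)
      then have cover: "box 0 1 \<subseteq> (\<Union>k. Q k)" using U Q(1) unfolding fine_covers_def by blast
      have one: "(1 :: real ^ 'n) \<bullet> b = 1" if "b \<in> Basis" for b
        using that by (auto simp: Basis_vec_def inner_axis)
      then have "emeasure lborel (box 0 (1 :: real ^ 'n)) = ennreal (\<Prod>b\<in>Basis. ((1 :: real ^ 'n) - 0) \<bullet> b)"
        by (intro emeasure_lborel_box) simp
      also have "(\<Prod>b\<in>Basis. ((1 :: real ^ 'n) - 0) \<bullet> b) = 1" using one by (intro prod.neutral) simp
      finally have "1 = emeasure lborel (box 0 (1 :: real ^ 'n))" by simp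
      also have "\<dots> \<le> emeasure lborel (\<Union>k. Q k)"
        using Q(2) cover by (intro emeasure_mono) auto
      also have "\<dots> \<le> (\<Sum>k. emeasure lborel (Q k))"
        using Q(2) by (intro emeasure_subadditive_countably) auto
      also have "\<dots> \<le> (\<Sum>k. ennreal (8 ^ ?n) * diam_pow ?m t (U k))" by (intro suminf_le Q(3)) auto
      also have "\<dots> = ennreal (8 ^ ?n) * (\<Sum>k. diam_pow ?m t (U k))" by simp
      finally have "1 \<le> ennreal (8 ^ ?n) * (\<Sum>k. diam_pow ?m t (U k))" .
      then have "ennreal (1 / 8 ^ ?n) * 1 \<le> ennreal (1 / 8 ^ ?n) * (ennreal (8 ^ ?n) * (\<Sum>k. diam_pow ?m t (U k)))"
        by (intro mult_left_mono) auto
      then show ?thesis by (simp add: mult.assoc[symmetric] ennreal_mult[symmetric])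
    qed
    then show ?thesis by (intro exI[of _ "1 / 8 ^ ?n"]) auto
  qed
  then obtain c where c: "0 < c" "\<And>U. U \<in> fine_covers ?m 1 cube \<Longrightarrow> ennreal c \<le> (\<Sum>i. diam_pow ?m t (U i))"
    by blast
  have "0 < ennreal c" using c(1) by simp
  also have "\<dots> \<le> hausdorff_premeasure ?m t 1 cube"
    unfolding hausdorff_premeasure_def by (intro INF_greatest c(2))
  also have "\<dots> \<le> hausdorff_outer ?m t cube"
    unfolding hausdorff_outer_def by (intro SUP_upper) simp
  finally show ?thesis .
qed

end

section \<open>Choice of the parameters\<close>

context twisted_phases
begin

text \<open>The number of levels with unequal weights below \<open>s j\<close>: burst
  \<open>l\<close> contributes \<open>l\<close> of them.\<close>

definition burst_steps :: "nat \<Rightarrow> nat" where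
  "burst_steps j = (\<Sum>l\<in>{j0..<j}. l)"

lemma burst_steps_Suc: "burst_steps (Suc j) = burst_steps j + (if j0 \<le> j then j else 0)"
  by (auto simp: burst_steps_def)

lemma burst_steps_lower: "j0 \<le> j \<Longrightarrow> j * j \<le> 2 * burst_steps j + j + j0 * j0"
proof (induction j rule: dec_induct)
  case (step j)
  then show ?case by (simp add: burst_steps_Suc algebra_simps)
qed simp

text \<open>The sum is about \<open>j\<^sup>2 / 2\<close>; beyond the threshold the terms
  \<open>j\<close> and \<open>j0\<^sup>2\<close> use up at most half of
  \<open>j\<^sup>2\<close>.\<close>

lemma burst_steps_quadratic:
  assumes "2 * j0 + 4 \<le> j"
  shows "j * j \<le> 4 * burst_steps j" "j \<le> burst_steps j"
proof -
  have "j0 * (2 * j0 + 4) \<le> j0 * j" "(2 * j0 + 4) * j \<le> j * j" using assms by (intro mult_left_mono mult_right_mono; simp)+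
  moreover have "j * j \<le> 2 * burst_steps j + j + j0 * j0" using assms by (intro burst_steps_lower) simp
  ultimately show 1: "j * j \<le> 4 * burst_steps j" by (simp add: algebra_simps)
  have "4 * j \<le> j * j" using assms by (intro mult_right_mono) simp_all
  then show "j \<le> burst_steps j" using 1 by linarith
qed

section \<open>Moment method for the number of bad columns\<close>

lemma moment_nonneg: "0 \<le> moment p k"
  unfolding moment_def by (intro sum_nonneg) simp

lemma moment_le:
  assumes "0 \<le> p" "k \<le> l"
  shows "moment p l \<le> 3 ^ (l - k) * moment p k"
  using assms(2)
proof (induction l rule: dec_induct)
  case (step l)
  have w: "w l r powr p \<le> 1" for r using w_bounds[of l r] \<delta>_pos assms(1) by (intro powr_le1) auto
  have "moment p (Suc l) \<le> moment p l * 3"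
    unfolding moment_Suc using w[of 0] w[of 1] w[of 2] moment_nonneg by (intro mult_left_mono) auto
  also have "\<dots> \<le> 3 ^ (l - k) * moment p k * 3" using step by (intro mult_right_mono) auto
  finally show ?case using step(1) by (simp add: Suc_diff_le mult_ac)
qed simp

text \<open>Each light child contributes at most 1/8 and the heavy one at most 1, so a burst level
  multiplies the moment by at most 5/4 instead of the general 3.\<close>

lemma moment_burst:
  assumes "0 \<le> p" "\<delta> powr p \<le> 1/8" "j0 \<le> j" "i \<le> j"
  shows "moment p (e j + i) \<le> (5/4) ^ i * moment p (e j)"
  using assms(4)
proof (induction i)
  case (Suc i)
  let ?k = "e j + i"
  have k: "\<exists>l\<ge>j0. e l \<le> ?k \<and> ?k < e l + l" using assms(3) Suc.prems by (intro exI[of _ j]) auto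
  have "w ?k 0 powr p + w ?k 1 powr p + w ?k 2 powr p = 2 * \<delta> powr p + (1 - 2 * \<delta>) powr p"
    using k by (simp add: w_def)
  also have "\<dots> \<le> 2 * (1/8) + 1"
    using assms(1,2) \<delta>_pos \<delta>_le by (intro add_mono mult_left_mono powr_le1) auto
  finally have "moment p (Suc ?k) \<le> moment p ?k * (5/4)"
    unfolding moment_Suc using moment_nonneg by (intro mult_left_mono) auto
  also have "\<dots> \<le> (5/4) ^ i * moment p (e j) * (5/4)" using Suc by (intro mult_right_mono) auto
  finally show ?case by (simp add: mult_ac)
qed simp

text \<open>Relative to the factor 3 per level, each burst level gains 5/12; the leading 2 is the
  moment at level 0.\<close>

lemma moment_bound:
  assumes "0 \<le> p" "\<delta> powr p \<le> 1/8"
  shows "moment p (s j) \<le> 2 * 3 ^ s j * (5/12) ^ burst_steps j"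
proof (induction j)
  case 0
  have "moment p 0 = 2" by (simp add: moment_def)
  then show ?case by (simp add: s_0 burst_steps_def)
next
  case (Suc j)
  let ?i = "if j0 \<le> j then j else 0"
  have "moment p (s (Suc j)) \<le> 3 ^ (s (Suc j) - (e j + ?i)) * moment p (e j + ?i)"
    using e_le_s[of j] assms(1) by (intro moment_le) auto
  also have "\<dots> \<le> 3 ^ (s (Suc j) - (e j + ?i)) * ((5/4) ^ ?i * moment p (e j))"
  proof (intro mult_left_mono)
    show "moment p (e j + ?i) \<le> (5/4) ^ ?i * moment p (e j)" using moment_burst[OF assms, of j j] by simp
  qed simp
  also have "\<dots> \<le> 3 ^ (s (Suc j) - (e j + ?i)) * ((5/4) ^ ?i * (3 ^ (e j - s j) * moment p (s j)))"
    using assms(1) by (intro mult_left_mono moment_le s_le_e) auto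
  also have "\<dots> \<le> 3 ^ (s (Suc j) - (e j + ?i)) * ((5/4) ^ ?i * (3 ^ (e j - s j) * (2 * 3 ^ s j * (5/12) ^ burst_steps j)))"
    using Suc by (intro mult_left_mono) auto
  also have "\<dots> = 2 * 3 ^ s (Suc j) * (5/12) ^ burst_steps (Suc j)"
  proof -
    have "s (Suc j) = (s (Suc j) - (e j + ?i)) + ?i + (e j - s j) + s j"
      using e_le_s[of j] s_le_e[of j] by auto
    then have "(3::real) ^ s (Suc j) = 3 ^ (s (Suc j) - (e j + ?i)) * 3 ^ ?i * 3 ^ (e j - s j) * 3 ^ s j"
      by (metis power_add)
    moreover have "(5/4 :: real) ^ ?i = 3 ^ ?i * (5/12) ^ ?i" by (simp add: power_mult_distrib[symmetric])
    ultimately show ?thesis unfolding burst_steps_Suc power_add by (simp only: mult_ac)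
  qed
  finally show ?case .
qed

text \<open>Markov's inequality for the \<open>p\<close>-th moment of the masses.\<close>

lemma card_bad:
  assumes "0 \<le> p" "\<delta> powr p \<le> 1/8"
  shows "real (card (bad Q j)) / 3 ^ s j \<le> 2 * (5/12) ^ burst_steps j * 3 powr (Q * s j * p)"
proof -
  have fin: "finite (bad Q j)" by (rule finite_subset[of _ "{0..<2 * 3 ^ s j}"]) (auto simp: bad_def)
  have "real (card (bad Q j)) * 3 powr (- (Q * s j * p)) = (\<Sum>i\<in>bad Q j. ((1/3) powr (Q * s j)) powr p)"
    by (simp add: powr_powr powr_divide powr_minus_divide)
  also have "\<dots> \<le> (\<Sum>i\<in>bad Q j. W (s j) i powr p)"
    using assms(1) by (intro sum_mono powr_mono2) (auto simp: bad_def)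
  also have "\<dots> \<le> moment p (s j)"
    unfolding moment_def by (intro sum_mono2) (auto simp: bad_def)
  also have "\<dots> \<le> 2 * 3 ^ s j * (5/12) ^ burst_steps j" by (rule moment_bound[OF assms])
  finally have "real (card (bad Q j)) * 3 powr (- (Q * s j * p)) * 3 powr (Q * s j * p)
      \<le> 2 * 3 ^ s j * (5/12) ^ burst_steps j * 3 powr (Q * s j * p)" by (intro mult_right_mono) auto
  moreover have "3 powr (- (Q * s j * p)) * 3 powr (Q * s j * p) = 1" by (simp add: powr_add[symmetric])
  ultimately have "real (card (bad Q j)) \<le> 2 * 3 ^ s j * (5/12) ^ burst_steps j * 3 powr (Q * s j * p)"
    by (simp only: mult.assoc mult_1_right)
  then show ?thesis by (simp add: divide_le_eq mult_ac)
qed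

text \<open>The Markov loss is at most 2^(j^2/4), hence at most a factor 2 per burst level, and 2 *
  5/12 = 5/6 is still less than 1.\<close>

lemma bad_negligible:
  assumes p: "0 \<le> p" "\<delta> powr p \<le> 1/8" and s: "\<And>j. s j = K * j\<^sup>2" and small: "3 powr (Q * K * p) \<le> 2 powr (1/4)"
  shows "(\<lambda>j. real (card (bad Q j)) / 3 ^ s j) \<longlonglongrightarrow> 0"
proof (rule tendsto_sandwich[OF _ _ tendsto_const])
  show "\<forall>\<^sub>F j in sequentially. real (card (bad Q j)) / 3 ^ s j \<le> 2 * (5/6) ^ j"
    using eventually_ge_at_top[of "2 * j0 + 4"]
  proof eventually_elim
    fix j assume j: "2 * j0 + 4 \<le> j"
    have "real (j * j) \<le> real (4 * burst_steps j)" using burst_steps_quadratic(1)[OF j] by (rule of_nat_mono)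
    then have quarter: "(1/4) * real (j\<^sup>2) \<le> real (burst_steps j)" by (simp add: power2_eq_square)
    have "3 powr (Q * s j * p) = (3 powr (Q * K * p)) powr real (j\<^sup>2)"
      unfolding powr_powr s by (simp add: mult_ac)
    also have "\<dots> \<le> (2 powr (1/4)) powr real (j\<^sup>2)" by (intro powr_mono2 small) auto
    also have "\<dots> \<le> 2 powr real (burst_steps j)" unfolding powr_powr using quarter by (intro powr_mono) auto
    also have "\<dots> = 2 ^ burst_steps j" by (simp add: powr_realpow)
    finally have "2 * (5/12) ^ burst_steps j * 3 powr (Q * s j * p) \<le> 2 * (5/12) ^ burst_steps j * 2 ^ burst_steps j"
      by (intro mult_left_mono) auto
    also have "\<dots> = 2 * (5/6) ^ burst_steps j" by (simp add: power_mult_distrib[symmetric])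
    also have "\<dots> \<le> 2 * (5/6) ^ j" using burst_steps_quadratic(2)[OF j] by (intro mult_left_mono power_decreasing) auto
    finally show "real (card (bad Q j)) / 3 ^ s j \<le> 2 * (5/6) ^ j" using card_bad[OF p, of Q j] by linarith
  qed
  show "(\<lambda>j. 2 * (5/6 :: real) ^ j) \<longlonglongrightarrow> 0" by (intro tendsto_mult_right_zero LIMSEQ_power_zero) auto
qed simp

end

lemma twisted_phases_exist:
  fixes Q :: real
  assumes "phases s e" and s: "\<And>j. s j = K * j\<^sup>2" and "0 < K" "0 < Q"
  obtains \<delta> j0 where "twisted_phases s e \<delta> j0"
    "(\<lambda>j. real (card (twisted_phases.bad s e \<delta> j0 Q j)) / 3 ^ s j) \<longlonglongrightarrow> 0"
proof -
  \<comment> \<open>\<open>p\<close> solves \<open>3 powr (Q * K * p) = 2 powr (1/4)\<close>; then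
    \<delta> is the largest value allowed by the moment bound and by 1/4.\<close>
  define p where "p = ln 2 / (4 * Q * K * ln 3)"
  define \<delta> :: real where "\<delta> = min (1/4) ((1/8) powr (1/p))"
  have p: "0 < p" using assms by (simp add: p_def)
  have "Q * K * p * ln 3 = (1/4) * ln 2" using assms by (simp add: p_def)
  then have small: "3 powr (Q * K * p) \<le> 2 powr (1/4)" by (simp add: powr_def)
  have \<delta>: "0 < \<delta>" "\<delta> \<le> 1/4" by (auto simp: \<delta>_def)
  have "\<delta> powr p \<le> ((1/8) powr (1/p)) powr p"
    using \<delta> p by (intro powr_mono2) (auto simp: \<delta>_def)
  also have "\<dots> = 1/8" using p by (simp add: powr_powr)
  finally have \<delta>p: "\<delta> powr p \<le> 1/8" .
  obtain j0 where "1 / \<delta>\<^sup>2 < 3 ^ j0" using real_arch_pow[of 3 "1 / \<delta>\<^sup>2"] by auto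
  then have j0: "1 \<le> \<delta>\<^sup>2 * 3 ^ j0" using \<delta> by (simp add: field_simps)
  interpret twisted_phases s e \<delta> j0
    using assms(1) \<delta> j0 by (intro twisted_phases.intro cascade.intro twisted_phases_axioms.intro) auto
  show thesis
    using that[OF twisted_phases_axioms bad_negligible[OF _ \<delta>p s small]] p by simp
qed

section \<open>Integer scales with prescribed density of free digits\<close>

lemma phases_exist:
  fixes t :: real
  assumes "0 \<le> t" "t < real n"
  obtains K s e where "0 < K" "phases s e" "\<And>j. s j = K * j\<^sup>2"
    "\<And>j. t * s j \<le> real (n * phases.digits_before s e j)"
    "\<And>j. real (n * phases.digits_before s e j) \<le> t * s j + real n"
proof -
  have n: "0 < real n" using assms by linarith
  define \<tau> where "\<tau> = t / n"
  have \<tau>: "0 \<le> \<tau>" "\<tau> < 1" using assms n by (auto simp: \<tau>_def)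
  \<comment> \<open>The gap after block \<open>j\<close> has length at least K(1-\<tau>)(2j+1) - 1,
    and 4(2j+1) - 1 \<ge> 3j + 3.\<close>
  define K where "K = nat \<lceil>4 / (1 - \<tau>)\<rceil>"
  have K: "4 / (1 - \<tau>) \<le> K" unfolding K_def by linarith
  have K0: "0 < K"
  proof -
    have "0 < 4 / (1 - \<tau>)" using \<tau> by simp
    then have "0 < real K" using K by linarith
    then show ?thesis by simp
  qed
  have K4: "4 \<le> K * (1 - \<tau>)" using K \<tau> by (simp add: divide_le_eq)
  define s where "s j = K * j\<^sup>2" for j
  \<comment> \<open>The intended number of free digits before \<open>s j\<close>; rounding up adds
    less than one digit per coordinate, whence the summand \<open>real n\<close>.\<close>
  define a where "a j = nat \<lceil>\<tau> * s j\<rceil>" for j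
  define e where "e j = s j + (a (Suc j) - a j)" for j
  have s_mono: "s j \<le> s (Suc j)" for j
    unfolding s_def by (intro mult_left_mono power_mono) auto
  have a: "\<tau> * s j \<le> a j" "a j < \<tau> * s j + 1" for j
  proof -
    have "0 \<le> \<tau> * s j" using \<tau> by simp
    then show "\<tau> * s j \<le> a j" "a j < \<tau> * s j + 1" unfolding a_def by linarith+
  qed
  have a_mono: "a j \<le> a (Suc j)" for j
    unfolding a_def using s_mono[of j] \<tau> by (intro nat_mono ceiling_mono mult_left_mono) auto
  have e_le: "e j + 3 * j + 3 \<le> s (Suc j)" for j
  proof -
    have ds: "real (s (Suc j)) - real (s j) = K * (2 * j + 1)"
      by (simp add: s_def power2_eq_square algebra_simps)
    have "real (e j) = s j + (real (a (Suc j)) - real (a j))" using a_mono[of j] by (simp add: e_def)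
    also have "\<dots> \<le> s j + (\<tau> * s (Suc j) + 1 - \<tau> * s j)" using a(2)[of "Suc j"] a(1)[of j] by linarith
    also have "\<dots> = s (Suc j) + 1 - (1 - \<tau>) * (real (s (Suc j)) - real (s j))" by (simp add: algebra_simps)
    also have "\<dots> = s (Suc j) + 1 - (K * (1 - \<tau>)) * (2 * j + 1)" unfolding ds by (simp add: algebra_simps)
    also have "\<dots> \<le> real (s (Suc j)) + 1 - 4 * (2 * real j + 1)"
      using mult_right_mono[OF K4, of "real (2 * j + 1)"] by simp
    finally have "real (e j + 3 * j + 3) \<le> real (s (Suc j))" by simp
    then show ?thesis by (simp only: of_nat_le_iff)
  qed
  have ph: "phases s e"
  proof (rule phases.intro)
    show "s 0 = 0" by (simp add: s_def)
    show "s j \<le> e j" for j by (simp add: e_def)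
  qed (rule e_le)
  have digits: "phases.digits_before s e j = a j" for j
  proof (induction j)
    case 0
    have "a 0 = 0" by (simp add: a_def s_def)
    then show ?case by (simp add: phases.digits_before_def[OF ph])
  next
    case (Suc j)
    have "e j - s j = a (Suc j) - a j" by (simp add: e_def)
    then show ?case using a_mono[of j] Suc by (simp add: phases.digits_before_Suc[OF ph])
  qed
  have t: "t = \<tau> * n" using n by (simp add: \<tau>_def)
  show thesis
  proof (rule that[OF K0 ph])
    show "s j = K * j\<^sup>2" for j by (simp add: s_def)
    show "t * s j \<le> real (n * phases.digits_before s e j)" for j
      using mult_left_mono[OF a(1)[of j], of "real n"] by (simp add: digits t mult_ac)
    show "real (n * phases.digits_before s e j) \<le> t * s j + real n" for j
      using mult_left_mono[OF less_imp_le[OF a(2)[of j]], of "real n"] by (simp add: digits t algebra_simps)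
  qed
qed

section \<open>Dimension of the image measure\<close>

lemma sets_sigma_submetric:
  fixes Y :: "'b::metric_space set"
  assumes "Y \<in> sets borel"
  shows "sets (sigma (mspace (submetric euclidean_metric Y)) (borel_sets_of (mtopology_of (submetric euclidean_metric Y))))
    = sets (restrict_space borel Y)"
proof -
  have op: "{U. openin (top_of_set Y) U} = (\<inter>) Y ` {U. open U}"
    by (auto simp: openin_open)
  have borel: "sets (borel :: 'b measure) = sigma_sets UNIV {U. open U}"
    by (simp add: borel_def)
  have eq: "borel_sets_of (mtopology_of (submetric euclidean_metric Y)) = sigma_sets Y ((\<inter>) Y ` {U. open U})"
    by (simp add: borel_sets_of_def mtopology_of_submetric op)
  have "sets (sigma Y (sigma_sets Y ((\<inter>) Y ` {U. open U}))) = sigma_sets Y ((\<inter>) Y ` {U. open U})"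
  proof -
    have sub: "(\<inter>) Y ` {U. open U} \<subseteq> Pow Y" by auto
    have "sigma_sets Y ((\<inter>) Y ` {U. open U}) \<subseteq> Pow Y" using sigma_sets_into_sp[OF sub] by blast
    then show ?thesis by (simp add: sets_measure_of sigma_sets_sigma_sets_eq[OF sub])
  qed
  also have "\<dots> = sets (restrict_space borel Y)"
    using sigma_sets_Int[of Y UNIV "{U. open U}"] assms by (simp add: sets_restrict_space borel)
  finally show ?thesis unfolding eq by simp
qed

lemma pushforward_hausdorff_dim_le:
  fixes F :: "'a::metric_space \<Rightarrow> 'b::metric_space"
  assumes Y: "Y \<in> sets borel" and \<nu>: "sets \<nu> = sets (restrict_space borel T)"
    and F: "continuous_on T F" "F ` T \<subseteq> Y"
    and A: "A \<in> sets borel" "emeasure \<nu> {p \<in> T. F p \<notin> A} = 0" "hausdorff_outer euclidean_metric \<sigma> A = 0"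
    and "0 \<le> \<sigma>"
  shows "measure_hausdorff_dim (submetric euclidean_metric Y) (borel_pushforward \<nu> (submetric euclidean_metric Y) F)
    \<le> ennreal \<sigma>"
proof -
  define N where
    "N = sigma (mspace (submetric euclidean_metric Y)) (borel_sets_of (mtopology_of (submetric euclidean_metric Y)))"
  have N: "sets N = sets (restrict_space borel Y)" unfolding N_def by (rule sets_sigma_submetric[OF Y])
  have space: "space \<nu> = T" "space N = Y"
    using sets_eq_imp_space_eq[OF \<nu>] sets_eq_imp_space_eq[OF N] by (auto simp: space_restrict_space)
  have "F \<in> measurable (restrict_space borel T) (restrict_space borel Y)"
    using F by (intro measurable_restrict_space2 borel_measurable_continuous_on_restrict)
      (auto simp: space_restrict_space)
  then have meas: "F \<in> measurable \<nu> N" using measurable_cong_sets[OF \<nu> N] by simp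
  have AY: "A \<inter> Y \<in> sets N" unfolding N sets_restrict_space using A(1) by (auto simp: Int_commute)
  show ?thesis
    unfolding borel_pushforward_def N_def[symmetric]
  proof (rule measure_hausdorff_dim_le[of "A \<inter> Y"])
    show "A \<inter> Y \<in> sets (distr \<nu> N F)" using AY by simp
    have "emeasure (distr \<nu> N F) (space (distr \<nu> N F) - A \<inter> Y) = emeasure \<nu> (F -` (Y - A \<inter> Y) \<inter> space \<nu>)"
      using AY space by (subst emeasure_distr[OF meas]) (auto intro: sets.compl_sets)
    also have "F -` (Y - A \<inter> Y) \<inter> space \<nu> = {p \<in> T. F p \<notin> A}" using F(2) space by auto
    finally show "emeasure (distr \<nu> N F) (space (distr \<nu> N F) - A \<inter> Y) = 0" using A(2) by simp
    have "hausdorff_outer (submetric euclidean_metric Y) \<sigma> (A \<inter> Y) \<le> hausdorff_outer euclidean_metric \<sigma> (A \<inter> Y)"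
      using \<open>0 \<le> \<sigma>\<close> by (intro hausdorff_outer_submetric_le) auto
    also have "\<dots> \<le> hausdorff_outer euclidean_metric \<sigma> A" by (intro hausdorff_outer_mono) auto
    finally show "hausdorff_outer (submetric euclidean_metric Y) \<sigma> (A \<inter> Y) = 0" using A(3) by simp
  qed fact
qed

lemma homeomorphic_map_compact:
  fixes F :: "'a::metric_space \<Rightarrow> 'b::metric_space"
  assumes "compact T" "continuous_on T F" "inj_on F T"
  shows "homeomorphic_map (top_of_set T) (top_of_set (F ` T)) F"
  using assms
  by (intro continuous_imp_homeomorphic_map) (auto simp: Hausdorff_space_subtopology compact_space_subtopology)

text \<open>The complement of the support is the union of the relatively open null sets.\<close>

lemma compact_spt:
  fixes S :: "'a::metric_space set"
  assumes "compact S"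
  shows "compact (spt (submetric euclidean_metric S) \<nu>)" "spt (submetric euclidean_metric S) \<nu> \<subseteq> S"
proof -
  let ?T = "spt (submetric euclidean_metric S) \<nu>"
  show sub: "?T \<subseteq> S" by (auto simp: spt_def)
  have "S - ?T = \<Union>{U. openin (top_of_set S) U \<and> \<not> 0 < emeasure \<nu> U}"
    using openin_imp_subset by (fastforce simp: spt_def mtopology_of_submetric)
  also have "openin (top_of_set S) \<dots>" by (rule openin_Union) blast
  finally have "closedin (top_of_set S) ?T" using sub by (simp add: closedin_def double_diff)
  then show "compact ?T" by (rule closedin_compact[OF assms])
qed

section \<open>Application to the strip and its measure\<close>

context phases
begin

abbreviation (input) strip_measure :: "real \<Rightarrow> (real \<times> (real ^ 'n)) measure" where
  "strip_measure t \<equiv> restrict_space (hausdorff_measure euclidean_metric (1 + t)) strip"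

lemma strip_borel: "(strip :: (real \<times> (real ^ 'n)) set) \<in> sets borel"
  using compact_strip by (intro borel_closed compact_imp_closed)

lemma sets_strip_measure: "sets (strip_measure t) = sets (restrict_space borel strip)"
  by (intro sets_restrict_space_cong sets_hausdorff_measure_euclidean)

end

context twisted_phases
begin

lemma quasisymmetric_embedding_twist:
  "quasisymmetric_embedding (submetric euclidean_metric strip) euclidean_metric
     (twist :: real \<times> (real ^ 'n) \<Rightarrow> _)"
  using quasisymmetric_twist[of strip UNIV] homeomorphic_map_compact[OF compact_strip continuous_on_twist inj_on_twist]
  unfolding quasisymmetric_embedding_def embedding_map_def by (simp add: mtopology_of_submetric)

context
  fixes A :: "(real \<times> (real ^ 'n)) set" and \<sigma> t :: real
  assumes A: "A \<in> sets borel" "hausdorff_outer euclidean_metric \<sigma> A = 0"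
    "hausdorff_outer euclidean_metric (1 + t) {p \<in> strip. twist p \<notin> A} = 0"
    and \<sigma>: "0 \<le> \<sigma>"
begin

text \<open>The measure agrees with the outer measure on Borel sets, so the exceptional set must
  first be shown Borel; this follows from continuity of \<open>twist\<close>.\<close>

lemma emeasure_strip_measure_exceptional:
  "{p \<in> strip. twist p \<notin> A} \<in> sets (strip_measure t)" "emeasure (strip_measure t) {p \<in> strip. twist p \<notin> A} = 0"
proof -
  let ?B = "{p \<in> strip. twist p \<notin> A}"
  have "twist \<in> borel_measurable (restrict_space borel (strip :: (real \<times> (real ^ 'n)) set))"
    by (intro borel_measurable_continuous_on_restrict continuous_on_twist)
  then have "twist -` (- A) \<inter> space (restrict_space borel strip) \<in> sets (restrict_space borel (strip :: (real \<times> (real ^ 'n)) set))"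
    using borel_comp[OF A(1)] by (rule measurable_sets)
  also have "twist -` (- A) \<inter> space (restrict_space borel strip) = ?B" by (auto simp: space_restrict_space)
  finally show B: "?B \<in> sets (strip_measure t)" unfolding sets_strip_measure .
  then have "?B \<in> sets borel"
    unfolding sets_strip_measure using strip_borel by (subst (asm) sets_restrict_space_iff) auto
  then have "?B \<in> sets (hausdorff_measure euclidean_metric (1 + t))"
    by (simp only: sets_hausdorff_measure_euclidean)
  then have "?B \<in> borel_sets_of (mtopology_of euclidean_metric)"
    by (simp only: sets_hausdorff_measure)
  then have "emeasure (hausdorff_measure euclidean_metric (1 + t)) ?B = 0"
    unfolding A(3)[symmetric] by (rule emeasure_hausdorff_measure)
  then show "emeasure (strip_measure t) ?B = 0"
    using strip_borel by (subst emeasure_restrict_space) (auto simp: sets_hausdorff_measure_euclidean)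
qed

lemma twist_pushforward_dim:
  "measure_hausdorff_dim euclidean_metric
     (borel_pushforward (strip_measure t) euclidean_metric (twist :: real \<times> (real ^ 'n) \<Rightarrow> _)) \<le> ennreal \<sigma>"
  using pushforward_hausdorff_dim_le[OF _ sets_strip_measure continuous_on_twist _ A(1) emeasure_strip_measure_exceptional(2) A(2) \<sigma>, of UNIV]
  by simp

text \<open>The support enters only as some compact subset of the strip: restricting
  \<open>twist\<close> to it gives an admissible homeomorphism, and the exceptional set only
  shrinks.\<close>

lemma conformal_dim_strip_le:
  "conformal_dim (submetric euclidean_metric (strip :: (real \<times> (real ^ 'n)) set)) (strip_measure t) \<le> ennreal \<sigma>"
proof -
  let ?X = "submetric euclidean_metric (strip :: (real \<times> (real ^ 'n)) set)"
  define T where "T = spt ?X (strip_measure t)"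
  have T: "compact T" "T \<subseteq> strip" unfolding T_def by (intro compact_spt compact_strip)+
  let ?Y = "submetric euclidean_metric (twist ` T)"
  have cont: "continuous_on T twist" by (rule continuous_on_subset[OF continuous_on_twist T(2)])
  have sub: "submetric ?X T = submetric euclidean_metric T" using T(2) by (simp add: Int_absorb1)
  have "quasisymmetric_homeo (submetric ?X T) ?Y twist"
    unfolding quasisymmetric_homeo_def sub
    using quasisymmetric_twist[OF T(2) order_refl]
      homeomorphic_map_compact[OF T(1) cont inj_on_subset[OF inj_on_twist T(2)]]
    by (simp add: mtopology_of_submetric)
  then have "conformal_dim ?X (strip_measure t)
      \<le> measure_hausdorff_dim ?Y (borel_pushforward (restrict_space (strip_measure t) T) ?Y twist)"
    unfolding conformal_dim_def T_def[symmetric] by (intro Inf_lower) blast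
  also have "\<dots> \<le> ennreal \<sigma>"
  proof (rule pushforward_hausdorff_dim_le[OF _ _ cont order_refl A(1) _ A(2) \<sigma>])
    show "twist ` T \<in> sets borel"
      using compact_continuous_image[OF cont T(1)] by (intro borel_closed compact_imp_closed)
    have "sets (restrict_space (strip_measure t) T) = sets (restrict_space (restrict_space borel strip) T)"
      by (intro sets_restrict_space_cong sets_strip_measure)
    then show "sets (restrict_space (strip_measure t) T) = sets (restrict_space borel T)"
      using T(2) by (simp add: sets_restrict_restrict_space Int_absorb1)
    have "T \<in> sets borel" using T(1) by (intro borel_closed compact_imp_closed)
    then have "T \<in> sets (strip_measure t)"
      unfolding sets_strip_measure using strip_borel T(2) by (subst sets_restrict_space_iff) auto
    then have "T \<inter> space (strip_measure t) \<in> sets (strip_measure t)" by auto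
    then have "emeasure (restrict_space (strip_measure t) T) {p \<in> T. twist p \<notin> A} = emeasure (strip_measure t) {p \<in> T. twist p \<notin> A}"
      by (rule emeasure_restrict_space) auto
    also have "\<dots> \<le> emeasure (strip_measure t) {p \<in> strip. twist p \<notin> A}"
      using T(2) by (intro emeasure_mono emeasure_strip_measure_exceptional) auto
    finally show "emeasure (restrict_space (strip_measure t) T) {p \<in> T. twist p \<notin> A} = 0"
      using emeasure_strip_measure_exceptional(2) by simp
  qed
  finally show ?thesis .
qed

end

end

theorem theorem1p6:
  fixes d :: nat and t :: real
  assumes "d \<ge> 2" and "CARD('n::finite) = d - 1" and "0 \<le> t" and "t < real d - 1"
  shows "\<exists>E :: (real ^ 'n) set.
           compact E \<and>
           0 < hausdorff_outer euclidean_metric t E \<and>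
           hausdorff_outer euclidean_metric t E < \<infinity> \<and>
           (let S = {0..1::real} \<times> E;
                X = submetric euclidean_metric S;
                \<nu> = restrict_space (hausdorff_measure euclidean_metric (1 + t)) S
            in conformal_dim X \<nu> = 0 \<and>
               (\<forall>\<epsilon>>0. \<exists>F :: real \<times> (real ^ 'n) \<Rightarrow> real \<times> (real ^ 'n).
                  quasisymmetric_embedding X euclidean_metric F \<and>
                  measure_hausdorff_dim euclidean_metric (borel_pushforward \<nu> euclidean_metric F)
                    < ennreal \<epsilon>))"
proof -
  have t: "t < real CARD('n)" using assms by (simp add: of_nat_diff)
  obtain K s e where K: "0 < K" and ph: "phases s e" and s: "\<And>j. s j = K * j\<^sup>2"
    and lower: "\<And>j. t * s j \<le> real (CARD('n) * phases.digits_before s e j)"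
    and upper: "\<And>j. real (CARD('n) * phases.digits_before s e j) \<le> t * s j + real CARD('n)"
    using phases_exist[OF assms(3) t] by blast
  interpret phases s e by fact
  define Z where "Z = (strip :: (real \<times> (real ^ 'n)) set)"
  define X where "X = submetric euclidean_metric Z"
  define \<nu> where "\<nu> = restrict_space (hausdorff_measure euclidean_metric (1 + t)) Z"
  have main: "conformal_dim X \<nu> \<le> ennreal \<sigma> \<and>
      (\<exists>F :: real \<times> (real ^ 'n) \<Rightarrow> real \<times> (real ^ 'n). quasisymmetric_embedding X euclidean_metric F \<and>
        measure_hausdorff_dim euclidean_metric (borel_pushforward \<nu> euclidean_metric F) \<le> ennreal \<sigma>)"
    if \<sigma>: "0 < \<sigma>" for \<sigma>
  proof -
    \<comment> \<open>The smallest contraction exponent that \<open>twist_small_dimension\<close>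
      admits for \<sigma>; the set is already fixed at this point.\<close>
    define Q where "Q = (2 + t) / \<sigma>"
    have Q: "0 < Q" "2 + t \<le> Q * \<sigma>" using \<sigma> assms(3) by (auto simp: Q_def)
    obtain \<delta> j0 where tw: "twisted_phases s e \<delta> j0"
      and bad: "(\<lambda>j. real (card (twisted_phases.bad s e \<delta> j0 Q j)) / 3 ^ s j) \<longlonglongrightarrow> 0"
      using twisted_phases_exist[OF ph s K Q(1)] by blast
    interpret twisted_phases s e \<delta> j0 by (rule tw)
    obtain A :: "(real \<times> (real ^ 'n)) set" where A: "A \<in> sets borel"
        "hausdorff_outer euclidean_metric \<sigma> A = 0"
        "hausdorff_outer euclidean_metric (1 + t) {p \<in> strip. twist p \<notin> A} = 0"
      using twist_small_dimension[OF assms(3) \<sigma> Q(2) upper bad] by blast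
    show ?thesis
      unfolding X_def \<nu>_def Z_def
      using conformal_dim_strip_le[OF A less_imp_le[OF \<sigma>]] twist_pushforward_dim[OF A less_imp_le[OF \<sigma>]]
        quasisymmetric_embedding_twist by blast
  qed
  have "conformal_dim X \<nu> \<le> 0 + ennreal \<sigma>" if "0 < \<sigma>" for \<sigma> using main[OF that] by simp
  then have "conformal_dim X \<nu> \<le> 0" by (rule ennreal_le_epsilon)
  then have zero: "conformal_dim X \<nu> = 0" by simp
  have small: "\<exists>F :: real \<times> (real ^ 'n) \<Rightarrow> real \<times> (real ^ 'n). quasisymmetric_embedding X euclidean_metric F \<and>
      measure_hausdorff_dim euclidean_metric (borel_pushforward \<nu> euclidean_metric F) < ennreal \<epsilon>"
    if "0 < \<epsilon>" for \<epsilon>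
  proof -
    have "ennreal (\<epsilon> / 2) < ennreal \<epsilon>" using that by (intro ennreal_lessI) auto
    then show ?thesis using main[of "\<epsilon> / 2"] that by (meson half_gt_zero le_less_trans)
  qed
  show ?thesis
  proof (intro exI[of _ cube] conjI)
    show "compact (cube :: (real ^ 'n) set)" by (rule compact_cube)
    show "0 < hausdorff_outer euclidean_metric t (cube :: (real ^ 'n) set)"
      using assms(3) t lower by (intro hausdorff_outer_cube_pos) auto
    show "hausdorff_outer euclidean_metric t (cube :: (real ^ 'n) set) < \<infinity>"
      using assms(3) upper by (intro hausdorff_outer_cube_finite)
    show "let S = {0..1::real} \<times> cube; X = submetric euclidean_metric S;
        \<nu> = restrict_space (hausdorff_measure euclidean_metric (1 + t)) S
      in conformal_dim X \<nu> = 0 \<and>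
         (\<forall>\<epsilon>>0. \<exists>F :: real \<times> (real ^ 'n) \<Rightarrow> real \<times> (real ^ 'n).
            quasisymmetric_embedding X euclidean_metric F \<and>
            measure_hausdorff_dim euclidean_metric (borel_pushforward \<nu> euclidean_metric F) < ennreal \<epsilon>)"
      unfolding Let_def strip_def[symmetric] Z_def[symmetric] X_def[symmetric] \<nu>_def[symmetric]
      using zero small by blast
  qed
qed

end
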